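(* There is an algorithm that, given a monotone submodular function $f:2^E\to\mathbb{R}_+$, a weight function $w:E\to[0,1]$, and $\epsilon\in(0,1)$, outputs a (random) set $S\subseteq E$ with $w(S)\le 1$ (with probability one) satisfying \[ \mathbf{E}[f(S)]\ \ge\ \Bigl(1-\frac{c_f}{e}-\epsilon\Bigr) f(O), \] where $O\subseteq E$ is an optimal solution, i.e., a set with $w(O)\le 1$ maximizing $f$ among all sets of weight at most $1$. The running time is $O\bigl(n^5+n^4\,\mathrm{polylog}(n)\cdot(1/\epsilon)^{\mathrm{poly}(1/\epsilon)}\bigr)$, where $n=|E|$.
   Context: $E$ is a finite ground set and $f$ is accessed via value queries. For $S\subseteq E$, $w(S)=\sum_{e\in S}w(e)$. For $S,T\subseteq E$, $f_S(T)=f(S\cup T)-f(S)$, and $f(e)$ means $f(\{e\})$. The (total) curvature of $f$ is $c_f=1-\min_{e\in E}\frac{f_{E-e}(e)}{f(e)}\in[0,1]$. *)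

theory Defs
  imports "HOL-Probability.Probability" "HOL-Computational_Algebra.Polynomial"
begin

section \<open>Set functions and knapsack solutions\<close>

definition submodular_on :: "'a set \<Rightarrow> ('a set \<Rightarrow> real) \<Rightarrow> bool" where
  "submodular_on E f \<longleftrightarrow>
     (\<forall>S T. S \<subseteq> E \<and> T \<subseteq> E \<longrightarrow> f (S \<union> T) + f (S \<inter> T) \<le> f S + f T)"

definition marginal :: "('a set \<Rightarrow> real) \<Rightarrow> 'a set \<Rightarrow> 'a set \<Rightarrow> real" where
  "marginal f S T = f (S \<union> T) - f S"

text \<open>
  The ratio in the curvature is undefined at elements with \<open>f {e} = 0\<close>. For a nonnegative
  monotone submodular \<open>f\<close> all marginals of such an element vanish, so the minimum ranges over the
  other elements. If there are none then \<open>f\<close> is constant \<open>0\<close> on a nonempty ground set, and the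
  curvature is set to \<open>0\<close>.
\<close>

definition curvature :: "'a set \<Rightarrow> ('a set \<Rightarrow> real) \<Rightarrow> real" where
  "curvature E f =
     (let E' = {e \<in> E. f {e} \<noteq> 0} in
      if E' = {} then 0
      else 1 - Min ((\<lambda>e. marginal f (E - {e}) {e} / f {e}) ` E'))"

definition knapsack_feasible :: "'a set \<Rightarrow> ('a \<Rightarrow> real) \<Rightarrow> 'a set \<Rightarrow> bool" where
  "knapsack_feasible E w S \<longleftrightarrow> S \<subseteq> E \<and> sum w S \<le> 1"

definition knapsack_optimal ::
  "'a set \<Rightarrow> ('a set \<Rightarrow> real) \<Rightarrow> ('a \<Rightarrow> real) \<Rightarrow> 'a set \<Rightarrow> bool" where
  "knapsack_optimal E f w S \<longleftrightarrow>
     knapsack_feasible E w S \<and> (\<forall>T. knapsack_feasible E w T \<longrightarrow> f T \<le> f S)"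


section \<open>Randomized real RAM programs with a value oracle\<close>

text \<open>
  The machine has countably many arrays of natural numbers and of reals, all initialised to \<open>0\<close>.
  The array name is a constant of the program text, so a program uses finitely many arrays; the
  index is computed, which gives indirect addressing. Naturals support only addition and truncated
  subtraction, and a real can never be turned into a natural (no rounding), so that unit-cost
  arithmetic cannot be abused to pack unbounded computations into single numbers.

  The instance is read-only: \<open>n\<close>, the weights and the accuracy parameter are data available
  to the program, while the objective is available only through \<open>RQuery k i\<close>, the value of the set
  \<open>{j < n. k[i + j] \<noteq> 0}\<close> whose characteristic vector is stored in the
  natural-number array \<open>k\<close> starting at position \<open>i\<close>.
\<close>

record rinstance =
  ground_size :: nat
  weight_at :: "nat \<Rightarrow> real"
  accuracy :: real
  set_value :: "nat set \<Rightarrow> real"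

datatype nexp =
    NConst nat
  | NSize
  | NRead nat nexp
  | NAdd nexp nexp
  | NSub nexp nexp

datatype rexp =
    ROfNat nexp
  | RRead nat nexp
  | RAccuracy
  | RWeight nexp
  | RQuery nat nexp
  | RAdd rexp rexp
  | RSub rexp rexp
  | RMul rexp rexp
  | RDiv rexp rexp

datatype bexp =
    BNatLess nexp nexp
  | BRealLess rexp rexp
  | BNot bexp
  | BAnd bexp bexp

datatype com =
    CSkip
  | CNatSet nat nexp nexp
  | CRealSet nat nexp rexp
  | CFlip nat nexp rexp
  | CSeq com com
  | CIf bexp com com
  | CWhile bexp com

record rstate =
  nmem :: "nat \<Rightarrow> nat \<Rightarrow> nat"
  rmem :: "nat \<Rightarrow> nat \<Rightarrow> real"

definition stored_set :: "rinstance \<Rightarrow> rstate \<Rightarrow> nat \<Rightarrow> nat \<Rightarrow> nat set" where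
  "stored_set I s k i = {j. j < ground_size I \<and> nmem s k (i + j) \<noteq> 0}"

primrec neval :: "rinstance \<Rightarrow> rstate \<Rightarrow> nexp \<Rightarrow> nat" where
  "neval I s (NConst c) = c"
| "neval I s NSize = ground_size I"
| "neval I s (NRead k a) = nmem s k (neval I s a)"
| "neval I s (NAdd a b) = neval I s a + neval I s b"
| "neval I s (NSub a b) = neval I s a - neval I s b"

primrec reval :: "rinstance \<Rightarrow> rstate \<Rightarrow> rexp \<Rightarrow> real" where
  "reval I s (ROfNat a) = real (neval I s a)"
| "reval I s (RRead k a) = rmem s k (neval I s a)"
| "reval I s RAccuracy = accuracy I"
| "reval I s (RWeight a) = weight_at I (neval I s a)"
| "reval I s (RQuery k a) = set_value I (stored_set I s k (neval I s a))"
| "reval I s (RAdd a b) = reval I s a + reval I s b"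
| "reval I s (RSub a b) = reval I s a - reval I s b"
| "reval I s (RMul a b) = reval I s a * reval I s b"
| "reval I s (RDiv a b) = reval I s a / reval I s b"

primrec beval :: "rinstance \<Rightarrow> rstate \<Rightarrow> bexp \<Rightarrow> bool" where
  "beval I s (BNatLess a b) = (neval I s a < neval I s b)"
| "beval I s (BRealLess a b) = (reval I s a < reval I s b)"
| "beval I s (BNot a) = (\<not> beval I s a)"
| "beval I s (BAnd a b) = (beval I s a \<and> beval I s b)"

definition nat_store :: "nat \<Rightarrow> nat \<Rightarrow> nat \<Rightarrow> rstate \<Rightarrow> rstate" where
  "nat_store k i v s = s\<lparr>nmem := (nmem s)(k := (nmem s k)(i := v))\<rparr>"

definition real_store :: "nat \<Rightarrow> nat \<Rightarrow> real \<Rightarrow> rstate \<Rightarrow> rstate" where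
  "real_store k i v s = s\<lparr>rmem := (rmem s)(k := (rmem s k)(i := v))\<rparr>"

text \<open>
  A configuration is a stack of commands still to be executed together with a memory state; it is
  halted when the stack is empty. Every step has unit cost. The expressions evaluated in a step are
  part of the fixed program, so a step performs at most a program-dependent constant number of
  arithmetic operations, comparisons, memory accesses and value queries. The command
  \<open>CFlip k a r\<close> stores the outcome of a coin flip of bias \<open>r\<close>
  (clamped to the unit interval by \<^const>\<open>bernoulli_pmf\<close>).
\<close>

fun rstep :: "rinstance \<Rightarrow> com list \<times> rstate \<Rightarrow> (com list \<times> rstate) pmf" where
  "rstep I ([], s) = return_pmf ([], s)"
| "rstep I (CSkip # K, s) = return_pmf (K, s)"
| "rstep I (CNatSet k a b # K, s) =
     return_pmf (K, nat_store k (neval I s a) (neval I s b) s)"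
| "rstep I (CRealSet k a r # K, s) =
     return_pmf (K, real_store k (neval I s a) (reval I s r) s)"
| "rstep I (CFlip k a r # K, s) =
     map_pmf (\<lambda>b. (K, nat_store k (neval I s a) (of_bool b) s)) (bernoulli_pmf (reval I s r))"
| "rstep I (CSeq c d # K, s) = return_pmf (c # d # K, s)"
| "rstep I (CIf b c d # K, s) = return_pmf ((if beval I s b then c else d) # K, s)"
| "rstep I (CWhile b c # K, s) =
     return_pmf (if beval I s b then (c # CWhile b c # K, s) else (K, s))"

definition run_pmf :: "com \<Rightarrow> rinstance \<Rightarrow> nat \<Rightarrow> (com list \<times> rstate) pmf" where
  "run_pmf P I t =
     ((\<lambda>p. bind_pmf p (rstep I)) ^^ t)
       (return_pmf ([P], \<lparr>nmem = (\<lambda>_ _. 0), rmem = (\<lambda>_ _. 0)\<rparr>))"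

text \<open>Worst-case running time: all outcomes of the coin flips lead to a halt within \<open>t\<close> steps.\<close>

definition halts_within :: "com \<Rightarrow> rinstance \<Rightarrow> nat \<Rightarrow> bool" where
  "halts_within P I t \<longleftrightarrow> (\<forall>cfg \<in> set_pmf (run_pmf P I t). fst cfg = [])"

text \<open>
  The ground set is presented to the machine through an enumeration \<open>es\<close> without repetitions:
  index \<open>i < length es\<close> stands for the element \<open>es ! i\<close>.
\<close>

definition knapsack_instance ::
  "'a list \<Rightarrow> ('a set \<Rightarrow> real) \<Rightarrow> ('a \<Rightarrow> real) \<Rightarrow> real \<Rightarrow> rinstance" where
  "knapsack_instance es f w \<epsilon> =
     \<lparr>ground_size = length es,
      weight_at = (\<lambda>i. if i < length es then w (es ! i) else 0),
      accuracy = \<epsilon>,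
      set_value = (\<lambda>J. f ((!) es ` J))\<rparr>"

text \<open>
  The set output after \<open>t\<close> steps (for a run halting within \<open>t\<close> steps this no longer depends
  on \<open>t\<close>); its characteristic vector is read from the beginning of natural-number array \<open>0\<close>.
\<close>

definition output_pmf ::
  "com \<Rightarrow> 'a list \<Rightarrow> ('a set \<Rightarrow> real) \<Rightarrow> ('a \<Rightarrow> real) \<Rightarrow> real \<Rightarrow> nat \<Rightarrow> 'a set pmf" where
  "output_pmf P es f w \<epsilon> t =
     (let I = knapsack_instance es f w \<epsilon> in
      map_pmf (\<lambda>cfg. (!) es ` stored_set I (snd cfg) 0 0) (run_pmf P I t))"

end

theory Submission
  imports Defs
begin

text \<open>
  Split \<open>f\<close> into the linear part \<open>e \<mapsto> f E - f (E - {e})\<close> and the remaining monotone submodular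
  \<open>curved\<close> part. A solution assigns levels \<open>1, \<dots>, L\<close> to its elements, and a non-oblivious
  potential averages the curved part over all selections of levels; at a local optimum of this
  potential plus the linear part, exchange inequalities give a fraction
  \<open>1 - 1 / exp 1 - O(1 / L)\<close> of the curved part and all of the linear part of any comparison solution, which is the guarantee in
  terms of the curvature.

  For the knapsack constraint guess a weight threshold \<open>\<tau>\<close>. Among the light elements the constraint
  becomes a convex penalty on their total weight, so that single insertions and deletions suffice
  for the local search. The boundedly many heavy elements of the solution are placed in slots: the
  guessed sequence of slots says which one to refill next, and the lightest heavy element with a
  sufficient gain is never heavier than the element of the comparison solution it stands for.
  Room for the rounding errors comes from deleting from the optimum a block of elements,
  consecutive in the order of weight, that contributes little. All guesses are
  enumerated, so the program flips no coins.
\<close>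

section \<open>Monotone submodular functions\<close>

text \<open>Let \<open>N\<close> be about \<open>1 / \<epsilon>\<close>. Two demands on the
  steepness \<open>K\<close> of the penalty conflict. Treating its slope as constant during single
  moves costs about \<open>K * \<tau> * W\<close>, which must be of order \<open>v / N\<close>;
  keeping a local optimum away from the hard bound \<open>cap\<close> needs
  \<open>K * (cap - W) * W\<close> above \<open>L * v\<close>, with \<open>L\<close> of order
  \<open>N\<close>. Hence \<open>cap - W\<close> must be of order \<open>N * N * \<tau>\<close>:
  that many elements form the deleted block, and \<open>4 * N\<close> such blocks give the bound
  \<open>k\<close> on the number of heavy elements.

  A heavy exchange would shift the load too far for this linearization. Feasibility of the heavy
  part is instead certified by an injection into the heavy elements of the comparison solution.
  Apart from a threshold, a width and a scale for the value, that unknown solution influences the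
  run only through which slot is refilled, so digits below \<open>k\<close> can stand for it. Each
  useful refill gains \<open>\<theta>\<close> while the potential stays below \<open>L * v\<close>,
  which bounds the number of digits. Averages over level selections are exact sums of
  \<open>2 ^ L\<close> terms, so there is no sampling error.\<close>

locale monotone_submodular =
  fixes E :: "'a set" and f :: "'a set \<Rightarrow> real"
  assumes finite_ground: "finite E"
    and submod: "submodular_on E f"
    and mono: "mono_on (Pow E) f"
    and nonneg: "S \<subseteq> E \<Longrightarrow> 0 \<le> f S"
begin

lemma finite_sub: "A \<subseteq> E \<Longrightarrow> finite A"
  using finite_ground finite_subset by blast

lemma mono_le: "A \<subseteq> B \<Longrightarrow> B \<subseteq> E \<Longrightarrow> f A \<le> f B"
  using mono by (auto simp: mono_on_def)

lemma submodD: "A \<subseteq> E \<Longrightarrow> B \<subseteq> E \<Longrightarrow> f (A \<union> B) + f (A \<inter> B) \<le> f A + f B"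
  using submod by (auto simp: submodular_on_def)

lemma diminishing:
  assumes "A \<subseteq> B" "B \<subseteq> E" "e \<in> E"
  shows "f (insert e B) - f B \<le> f (insert e A) - f A"
proof (cases "e \<in> B")
  case True
  then show ?thesis using mono_le[of A "insert e A"] assms by (auto simp: insert_absorb)
next
  case False
  have "insert e A \<union> B = insert e B" "insert e A \<inter> B = A" using assms False by auto
  then show ?thesis using submodD[of "insert e A" B] assms by (smt (verit) insert_subset subset_trans)
qed

lemma union_gain:
  assumes "A \<subseteq> E" "B \<subseteq> E"
  shows "f (A \<union> B) - f A \<le> (\<Sum>e\<in>B. f (insert e A) - f A)"
  using finite_sub[OF assms(2)] assms(2)
proof (induction B rule: finite_induct)
  case empty
  then show ?case by simp
next
  case (insert e B)
  have "f (insert e (A \<union> B)) - f (A \<union> B) \<le> f (insert e A) - f A"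
    using diminishing[of A "A \<union> B" e] insert assms by auto
  then show ?case using insert by auto
qed

text \<open>Peeling off the elements of \<open>X\<close> one at a time telescopes, and each is then
  lost from a subset of \<open>A\<close>, where its marginal is at least as large.\<close>

lemma removal_cost:
  assumes "X \<subseteq> A" "A \<subseteq> E"
  shows "(\<Sum>s\<in>X. f A - f (A - {s})) \<le> f A - f (A - X)"
proof -
  have "finite X" using finite_sub assms by blast
  then show ?thesis using assms(1)
  proof (induction X rule: finite_induct)
    case empty
    then show ?case by simp
  next
    case (insert e X)
    have "f (insert e (A - {e})) - f (A - {e})
        \<le> f (insert e (A - insert e X)) - f (A - insert e X)"
      using insert assms(2) by (intro diminishing) auto
    moreover have "insert e (A - {e}) = A" "insert e (A - insert e X) = A - X"
      using insert by auto
    ultimately show ?case using insert by auto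
  qed
qed

text \<open>Trades the loss from deleting \<open>D\<close> out of all of \<open>A\<close> for the
  gain of \<open>D\<close> over a prefix \<open>B\<close>. Gains over prefixes telescope, which
  \<open>drop_block\<close> exploits.\<close>

lemma deletion_le:
  assumes "D \<subseteq> A" "A \<subseteq> E" "B \<subseteq> A - D"
  shows "f A - f (A - D) \<le> f (B \<union> D) - f B"
proof -
  have "(B \<union> D) \<union> (A - D) = A" "(B \<union> D) \<inter> (A - D) = B" using assms by auto
  then show ?thesis using submodD[of "B \<union> D" "A - D"] assms
    by (smt (verit) Diff_subset Un_subset_iff subset_trans)
qed

text \<open>\<open>f {}\<close> may be positive, and every singleton value contains a copy of it.
  One copy suffices, and nonemptiness provides it.\<close>

lemma le_sum_singletons:
  assumes "A \<subseteq> E" "A \<noteq> {}"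
  shows "f A \<le> (\<Sum>e\<in>A. f {e})"
proof -
  obtain a where a: "a \<in> A" using assms by auto
  have fin: "finite A" using assms finite_sub by auto
  have "f A - f {} \<le> (\<Sum>e\<in>A. f {e} - f {})" using union_gain[of "{}" A] assms by auto
  also have "\<dots> = (\<Sum>e\<in>A. f {e}) - card A * f {}" by (simp add: sum_subtractf)
  also have "\<dots> \<le> (\<Sum>e\<in>A. f {e}) - f {}"
  proof -
    have "card A \<ge> 1" using a fin by (metis One_nat_def Suc_leI card_gt_0_iff empty_iff)
    then have "1 * f {} \<le> card A * f {}" using nonneg[of "{}"] by (intro mult_right_mono) auto
    then show ?thesis by simp
  qed
  finally show ?thesis by simp
qed

text \<open>For \<open>e\<close> in \<open>E\<close> this is the least gain that \<open>e\<close>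
  can bring to a set without it, by \<open>diminishing\<close>; \<open>curvature_bounds\<close>
  bounds it below by a multiple of \<open>f {e}\<close>.\<close>

definition tail :: "'a \<Rightarrow> real" where
  "tail e = f E - f (E - {e})"

definition curved :: "'a set \<Rightarrow> real" where
  "curved A = f A - sum tail A"

lemma tail_nonneg: "0 \<le> tail e"
  unfolding tail_def using mono_le[of "E - {e}" E] by auto

text \<open>Subtracting a modular function preserves submodularity, and monotonicity survives
  because every gain of \<open>e\<close> in \<open>f\<close> is at least
  \<open>tail e\<close>.\<close>

lemma curved_submodular: "monotone_submodular E curved"
proof
  show "finite E" by (rule finite_ground)
  show "submodular_on E curved"
    unfolding submodular_on_def curved_def
  proof (intro allI impI)
    fix S T assume ST: "S \<subseteq> E \<and> T \<subseteq> E"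
    then have "sum tail (S \<union> T) + sum tail (S \<inter> T) = sum tail S + sum tail T"
      using sum.union_inter finite_sub by metis
    then show "f (S \<union> T) - sum tail (S \<union> T) + (f (S \<inter> T) - sum tail (S \<inter> T))
        \<le> f S - sum tail S + (f T - sum tail T)"
      using submodD[of S T] ST by linarith
  qed
  have step: "curved A \<le> curved (insert e A)" if "insert e A \<subseteq> E" "e \<notin> A" for e A
  proof -
    have "f (insert e (E - {e})) - f (E - {e}) \<le> f (insert e A) - f A"
      using that by (intro diminishing) auto
    moreover have "insert e (E - {e}) = E" using that by auto
    ultimately show ?thesis
      using that finite_sub[of A] by (auto simp: curved_def tail_def)
  qed
  have ext: "curved A \<le> curved (A \<union> B)" if "A \<union> B \<subseteq> E" for A B
  proof -
    have "finite B" using that finite_sub by auto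
    then show ?thesis using that
    proof (induction B rule: finite_induct)
      case empty
      then show ?case by simp
    next
      case (insert e B)
      then show ?case using step[of e "A \<union> B"]
        by (cases "e \<in> A \<union> B") (auto simp: insert_absorb)
    qed
  qed
  show "mono_on (Pow E) curved"
  proof (rule mono_onI)
    fix A B assume "A \<in> Pow E" "B \<in> Pow E" "A \<subseteq> B"
    then show "curved A \<le> curved B" using ext[of A B] by (auto simp: sup.absorb2)
  qed
  show "0 \<le> curved S" if "S \<subseteq> E" for S
    using ext[of "{}" S] that nonneg[of "{}"] by (auto simp: curved_def)
qed

end

section \<open>Coefficients of the level potential\<close>

text \<open>
  With these weights the terms of proper nonempty level sets cancel in the exchange inequality
  \<open>level_cancellation\<close>.
\<close>

definition alpha :: "nat \<Rightarrow> nat \<Rightarrow> real" where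
  "alpha L r = (real L / (real L + 1)) ^ (L - r) * real L / ((real L + 1) * real r * real (L choose r))"

definition beta :: "nat \<Rightarrow> real" where
  "beta L = 1 - (real L / (real L + 1)) ^ L"

lemma alpha_0: "alpha L 0 = 0"
  by (simp add: alpha_def)

lemma alpha_nonneg: "0 \<le> alpha L r"
  by (simp add: alpha_def)

lemma beta_le_1: "beta L \<le> 1"
  by (auto simp: beta_def intro: power_le_one)

lemma alpha_L: "0 < L \<Longrightarrow> alpha L L = 1 / (real L + 1)"
proof -
  assume L: "0 < L"
  have "real L + real L * real L = real L * (real L + 1)" by (simp add: algebra_simps)
  then show ?thesis using L by (simp add: alpha_def)
qed

text \<open>This is the equation that makes the coefficient of a selection of size \<open>r\<close>
  vanish in \<open>level_cancellation\<close>. With \<open>alpha_L\<close> it determines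
  \<open>alpha\<close> from \<open>L\<close> downwards, and the program tabulates it in that
  order.\<close>

lemma alpha_step:
  assumes "0 < r" "r < L"
  shows "alpha L r = alpha L (Suc r) * real (L - r) * real L / (real r * (real L + 1))"
proof -
  have b: "(L - r) * (L choose r) = Suc r * (L choose Suc r)"
    by (simp only: binomial_absorb_comp binomial_absorption)
  then have b': "(real L - r) * (L choose r) = (1 + real r) * (L choose Suc r)"
    using assms by (metis of_nat_Suc of_nat_diff of_nat_mult less_imp_le)
  have p: "(real L / (real L + 1)) ^ (L - r) = (real L / (real L + 1)) ^ (L - Suc r) * (real L / (real L + 1))"
    using assms by (metis Suc_diff_Suc power_Suc2)
  have pos: "real (L choose r) > 0" "real L - r > 0" "real r > 0" "real L + 1 > 0"
    using assms by (auto simp: zero_less_binomial_iff)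
  have field: "q * (l / m) * l / (m * r * b) = q * l / (m * (x * b)) * x * l / (r * m)"
    if "b > 0" "x > 0" "r > 0" "m > 0" for q l m x b r :: real
    using that by (simp add: divide_simps)
  define m where "m = real L + 1"
  let ?q = "(real L / m) ^ (L - Suc r)"
  have "alpha L r = ?q * (L / m) * L / (m * r * (L choose r))"
    unfolding alpha_def p m_def by simp
  also have "\<dots> = ?q * L / (m * ((real L - r) * (L choose r))) * (real L - r) * L / (r * m)"
    using pos by (intro field) (auto simp: m_def)
  also have "m * ((real L - r) * (L choose r)) = m * Suc r * (L choose Suc r)"
    unfolding b' by simp
  also have "?q * L / (m * Suc r * (L choose Suc r)) = alpha L (Suc r)"
    unfolding alpha_def m_def by simp
  finally show ?thesis using assms by (simp add: of_nat_diff m_def)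
qed

lemma sum_Pow_card:
  fixes h :: "nat \<Rightarrow> real"
  assumes "finite V"
  shows "(\<Sum>A\<in>Pow V. h (card A)) = (\<Sum>r\<le>card V. (card V choose r) * h r)"
proof -
  have img: "card ` Pow V \<subseteq> {..card V}" using assms by (auto intro: card_mono)
  have "(\<Sum>A\<in>Pow V. h (card A)) = (\<Sum>r\<le>card V. \<Sum>A\<in>{A \<in> Pow V. card A = r}. h (card A))"
    using sum.group[of "Pow V" "{..card V}" card "\<lambda>A. h (card A)"] assms img by simp
  also have "\<dots> = (\<Sum>r\<le>card V. (card V choose r) * h r)"
  proof (rule sum.cong)
    fix r
    have "card {A \<in> Pow V. card A = r} = card V choose r"
      using n_subsets[OF assms, of r] by simp
    then show "(\<Sum>A\<in>{A \<in> Pow V. card A = r}. h (card A)) = (card V choose r) * h r" by simp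
  qed simp
  finally show ?thesis .
qed

text \<open>Averaging a modular function over all selections therefore just multiplies it by
  \<open>beta L\<close>. The binomial coefficients cancel by absorption, and a geometric sum with
  ratio \<open>L / (L + 1)\<close> remains.\<close>

lemma alpha_marked_sum:
  assumes "j < L"
  shows "(\<Sum>A\<in>{A \<in> Pow {..<L}. j \<in> A}. alpha L (card A)) = beta L"
proof -
  obtain M where M: "L = Suc M" using assms by (cases L) auto
  let ?V = "{..<L} - {j}" and ?q = "real L / (real L + 1)"
  have img: "{A \<in> Pow {..<L}. j \<in> A} = insert j ` Pow ?V"
  proof (intro equalityI subsetI)
    fix A assume "A \<in> {A \<in> Pow {..<L}. j \<in> A}"
    then have "A = insert j (A - {j})" "A - {j} \<in> Pow ?V" by auto
    then show "A \<in> insert j ` Pow ?V" by blast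
  qed (use assms in auto)
  have inj: "inj_on (insert j) (Pow ?V)" by (auto simp: inj_on_def)
  have "(\<Sum>A\<in>{A \<in> Pow {..<L}. j \<in> A}. alpha L (card A)) = (\<Sum>A\<in>Pow ?V. alpha L (Suc (card A)))"
    unfolding img sum.reindex[OF inj] o_def
  proof (rule sum.cong)
    fix A assume "A \<in> Pow ?V"
    then have "j \<notin> A" "finite A" by (auto intro: finite_subset)
    then show "alpha L (card (insert j A)) = alpha L (Suc (card A))" by simp
  qed simp
  also have "\<dots> = (\<Sum>r\<le>M. (M choose r) * alpha L (Suc r))"
    using sum_Pow_card[of ?V "\<lambda>r. alpha L (Suc r)"] assms M by simp
  also have "\<dots> = (\<Sum>r\<le>M. ?q ^ (M - r) / (real L + 1))"
  proof (rule sum.cong)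
    fix r assume r: "r \<in> {..M}"
    have b: "real (Suc r) * (L choose Suc r) = real L * (M choose r)"
      using binomial_absorption[of r L] M by (metis diff_Suc_1 of_nat_mult)
    have "L choose Suc r > 0" "M choose r > 0"
      using r M by (simp_all del: binomial_Suc_Suc)
    then have pos: "real (L choose Suc r) > 0" "real (M choose r) > 0"
      by simp_all
    have "(M choose r) * alpha L (Suc r)
        = ?q ^ (M - r) / (real L + 1) * ((real L * (M choose r)) / (real (Suc r) * (L choose Suc r)))"
      unfolding alpha_def using M by (simp add: divide_simps del: binomial_Suc_Suc)
    also have "(real L * (M choose r)) / (real (Suc r) * (L choose Suc r)) = 1"
      unfolding b using pos assms by simp
    finally show "(M choose r) * alpha L (Suc r) = ?q ^ (M - r) / (real L + 1)" by simp
  qed simp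
  also have "\<dots> = (\<Sum>r<L. ?q ^ r) / (real L + 1)"
  proof -
    have "(\<Sum>r\<le>M. ?q ^ (M - r)) = (\<Sum>r\<le>M. ?q ^ r)"
      by (rule sum.reindex_bij_witness[of _ "\<lambda>r. M - r" "\<lambda>r. M - r"]) auto
    then show ?thesis unfolding sum_divide_distrib[symmetric] M lessThan_Suc_atMost by simp
  qed
  also have "\<dots> = beta L"
  proof -
    have "?q \<noteq> 1" using assms by (simp add: field_simps)
    then have "(\<Sum>r<L. ?q ^ r) = (1 - ?q ^ L) / (1 - ?q)" by (simp add: sum_gp_strict)
    moreover have "1 - ?q = 1 / (real L + 1)" by (simp add: field_simps)
    ultimately show ?thesis by (simp add: beta_def)
  qed
  finally show ?thesis .
qed

lemma sum_Pow_elements: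
  fixes h :: "nat set \<Rightarrow> nat \<Rightarrow> real"
  shows "(\<Sum>A\<in>Pow {..<L}. \<Sum>j\<in>A. h A j) = (\<Sum>j<L. \<Sum>A\<in>{A \<in> Pow {..<L}. j \<in> A}. h A j)"
proof -
  have "(\<Sum>A\<in>Pow {..<L}. \<Sum>j\<in>A. h A j) = (\<Sum>A\<in>Pow {..<L}. \<Sum>j\<in>{j\<in>{..<L}. j \<in> A}. h A j)"
    by (intro sum.cong refl) auto
  also have "\<dots> = (\<Sum>j<L. \<Sum>A\<in>{A \<in> Pow {..<L}. j \<in> A}. h A j)"
    by (rule sum.swap_restrict) auto
  finally show ?thesis .
qed

lemma alpha_card_sum:
  "(\<Sum>A\<in>Pow {..<L}. alpha L (card A) * card A) = L * beta L"
proof -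
  have "(\<Sum>A\<in>Pow {..<L}. alpha L (card A) * card A) = (\<Sum>A\<in>Pow {..<L}. \<Sum>j\<in>A. alpha L (card A))"
    by (simp add: mult.commute)
  also have "\<dots> = L * beta L"
    unfolding sum_Pow_elements
    using sum.cong[of "{..<L}" "{..<L}" "\<lambda>j. \<Sum>A\<in>{A \<in> Pow {..<L}. j \<in> A}. alpha L (card A)" "\<lambda>_. beta L"]
      alpha_marked_sum by simp
  finally show ?thesis .
qed

lemma alpha_sum_le: "(\<Sum>A\<in>Pow {..<L}. alpha L (card A)) \<le> L"
proof -
  have "(\<Sum>A\<in>Pow {..<L}. alpha L (card A)) \<le> (\<Sum>A\<in>Pow {..<L}. alpha L (card A) * card A)"
  proof (rule sum_mono)
    fix A
    show "alpha L (card A) \<le> alpha L (card A) * card A"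
      using mult_left_mono[of 1 "real (card A)" "alpha L (card A)"] alpha_nonneg[of L "card A"] alpha_0[of L]
      by (cases "card A = 0") (auto simp: Suc_le_eq)
  qed
  also have "\<dots> \<le> L * 1" unfolding alpha_card_sum using beta_le_1[of L] by (simp add: mult_left_le)
  finally show ?thesis by simp
qed

text \<open>Read \<open>G A\<close> as the value of the selection \<open>A\<close> and
  \<open>X\<close> as the value of the comparison solution. The first sum is the gain from
  insertions at a uniformly random level, the second the loss from emptying single levels.
  Collecting the coefficient of each \<open>G A\<close>, the recurrence \<open>alpha_step\<close>
  leaves only the empty and the full selection.\<close>

lemma level_cancellation:
  fixes G :: "nat set \<Rightarrow> real"
  assumes L: "0 < L" and G0: "0 \<le> G {}"
  shows "beta L * X - G {..<L} \<le>
    (\<Sum>A\<in>Pow {..<L}. alpha L (card A) * (card A / L) * (X - G A))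
    - (\<Sum>A\<in>Pow {..<L}. alpha L (card A) * (\<Sum>j\<in>A. G A - G (A - {j})))"
proof -
  let ?P = "Pow {..<L}"
  have X: "(\<Sum>A\<in>?P. alpha L (card A) * (card A / L) * X) = beta L * X"
  proof -
    have "(\<Sum>A\<in>?P. alpha L (card A) * (card A / L) * X) = (\<Sum>A\<in>?P. alpha L (card A) * card A) * X / L"
      by (simp add: sum_distrib_right sum_divide_distrib)
    then show ?thesis unfolding alpha_card_sum using L by simp
  qed
  \<comment> \<open>A set of size \<open>r\<close> arises by removing one index from
    \<open>L - r\<close> sets of size \<open>r + 1\<close>.\<close>
  have shift: "(\<Sum>A\<in>?P. \<Sum>j\<in>A. alpha L (card A) * G (A - {j}))
      = (\<Sum>A\<in>?P. alpha L (Suc (card A)) * (L - card A) * G A)"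
  proof -
    have inner: "(\<Sum>A\<in>{A \<in> ?P. j \<in> A}. alpha L (card A) * G (A - {j}))
        = (\<Sum>A\<in>{A \<in> ?P. j \<notin> A}. alpha L (Suc (card A)) * G A)" if "j < L" for j
    proof (rule sum.reindex_bij_witness[of _ "insert j" "\<lambda>A. A - {j}"])
      fix A assume A: "A \<in> {A \<in> ?P. j \<in> A}"
      then have "finite A" by (auto intro: finite_subset)
      then have "Suc (card (A - {j})) = card A" using A by (intro card_Suc_Diff1) auto
      then show "alpha L (Suc (card (A - {j}))) * G (A - {j}) = alpha L (card A) * G (A - {j})" by simp
    qed (use that in auto)
    have "(\<Sum>A\<in>?P. \<Sum>j\<in>A. alpha L (card A) * G (A - {j}))
        = (\<Sum>j<L. \<Sum>A\<in>{A \<in> ?P. j \<notin> A}. alpha L (Suc (card A)) * G A)"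
      unfolding sum_Pow_elements using inner by simp
    also have "\<dots> = (\<Sum>A\<in>?P. \<Sum>j\<in>{j \<in> {..<L}. j \<notin> A}. alpha L (Suc (card A)) * G A)"
      by (rule sum.swap_restrict) auto
    also have "\<dots> = (\<Sum>A\<in>?P. alpha L (Suc (card A)) * (L - card A) * G A)"
    proof (rule sum.cong)
      fix A assume A: "A \<in> ?P"
      then have f: "finite A" "A \<subseteq> {..<L}" by (auto intro: finite_subset)
      have "{j \<in> {..<L}. j \<notin> A} = {..<L} - A" by auto
      then have "card {j \<in> {..<L}. j \<notin> A} = L - card A" using f by (simp add: card_Diff_subset)
      then show "(\<Sum>j\<in>{j \<in> {..<L}. j \<notin> A}. alpha L (Suc (card A)) * G A)
          = alpha L (Suc (card A)) * (L - card A) * G A" by (simp add: mult_ac)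
    qed simp
    finally show ?thesis .
  qed
  define c where "c A = - (alpha L (card A) * (card A / L)) - alpha L (card A) * card A
      + alpha L (Suc (card A)) * (L - card A)" for A :: "nat set"
  have split: "(\<Sum>A\<in>?P. a A * (X - G A)) = (\<Sum>A\<in>?P. a A * X) - (\<Sum>A\<in>?P. a A * G A)"
    for a :: "nat set \<Rightarrow> real" by (simp add: right_diff_distrib sum_subtractf)
  have inner: "alpha L (card A) * (\<Sum>j\<in>A. G A - G (A - {j}))
      = alpha L (card A) * card A * G A - (\<Sum>j\<in>A. alpha L (card A) * G (A - {j}))" for A
    by (simp add: sum_subtractf right_diff_distrib sum_distrib_left mult_ac)
  have "(\<Sum>A\<in>?P. alpha L (card A) * (card A / L) * (X - G A))
    - (\<Sum>A\<in>?P. alpha L (card A) * (\<Sum>j\<in>A. G A - G (A - {j})))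
    = beta L * X - (\<Sum>A\<in>?P. alpha L (card A) * (card A / L) * G A)
      - (\<Sum>A\<in>?P. alpha L (card A) * card A * G A) + (\<Sum>A\<in>?P. \<Sum>j\<in>A. alpha L (card A) * G (A - {j}))"
    unfolding X[symmetric] split inner by (simp add: sum_subtractf)
  also have "\<dots> = beta L * X + (\<Sum>A\<in>?P. c A * G A)"
    unfolding shift c_def
    by (simp add: sum.distrib sum_subtractf left_diff_distrib distrib_right sum_negf)
  also have "(\<Sum>A\<in>?P. c A * G A) = (\<Sum>A\<in>?P - {{}} - {{..<L}}. c A * G A) + c {} * G {} + c {..<L} * G {..<L}"
  proof -
    have "(\<Sum>A\<in>?P. c A * G A) = c {} * G {} + (\<Sum>A\<in>?P - {{}}. c A * G A)"
      by (rule sum.remove) auto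
    also have "(\<Sum>A\<in>?P - {{}}. c A * G A) = c {..<L} * G {..<L} + (\<Sum>A\<in>?P - {{}} - {{..<L}}. c A * G A)"
      using L by (intro sum.remove) auto
    finally show ?thesis by simp
  qed
  also have "(\<Sum>A\<in>?P - {{}} - {{..<L}}. c A * G A) = 0"
  proof (rule sum.neutral, rule ballI)
    fix A assume A: "A \<in> ?P - {{}} - {{..<L}}"
    then have "A \<subset> {..<L}" by auto
    then have "card A < card {..<L}" by (intro psubset_card_mono) auto
    then have lt: "card A < L" by simp
    have "finite A" using A by (auto intro: finite_subset)
    then have "0 < card A" using A by (simp add: card_gt_0_iff)
    then have "real (card A) * (real L + 1) \<noteq> 0" by simp
    then have "alpha L (card A) * (real (card A) * (real L + 1))
        = alpha L (Suc (card A)) * real (L - card A) * real L"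
      unfolding alpha_step[OF \<open>0 < card A\<close> lt] by (simp del: of_nat_diff)
    moreover have "c A * real L = alpha L (Suc (card A)) * real (L - card A) * real L
        - alpha L (card A) * (real (card A) * (real L + 1))"
      unfolding c_def using L by (simp add: algebra_simps)
    ultimately have "c A = 0" using L by simp
    then show "c A * G A = 0" by simp
  qed
  \<comment> \<open>The value of \<open>alpha_L\<close> fixes the common scale of the coefficients
    so that the full selection is charged exactly once.\<close>
  also have "c {..<L} = -1" unfolding c_def using L alpha_L[of L] by (simp add: field_simps)
  also have "0 \<le> c {} * G {}" unfolding c_def using G0 alpha_nonneg by (simp add: alpha_0)
  then have "beta L * X - G {..<L} \<le> beta L * X + (0 + c {} * G {} + - 1 * G {..<L})" by simp
  finally show ?thesis .
qed

section \<open>The level potential\<close>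

text \<open>
  A solution is stored as a map \<open>lev\<close> sending absent elements to \<open>0\<close> and present ones to a level
  in \<open>{1..L}\<close>; the index set \<open>A \<subseteq> {..<L}\<close> selects the levels \<open>Suc ` A\<close>.
\<close>

locale level_potential = monotone_submodular E g for E :: "'a set" and g +
  fixes lin :: "'a \<Rightarrow> real" and L :: nat
  assumes L_pos: "0 < L" and lin_nonneg: "0 \<le> lin e"
begin

definition at_levels :: "('a \<Rightarrow> nat) \<Rightarrow> nat set \<Rightarrow> 'a set" where
  "at_levels lev A = {e \<in> E. lev e \<in> Suc ` A}"

definition support :: "('a \<Rightarrow> nat) \<Rightarrow> 'a set" where
  "support lev = {e \<in> E. 0 < lev e}"

text \<open>The modular part has weight one, not the factor \<open>beta L\<close> that averaging
  would give it; this is what lets a local optimum keep all of it.\<close>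

definition Phi :: "('a \<Rightarrow> nat) \<Rightarrow> real" where
  "Phi lev = (\<Sum>A\<in>Pow {..<L}. alpha L (card A) * g (at_levels lev A)) + sum lin (support lev)"

definition cost :: "('a \<Rightarrow> nat) \<Rightarrow> 'a set \<Rightarrow> real" where
  "cost lev X =
     (\<Sum>A\<in>Pow {..<L}. alpha L (card A) * (g (at_levels lev A) - g (at_levels lev A - X))) + sum lin X"

text \<open>A uniformly random level lies in \<open>A\<close> with probability
  \<open>card A / L\<close>, so this is the expected gain from inserting \<open>e\<close> at a
  random level.\<close>

definition bonus :: "('a \<Rightarrow> nat) \<Rightarrow> 'a \<Rightarrow> real" where
  "bonus lev e =
     (\<Sum>A\<in>Pow {..<L}. alpha L (card A) * (card A / L) *
        (g (insert e (at_levels lev A)) - g (at_levels lev A))) + lin e"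

text \<open>\<open>X\<close> is what is given up in exchange. The case \<open>x = e\<close> comes
  first, so that \<open>e \<in> X\<close> describes a mere change of level.\<close>

definition place :: "('a \<Rightarrow> nat) \<Rightarrow> 'a \<Rightarrow> nat \<Rightarrow> 'a set \<Rightarrow> 'a \<Rightarrow> nat" where
  "place lev e j X = (\<lambda>x. if x = e then Suc j else if x \<in> X then 0 else lev x)"

lemma at_levels_sub: "at_levels lev A \<subseteq> E" and support_sub: "support lev \<subseteq> E"
  by (auto simp: at_levels_def support_def)

lemma at_levels_support: "at_levels lev A \<subseteq> support lev"
  by (auto simp: at_levels_def support_def)

lemma at_levels_full: "(\<And>e. e \<in> E \<Longrightarrow> lev e \<le> L) \<Longrightarrow> at_levels lev {..<L} = support lev"
  unfolding at_levels_def support_def by (auto simp: image_iff) (metis Suc_le_eq gr0_implies_Suc lessThan_iff)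

lemma finite_support: "finite (support lev)"
  using finite_sub support_sub by blast

lemma cost_empty: "cost lev {} = 0"
  by (simp add: cost_def)

lemma Phi_nonneg: "0 \<le> Phi lev"
  unfolding Phi_def using nonneg at_levels_sub alpha_nonneg lin_nonneg
  by (intro add_nonneg_nonneg sum_nonneg mult_nonneg_nonneg) auto

lemma Phi_le: "Phi lev \<le> L * (g (support lev) + sum lin (support lev))"
proof -
  have "(\<Sum>A\<in>Pow {..<L}. alpha L (card A) * g (at_levels lev A))
      \<le> (\<Sum>A\<in>Pow {..<L}. alpha L (card A) * g (support lev))"
    using mono_le[OF at_levels_support support_sub] alpha_nonneg by (intro sum_mono mult_left_mono) auto
  also have "\<dots> \<le> L * g (support lev)"
    unfolding sum_distrib_right[symmetric]
    using alpha_sum_le nonneg[OF support_sub] by (intro mult_right_mono) auto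
  finally have "(\<Sum>A\<in>Pow {..<L}. alpha L (card A) * g (at_levels lev A)) \<le> L * g (support lev)" .
  moreover have "1 * sum lin (support lev) \<le> L * sum lin (support lev)"
    using L_pos lin_nonneg by (intro mult_right_mono sum_nonneg) auto
  ultimately show ?thesis unfolding Phi_def by (simp add: distrib_left)
qed

lemma Phi_remove:
  assumes "X \<subseteq> support lev"
  shows "Phi (\<lambda>e. if e \<in> X then 0 else lev e) = Phi lev - cost lev X"
proof -
  let ?lev = "\<lambda>e. if e \<in> X then 0 else lev e"
  have "at_levels ?lev A = at_levels lev A - X" for A by (auto simp: at_levels_def)
  moreover have "support ?lev = support lev - X" by (auto simp: support_def)
  moreover have "sum lin (support lev - X) = sum lin (support lev) - sum lin X"
    using assms finite_support by (meson finite_subset sum_diff)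
  ultimately show ?thesis
    unfolding Phi_def cost_def by (simp add: right_diff_distrib sum_subtractf)
qed

text \<open>The gain of \<open>e\<close> is measured before \<open>X\<close> leaves; by diminishing
  returns this can only underestimate it. This is why removal and insertion decouple into
  \<open>cost\<close> and \<open>bonus\<close>.\<close>

lemma Phi_place:
  assumes X: "X \<subseteq> support lev" and e: "e \<in> E" "e \<notin> support lev - X" and j: "j < L"
  shows "Phi lev - cost lev X + (\<Sum>A\<in>{A \<in> Pow {..<L}. j \<in> A}.
      alpha L (card A) * (g (insert e (at_levels lev A)) - g (at_levels lev A))) + lin e
    \<le> Phi (place lev e j X)"
proof -
  let ?S = "at_levels lev" and ?T = "at_levels (place lev e j X)"
  have T: "?T A = (if j \<in> A then insert e (?S A - X) else ?S A - X)" for A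
    using e unfolding at_levels_def place_def support_def by (auto split: if_splits)
  have step: "alpha L (card A) * g (?S A) - alpha L (card A) * (g (?S A) - g (?S A - X))
      + (if j \<in> A then alpha L (card A) * (g (insert e (?S A)) - g (?S A)) else 0)
      \<le> alpha L (card A) * g (?T A)" for A
  proof (cases "j \<in> A")
    case True
    have "g (insert e (?S A)) - g (?S A) \<le> g (insert e (?S A - X)) - g (?S A - X)"
      using at_levels_sub e by (intro diminishing) auto
    then have "alpha L (card A) * (g (insert e (?S A)) - g (?S A))
        \<le> alpha L (card A) * (g (insert e (?S A - X)) - g (?S A - X))"
      using alpha_nonneg by (intro mult_left_mono) auto
    then show ?thesis using True T by (simp add: algebra_simps)
  next
    case False
    then show ?thesis using T by (simp add: algebra_simps)
  qed
  have supp: "support (place lev e j X) = insert e (support lev - X)"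
    using e by (auto simp: support_def place_def split: if_splits)
  have "sum lin (support (place lev e j X)) = lin e + (sum lin (support lev) - sum lin X)"
    unfolding supp using e X finite_support by (simp add: sum_diff)
  moreover have "(\<Sum>A\<in>Pow {..<L}. alpha L (card A) * g (?S A)
      - alpha L (card A) * (g (?S A) - g (?S A - X))
      + (if j \<in> A then alpha L (card A) * (g (insert e (?S A)) - g (?S A)) else 0))
      \<le> (\<Sum>A\<in>Pow {..<L}. alpha L (card A) * g (?T A))"
    by (intro sum_mono step)
  moreover have "(\<Sum>A\<in>Pow {..<L}. if j \<in> A then alpha L (card A) * (g (insert e (?S A)) - g (?S A)) else 0)
      = (\<Sum>A\<in>{A \<in> Pow {..<L}. j \<in> A}. alpha L (card A) * (g (insert e (?S A)) - g (?S A)))"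
    by (rule sum.inter_filter[symmetric]) auto
  ultimately show ?thesis
    unfolding Phi_def cost_def by (simp add: sum.distrib sum_subtractf)
qed

text \<open>If no single level gains more than \<open>d\<close>, neither does the average over the
  \<open>L\<close> levels, and that average is \<open>bonus\<close>.\<close>

lemma bonus_le_place:
  assumes X: "X \<subseteq> support lev" and e: "e \<in> E" "e \<notin> support lev - X"
    and bound: "\<And>j. j < L \<Longrightarrow> Phi (place lev e j X) \<le> Phi lev + d"
  shows "bonus lev e - cost lev X \<le> d"
proof -
  let ?D = "\<lambda>A. alpha L (card A) * (g (insert e (at_levels lev A)) - g (at_levels lev A))"
  have "(\<Sum>j<L. \<Sum>A\<in>{A \<in> Pow {..<L}. j \<in> A}. ?D A) \<le> (\<Sum>j<L. d + cost lev X - lin e)"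
    using Phi_place[OF X e] bound by (intro sum_mono) force
  also have "\<dots> = L * (d + cost lev X - lin e)" by simp
  also have "(\<Sum>j<L. \<Sum>A\<in>{A \<in> Pow {..<L}. j \<in> A}. ?D A) = (\<Sum>A\<in>Pow {..<L}. \<Sum>j\<in>A. ?D A)"
    by (rule sum_Pow_elements[symmetric])
  also have "\<dots> = L * (bonus lev e - lin e)"
    using L_pos by (simp add: bonus_def sum_distrib_left mult_ac)
  finally show ?thesis using L_pos by simp
qed

text \<open>Within a selection, the removal costs of the elements on one level add up to at most the
  loss from emptying that level (\<open>removal_cost\<close>). This is the form in which
  \<open>level_cancellation\<close> takes losses.\<close>

lemma sum_costs_levels:
  assumes "\<And>e. e \<in> E \<Longrightarrow> lev e \<le> L"
  shows "(\<Sum>s\<in>support lev. cost lev {s}) \<le>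
    (\<Sum>A\<in>Pow {..<L}. alpha L (card A) * (\<Sum>j\<in>A. g (at_levels lev A) - g (at_levels lev (A - {j}))))
    + sum lin (support lev)"
proof -
  let ?S = "at_levels lev"
  have level: "(\<Sum>s\<in>support lev. g (?S A) - g (?S A - {s})) \<le> (\<Sum>j\<in>A. g (?S A) - g (?S (A - {j})))"
    if A: "A \<in> Pow {..<L}" for A
  proof -
    have fin: "finite A" using A by (auto intro: finite_subset)
    have "(\<Sum>s\<in>support lev. g (?S A) - g (?S A - {s})) = (\<Sum>s\<in>?S A. g (?S A) - g (?S A - {s}))"
      using at_levels_support finite_support by (intro sum.mono_neutral_right) auto
    also have "\<dots> = (\<Sum>s\<in>(\<Union>j\<in>A. ?S {j}). g (?S A) - g (?S A - {s}))"
      by (rule sum.cong) (auto simp: at_levels_def)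
    also have "\<dots>
        = (\<Sum>j\<in>A. \<Sum>s\<in>?S {j}. g (?S A) - g (?S A - {s}))"
      using fin finite_sub at_levels_sub by (intro sum.UNION_disjoint) (auto simp: at_levels_def)
    also have "\<dots> \<le> (\<Sum>j\<in>A. g (?S A) - g (?S (A - {j})))"
    proof (rule sum_mono)
      fix j assume j: "j \<in> A"
      have "?S A - ?S {j} = ?S (A - {j})" by (auto simp: at_levels_def)
      then show "(\<Sum>s\<in>?S {j}. g (?S A) - g (?S A - {s})) \<le> g (?S A) - g (?S (A - {j}))"
        using removal_cost[of "?S {j}" "?S A"] at_levels_sub j by (auto simp: at_levels_def)
    qed
    finally show ?thesis .
  qed
  have "(\<Sum>s\<in>support lev. cost lev {s}) =
      (\<Sum>A\<in>Pow {..<L}. alpha L (card A) * (\<Sum>s\<in>support lev. g (?S A) - g (?S A - {s})))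
      + sum lin (support lev)"
    unfolding cost_def sum.distrib by (subst sum.swap) (simp add: sum_distrib_left)
  then show ?thesis using level alpha_nonneg by (auto intro!: sum_mono mult_left_mono)
qed

lemma sum_costs_le_Phi: "(\<Sum>s\<in>support lev. cost lev {s}) \<le> Phi lev"
proof -
  let ?S = "at_levels lev"
  have "(\<Sum>s\<in>support lev. g (?S A) - g (?S A - {s})) \<le> g (?S A)" for A
  proof -
    have "(\<Sum>s\<in>support lev. g (?S A) - g (?S A - {s})) = (\<Sum>s\<in>?S A. g (?S A) - g (?S A - {s}))"
      using at_levels_support finite_support by (intro sum.mono_neutral_right) auto
    also have "\<dots> \<le> g (?S A) - g (?S A - ?S A)" using at_levels_sub by (intro removal_cost) auto
    finally show ?thesis using nonneg[of "{}"] by simp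
  qed
  moreover have "(\<Sum>s\<in>support lev. cost lev {s}) =
      (\<Sum>A\<in>Pow {..<L}. alpha L (card A) * (\<Sum>s\<in>support lev. g (?S A) - g (?S A - {s})))
      + sum lin (support lev)"
    unfolding cost_def sum.distrib by (subst sum.swap) (simp add: sum_distrib_left)
  ultimately show ?thesis
    unfolding Phi_def using alpha_nonneg by (auto intro!: sum_mono mult_left_mono)
qed

text \<open>Holds at every state: \<open>level_cancellation\<close> is applied to the values of the
  selections, and submodularity splits the gain of \<open>Y\<close> into bonuses of its elements.
  Local optimality enters only when the right side is bounded.\<close>

lemma exchange_inequality:
  assumes lev: "\<And>e. e \<in> E \<Longrightarrow> lev e \<le> L" and Y: "Y \<subseteq> E"
  shows "beta L * g Y + sum lin Y - (g (support lev) + sum lin (support lev))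
    \<le> (\<Sum>e\<in>Y. bonus lev e) - (\<Sum>s\<in>support lev. cost lev {s})"
proof -
  let ?S = "at_levels lev"
  have "beta L * g Y - g (?S {..<L}) \<le>
    (\<Sum>A\<in>Pow {..<L}. alpha L (card A) * (card A / L) * (g Y - g (?S A)))
    - (\<Sum>A\<in>Pow {..<L}. alpha L (card A) * (\<Sum>j\<in>A. g (?S A) - g (?S (A - {j}))))"
    using L_pos nonneg[OF at_levels_sub] by (rule level_cancellation)
  moreover have "(\<Sum>A\<in>Pow {..<L}. alpha L (card A) * (card A / L) * (g Y - g (?S A))) + sum lin Y
      \<le> (\<Sum>e\<in>Y. bonus lev e)"
  proof -
    have "(\<Sum>e\<in>Y. bonus lev e) = (\<Sum>A\<in>Pow {..<L}. alpha L (card A) * (card A / L) *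
        (\<Sum>e\<in>Y. g (insert e (?S A)) - g (?S A))) + sum lin Y"
      unfolding bonus_def sum.distrib by (subst sum.swap) (simp add: sum_distrib_left)
    moreover have "g Y - g (?S A) \<le> (\<Sum>e\<in>Y. g (insert e (?S A)) - g (?S A))" for A
      using union_gain[OF at_levels_sub Y, of lev A] mono_le[of Y "?S A \<union> Y"] at_levels_sub[of lev A] Y
      by auto
    then have "alpha L (card A) * (card A / L) * (g Y - g (?S A)) \<le> alpha L (card A) * (card A / L) *
        (\<Sum>e\<in>Y. g (insert e (?S A)) - g (?S A))" for A
      using alpha_nonneg by (intro mult_left_mono) auto
    ultimately show ?thesis by (simp only: add_le_cancel_right) (rule sum_mono)
  qed
  moreover have "?S {..<L} = support lev" using lev by (rule at_levels_full)
  ultimately show ?thesis using sum_costs_levels[of lev, OF lev] by simp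
qed

end

section \<open>Local optima of the penalized potential\<close>

text \<open>
  The knapsack constraint on the light elements (\<open>w e \<le> \<tau>\<close>) is replaced by a convex penalty whose
  slope changes little over a window of width \<open>\<tau>\<close>, so that at a local optimum one multiplier serves
  all single-element moves.
\<close>

locale penalized_potential = level_potential E g lin L for E :: "'a set" and g lin L +
  fixes w :: "'a \<Rightarrow> real" and \<tau> K W :: real
  assumes w_nonneg: "e \<in> E \<Longrightarrow> 0 \<le> w e" and K_nonneg: "0 \<le> K"
begin

definition load :: "('a \<Rightarrow> nat) \<Rightarrow> real" where
  "load lev = sum w {e \<in> support lev. w e \<le> \<tau>}"

text \<open>Its slope \<open>K * max 0 (x - W)\<close> at the current load is the multiplier, called
  \<open>D\<close> below; \<open>K / 2 * h\<^sup>2\<close> is the error of linearizing over a move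
  of weight \<open>h\<close>.\<close>

definition penalty :: "real \<Rightarrow> real" where
  "penalty x = K / 2 * (max 0 (x - W))\<^sup>2"

definition Psi :: "('a \<Rightarrow> nat) \<Rightarrow> real" where
  "Psi lev = Phi lev - penalty (load lev)"

lemma penalty_nonneg: "0 \<le> penalty x"
  using K_nonneg by (simp add: penalty_def)

lemma penalty_increase:
  assumes "0 \<le> h"
  shows "penalty (x + h) \<le> penalty x + K * max 0 (x - W) * h + K / 2 * h\<^sup>2"
proof -
  have "(max 0 (x + h - W))\<^sup>2 \<le> (max 0 (x - W))\<^sup>2 + 2 * max 0 (x - W) * h + h\<^sup>2"
  proof (cases "0 \<le> x - W")
    case True
    then have "max 0 (x + h - W) = (x - W) + h" "max 0 (x - W) = x - W" using assms by auto
    then show ?thesis by (simp add: power2_eq_square algebra_simps)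
  next
    case False
    then have "(max 0 (x + h - W))\<^sup>2 \<le> h\<^sup>2" using assms by (intro power_mono) auto
    then show ?thesis using False by simp
  qed
  from mult_left_mono[OF this, of "K / 2"] show ?thesis
    using K_nonneg by (simp add: penalty_def algebra_simps)
qed

lemma penalty_decrease:
  assumes "0 \<le> h"
  shows "penalty (x - h) \<le> penalty x - K * max 0 (x - W) * h + K / 2 * h\<^sup>2"
proof -
  have "(max 0 (x - h - W))\<^sup>2 \<le> (max 0 (x - W))\<^sup>2 - 2 * max 0 (x - W) * h + h\<^sup>2"
  proof (cases "0 \<le> x - h - W")
    case True
    then have "max 0 (x - h - W) = (x - W) - h" "max 0 (x - W) = x - W" using assms by auto
    then show ?thesis by (simp add: power2_eq_square algebra_simps)
  next
    case False
    then have "(max 0 (x - h - W))\<^sup>2 = 0" by simp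
    also have "0 \<le> (max 0 (x - W) - h)\<^sup>2" by simp
    finally show ?thesis by (simp add: power2_diff algebra_simps)
  qed
  from mult_left_mono[OF this, of "K / 2"] show ?thesis
    using K_nonneg by (simp add: penalty_def algebra_simps)
qed

lemma load_add:
  assumes "e \<in> E" "w e \<le> \<tau>" "e \<notin> support lev" "0 < l"
  shows "load (lev(e := l)) = load lev + w e"
proof -
  have "{x \<in> support (lev(e := l)). w x \<le> \<tau>} = insert e {x \<in> support lev. w x \<le> \<tau>}"
    using assms by (auto simp: support_def)
  then show ?thesis unfolding load_def using assms finite_support by simp
qed

lemma load_remove:
  assumes "e \<in> support lev" "w e \<le> \<tau>"
  shows "load (lev(e := 0)) = load lev - w e"
proof -
  have "{x \<in> support (lev(e := 0)). w x \<le> \<tau>} = {x \<in> support lev. w x \<le> \<tau>} - {e}"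
    by (auto simp: support_def)
  then show ?thesis unfolding load_def using assms finite_support by (simp add: sum_diff1)
qed

lemma load_move:
  assumes "e \<in> support lev" "0 < l"
  shows "load (lev(e := l)) = load lev"
proof -
  have "support (lev(e := l)) = support lev" using assms by (auto simp: support_def)
  then show ?thesis by (simp add: load_def)
qed

lemma load_large:
  assumes "\<tau> < w e" "\<And>x. x \<in> X \<Longrightarrow> \<tau> < w x"
  shows "load (place lev e j X) = load lev"
proof -
  have "{x \<in> support (place lev e j X). w x \<le> \<tau>} = {x \<in> support lev. w x \<le> \<tau>}"
    using assms by (force simp: support_def place_def split: if_splits)
  then show ?thesis by (simp add: load_def)
qed

lemma remove_light:
  fixes \<eta> :: real
  assumes s: "s \<in> support lev" "w s \<le> \<tau>"
    and opt: "Psi (lev(s := 0)) \<le> Psi lev + \<eta>"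
  shows "K * max 0 (load lev - W) * w s - K / 2 * (w s)\<^sup>2 \<le> cost lev {s} + \<eta>"
proof -
  have "(\<lambda>e. if e \<in> {s} then 0 else lev e) = lev(s := 0)" by auto
  then have "Phi (lev(s := 0)) = Phi lev - cost lev {s}" using Phi_remove[of "{s}" lev] s by auto
  moreover have "penalty (load lev - w s)
      \<le> penalty (load lev) - K * max 0 (load lev - W) * w s + K / 2 * (w s)\<^sup>2"
    using w_nonneg s support_sub by (intro penalty_decrease) auto
  ultimately show ?thesis using opt load_remove[OF s] by (simp add: Psi_def)
qed

text \<open>If no removal pays, every light element costs at least the slope times its weight.
  Summation gives slope times load, while all removal costs together are at most
  \<open>Phi\<close>.\<close>

lemma load_bound:
  fixes \<eta> :: real
  assumes opt: "\<And>s. s \<in> support lev \<Longrightarrow> w s \<le> \<tau> \<Longrightarrow> Psi (lev(s := 0)) \<le> Psi lev + \<eta>"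
    and "0 \<le> \<eta>"
  shows "K * (max 0 (load lev - W) - \<tau> / 2) * load lev \<le> card E * \<eta> + Phi lev"
proof -
  let ?T = "{e \<in> support lev. w e \<le> \<tau>}" and ?D = "K * max 0 (load lev - W)"
  have T: "finite ?T" "?T \<subseteq> E" using finite_support support_sub by auto
  have "K * (max 0 (load lev - W) - \<tau> / 2) * load lev = (\<Sum>s\<in>?T. ?D * w s - K / 2 * (\<tau> * w s))"
    unfolding sum_subtractf sum_distrib_left[symmetric] load_def[symmetric]
    by (simp add: algebra_simps)
  also have "\<dots> \<le> (\<Sum>s\<in>?T. cost lev {s} + \<eta>)"
  proof (rule sum_mono)
    fix s assume s: "s \<in> ?T"
    then have "(w s)\<^sup>2 \<le> \<tau> * w s"
      using w_nonneg[of s] T by (auto simp: power2_eq_square intro: mult_right_mono)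
    then have "K / 2 * (w s)\<^sup>2 \<le> K / 2 * (\<tau> * w s)" using K_nonneg by (intro mult_left_mono) auto
    then show "?D * w s - K / 2 * (\<tau> * w s) \<le> cost lev {s} + \<eta>"
      using remove_light[of s lev \<eta>] opt[of s] s by auto
  qed
  also have "\<dots> = (\<Sum>s\<in>?T. cost lev {s}) + card ?T * \<eta>" by (simp add: sum.distrib)
  also have "card ?T * \<eta> \<le> card E * \<eta>"
    using card_mono[OF finite_ground T(2)] \<open>0 \<le> \<eta>\<close> by (intro mult_right_mono) auto
  also have "(\<Sum>s\<in>?T. cost lev {s}) \<le> (\<Sum>s\<in>support lev. cost lev {s})"
  proof (rule sum_mono2)
    fix s assume "s \<in> support lev - ?T"
    have "0 \<le> g (at_levels lev A) - g (at_levels lev A - {s})" for A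
      using mono_le[of "at_levels lev A - {s}" "at_levels lev A"] at_levels_sub by auto
    then show "0 \<le> cost lev {s}"
      unfolding cost_def using alpha_nonneg lin_nonneg
      by (intro add_nonneg_nonneg sum_nonneg mult_nonneg_nonneg) auto
  qed (use finite_support in auto)
  also have "\<dots> \<le> Phi lev" by (rule sum_costs_le_Phi)
  finally show ?thesis by linarith
qed

text \<open>One move is charged to each element. A heavy \<open>e\<close> of \<open>Y\<close> enters
  for \<open>\<rho> e\<close>, which leaves the load unchanged; a light element of \<open>Y\<close>
  is inserted or moved to another level; a light element outside \<open>Y\<close> is removed. Adding
  up these inequalities bounds the right side of \<open>exchange_inequality\<close>, up to a
  multiplier term that is not positive.\<close>

lemma local_optimum:
  fixes \<rho> :: "'a \<Rightarrow> 'a set" and \<eta> \<theta> :: real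
  assumes lev: "\<And>e. e \<in> E \<Longrightarrow> lev e \<le> L" and Y: "Y \<subseteq> E"
    and light: "\<And>e l. e \<in> support lev \<union> Y \<Longrightarrow> w e \<le> \<tau> \<Longrightarrow> l \<le> L \<Longrightarrow> Psi (lev(e := l)) \<le> Psi lev + \<eta>"
    and heavy: "\<And>e j. e \<in> Y \<Longrightarrow> \<tau> < w e \<Longrightarrow> j < L \<Longrightarrow> Psi (place lev e j (\<rho> e)) \<le> Psi lev + \<theta>"
    and card: "\<And>e. e \<in> Y \<Longrightarrow> \<tau> < w e \<Longrightarrow> \<rho> e = {} \<or> (\<exists>s. \<rho> e = {s})"
    and disj: "disjoint_family_on \<rho> {e \<in> Y. \<tau> < w e}"
    and cover: "(\<Union>e\<in>{e \<in> Y. \<tau> < w e}. \<rho> e) = {s \<in> support lev. \<tau> < w s}"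
    and own: "\<And>e. e \<in> Y \<Longrightarrow> \<tau> < w e \<Longrightarrow> e \<in> support lev \<Longrightarrow> e \<in> \<rho> e"
    and WO: "sum w {e \<in> Y. w e \<le> \<tau>} \<le> W" and "0 \<le> \<eta>" and "0 \<le> \<tau>"
  shows "beta L * g Y + sum lin Y - (g (support lev) + sum lin (support lev))
    \<le> card E * \<eta> + card {e \<in> Y. \<tau> < w e} * \<theta> + K * \<tau> / 2 * (sum w {e \<in> Y. w e \<le> \<tau>} + load lev)"
proof -
  define S where "S = support lev"
  define T where "T = {e \<in> S. w e \<le> \<tau>}"
  define Ol where "Ol = {e \<in> Y. \<tau> < w e}"
  define Os where "Os = {e \<in> Y. w e \<le> \<tau>}"
  define D where "D = K * max 0 (load lev - W)"
  have fin: "finite S" "finite T" "finite Y" "finite Ol" "finite Os"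
    using finite_support finite_sub[OF Y] by (auto simp: S_def T_def Ol_def Os_def)
  have SE: "S \<subseteq> E" unfolding S_def by (rule support_sub)
  have loadT: "load lev = sum w T" by (simp add: load_def T_def S_def)
  have place_single: "place lev e j X = lev(e := Suc j)" if "X \<subseteq> {e}" for e j X
    using that by (auto simp: place_def fun_eq_iff)
  have heavy_bound: "bonus lev e - cost lev (\<rho> e) \<le> \<theta>" if e: "e \<in> Ol" for e
  proof (rule bonus_le_place)
    have sub: "\<rho> e \<subseteq> {s \<in> support lev. \<tau> < w s}" using cover e by (auto simp: Ol_def)
    then show "\<rho> e \<subseteq> support lev" by auto
    show "e \<in> E" "e \<notin> support lev - \<rho> e" using e Y own by (auto simp: Ol_def)
    show "Phi (place lev e j (\<rho> e)) \<le> Phi lev + \<theta>" if "j < L" for j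
    proof -
      have "load (place lev e j (\<rho> e)) = load lev" using sub e by (intro load_large) (auto simp: Ol_def)
      then show ?thesis using heavy[of e j] e that by (auto simp: Psi_def Ol_def)
    qed
  qed
  have move_bound: "bonus lev e - cost lev {e} \<le> \<eta>" if e: "e \<in> Os \<inter> S" for e
  proof (rule bonus_le_place)
    show "{e} \<subseteq> support lev" "e \<in> E" "e \<notin> support lev - {e}" using e SE by (auto simp: S_def)
    show "Phi (place lev e j {e}) \<le> Phi lev + \<eta>" if "j < L" for j
      using light[of e "Suc j"] load_move[of e lev "Suc j"] e that place_single[of "{e}" e j]
      by (auto simp: Psi_def Os_def S_def)
  qed
  have add_bound: "bonus lev e \<le> \<eta> + D * w e + K / 2 * (\<tau> * w e)" if e: "e \<in> Os - S" for e
  proof -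
    have we: "0 \<le> w e" "w e \<le> \<tau>" using e Y w_nonneg by (auto simp: Os_def)
    then have "(w e)\<^sup>2 \<le> \<tau> * w e" by (auto simp: power2_eq_square intro: mult_right_mono)
    then have sq: "K / 2 * (w e)\<^sup>2 \<le> K / 2 * (\<tau> * w e)" using K_nonneg by (intro mult_left_mono) auto
    have "bonus lev e - cost lev {} \<le> \<eta> + D * w e + K / 2 * (\<tau> * w e)"
    proof (rule bonus_le_place)
      show "{} \<subseteq> support lev" "e \<in> E" "e \<notin> support lev - {}" using e Y by (auto simp: S_def Os_def)
      fix j assume j: "j < L"
      have "Psi (lev(e := Suc j)) \<le> Psi lev + \<eta>" using light[of e "Suc j"] e j by (auto simp: Os_def)
      moreover have "load (lev(e := Suc j)) = load lev + w e"
        using e Y by (intro load_add) (auto simp: Os_def S_def)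
      ultimately show "Phi (place lev e j {}) \<le> Phi lev + (\<eta> + D * w e + K / 2 * (\<tau> * w e))"
        using penalty_increase[OF we(1), of "load lev"] sq place_single[of "{}" e j]
        by (auto simp: Psi_def D_def)
    qed
    then show ?thesis by (simp add: cost_empty)
  qed
  have remove_bound: "- cost lev {s} \<le> \<eta> - D * w s + K / 2 * (\<tau> * w s)" if s: "s \<in> T - Y" for s
  proof -
    have ws: "0 \<le> w s" "w s \<le> \<tau>" using s SE w_nonneg by (auto simp: T_def)
    then have "(w s)\<^sup>2 \<le> \<tau> * w s" by (auto simp: power2_eq_square intro: mult_right_mono)
    then have "K / 2 * (w s)\<^sup>2 \<le> K / 2 * (\<tau> * w s)" using K_nonneg by (intro mult_left_mono) auto
    then show ?thesis
      using remove_light[of s lev \<eta>] light[of s 0] s by (auto simp: D_def T_def S_def)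
  qed
  have cost_heavy: "(\<Sum>s\<in>{s \<in> S. \<tau> < w s}. cost lev {s}) = (\<Sum>e\<in>Ol. cost lev (\<rho> e))"
  proof -
    have "(\<Sum>s\<in>{s \<in> S. \<tau> < w s}. cost lev {s}) = (\<Sum>e\<in>Ol. \<Sum>s\<in>\<rho> e. cost lev {s})"
      unfolding S_def cover[symmetric] Ol_def
    proof (rule sum.UNION_disjoint)
      show "finite {e \<in> Y. \<tau> < w e}" using fin by simp
      show "\<forall>e\<in>{e \<in> Y. \<tau> < w e}. finite (\<rho> e)" using card by fastforce
      show "\<forall>e\<in>{e \<in> Y. \<tau> < w e}. \<forall>e'\<in>{e \<in> Y. \<tau> < w e}. e \<noteq> e' \<longrightarrow> \<rho> e \<inter> \<rho> e' = {}"
        using disj by (auto simp: disjoint_family_on_def)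
    qed
    also have "\<dots> = (\<Sum>e\<in>Ol. cost lev (\<rho> e))"
      using card by (intro sum.cong refl) (fastforce simp: cost_empty Ol_def)
    finally show ?thesis .
  qed
  have Y_split: "(\<Sum>e\<in>Y. bonus lev e)
      = (\<Sum>e\<in>Ol. bonus lev e) + ((\<Sum>e\<in>Os \<inter> S. bonus lev e) + (\<Sum>e\<in>Os - S. bonus lev e))"
  proof -
    have "(\<Sum>e\<in>Y. bonus lev e) = (\<Sum>e\<in>Ol. bonus lev e) + (\<Sum>e\<in>Os. bonus lev e)"
      using fin by (subst sum.union_disjoint[symmetric]) (auto simp: Ol_def Os_def intro: sum.cong)
    moreover have "(\<Sum>e\<in>Os. bonus lev e) = (\<Sum>e\<in>Os \<inter> S. bonus lev e) + (\<Sum>e\<in>Os - S. bonus lev e)"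
      using fin by (intro sum.Int_Diff)
    ultimately show ?thesis by simp
  qed
  have S_split: "(\<Sum>s\<in>S. cost lev {s})
      = (\<Sum>e\<in>Ol. cost lev (\<rho> e)) + ((\<Sum>s\<in>Os \<inter> S. cost lev {s}) + (\<Sum>s\<in>T - Y. cost lev {s}))"
  proof -
    have "(\<Sum>s\<in>S. cost lev {s}) = (\<Sum>s\<in>{s \<in> S. \<tau> < w s}. cost lev {s}) + (\<Sum>s\<in>T. cost lev {s})"
      using fin by (subst sum.union_disjoint[symmetric]) (auto simp: T_def intro: sum.cong)
    moreover have "(\<Sum>s\<in>T. cost lev {s}) = (\<Sum>s\<in>T \<inter> Y. cost lev {s}) + (\<Sum>s\<in>T - Y. cost lev {s})"
      using fin by (intro sum.Int_Diff)
    moreover have "T \<inter> Y = Os \<inter> S" by (auto simp: T_def Os_def)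
    ultimately show ?thesis using cost_heavy by simp
  qed
  have "(\<Sum>e\<in>Ol. bonus lev e - cost lev (\<rho> e)) \<le> card Ol * \<theta>"
    using sum_bounded_above[of Ol _ \<theta>] heavy_bound by auto
  moreover have "(\<Sum>e\<in>Os \<inter> S. bonus lev e - cost lev {e}) \<le> (\<Sum>e\<in>Os \<inter> S. \<eta>)"
    using move_bound by (rule sum_mono)
  moreover have "(\<Sum>e\<in>Os - S. bonus lev e) \<le> (\<Sum>e\<in>Os - S. \<eta> + D * w e + K / 2 * (\<tau> * w e))"
    using add_bound by (rule sum_mono)
  moreover have "(\<Sum>s\<in>T - Y. - cost lev {s}) \<le> (\<Sum>s\<in>T - Y. \<eta> - D * w s + K / 2 * (\<tau> * w s))"
    using remove_bound by (rule sum_mono)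
  ultimately have total: "(\<Sum>e\<in>Y. bonus lev e) - (\<Sum>s\<in>S. cost lev {s}) \<le> card Ol * \<theta>
      + \<eta> * (card (Os \<inter> S) + card (Os - S) + card (T - Y))
      + D * (sum w (Os - S) - sum w (T - Y)) + K / 2 * \<tau> * (sum w (Os - S) + sum w (T - Y))"
    unfolding Y_split S_split
    by (simp add: sum_subtractf sum.distrib sum_distrib_left sum_divide_distrib sum_negf algebra_simps)
  have count: "\<eta> * (card (Os \<inter> S) + card (Os - S) + card (T - Y)) \<le> \<eta> * card E"
  proof -
    have "card (Os \<inter> S) + card (Os - S) + card (T - Y) = card (Os \<union> (T - Y))"
    proof -
      have "card (Os \<inter> S) + card (Os - S) = card Os"
        using fin by (metis Int_commute add.commute card_Diff_subset_Int card_mono finite_Int inf_le2 le_add_diff_inverse2)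
      moreover have "card (Os \<union> (T - Y)) = card Os + card (T - Y)"
        using fin by (intro card_Un_disjoint) (auto simp: Os_def)
      ultimately show ?thesis by simp
    qed
    also have "\<dots> \<le> card E"
      using SE Y by (intro card_mono finite_ground) (auto simp: Os_def T_def)
    finally show ?thesis using \<open>0 \<le> \<eta>\<close> by (intro mult_left_mono) (simp_all flip: of_nat_add)
  qed
  have ws: "sum w Os = sum w (Os \<inter> S) + sum w (Os - S)" "sum w T = sum w (Os \<inter> S) + sum w (T - Y)"
  proof -
    show "sum w Os = sum w (Os \<inter> S) + sum w (Os - S)" using fin by (intro sum.Int_Diff)
    have "T \<inter> Y = Os \<inter> S" by (auto simp: T_def Os_def)
    then show "sum w T = sum w (Os \<inter> S) + sum w (T - Y)"
      using sum.Int_Diff[OF fin(2), of w Y] by simp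
  qed
  \<comment> \<open>Complementary slackness: either the multiplier is \<open>0\<close>, or the load
    exceeds \<open>W\<close> and hence the light weight of \<open>Y\<close>, and the common light
    elements cancel from that comparison.\<close>
  have "D * (sum w (Os - S) - sum w (T - Y)) \<le> 0"
  proof (cases "W < load lev")
    case True
    then have "sum w (Os - S) - sum w (T - Y) \<le> 0" using ws WO loadT by (simp add: Os_def)
    moreover have "0 \<le> D" using K_nonneg by (simp add: D_def)
    ultimately show ?thesis by (simp add: mult_nonneg_nonpos)
  qed (simp add: D_def)
  moreover have "K / 2 * \<tau> * (sum w (Os - S) + sum w (T - Y)) \<le> K / 2 * \<tau> * (sum w Os + load lev)"
  proof (rule mult_left_mono)
    have "0 \<le> sum w (Os \<inter> S)" using w_nonneg SE by (intro sum_nonneg) auto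
    then show "sum w (Os - S) + sum w (T - Y) \<le> sum w Os + load lev" using ws loadT by simp
  qed (use K_nonneg \<open>0 \<le> \<tau>\<close> in auto)
  ultimately have "(\<Sum>e\<in>Y. bonus lev e) - (\<Sum>s\<in>S. cost lev {s})
      \<le> card E * \<eta> + card Ol * \<theta> + K * \<tau> / 2 * (sum w Os + load lev)"
    using total count by (simp add: mult.commute)
  then show ?thesis using exchange_inequality[of lev, OF lev Y] by (simp add: S_def Ol_def Os_def)
qed

end

section \<open>The search procedure\<close>

text \<open>
  \<open>settle\<close> is the local search over light elements. Heavy elements occupy slots (\<open>sl i = Suc e\<close>
  means that slot \<open>i\<close> holds \<open>e\<close>, and \<open>sl i = 0\<close> that it is empty); \<open>exchange d\<close> refills slot \<open>d\<close>
  with the lightest heavy element that gains at least \<open>\<theta>\<close>. The digits of a code in base \<open>k\<close> are the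
  guessed slots.
\<close>

locale knapsack_search = penalized_potential "{..<n}" g lin L w \<tau> K W
  for n :: nat and g lin L w \<tau> K W +
  fixes cap \<eta> \<theta> :: real and R k M :: nat
begin

text \<open>The margin \<open>\<eta>\<close> bounds the number of moves. The test against
  \<open>cap\<close> enforces what the penalty merely encourages.\<close>

definition improve :: "nat \<Rightarrow> (nat \<Rightarrow> nat) \<Rightarrow> nat \<Rightarrow> nat \<Rightarrow> nat" where
  "improve e lev l =
     (if load (lev(e := l)) \<le> cap \<and> Psi lev + \<eta> < Psi (lev(e := l)) then lev(e := l) else lev)"

definition sweep_at :: "(nat \<Rightarrow> nat) \<Rightarrow> nat \<Rightarrow> nat \<Rightarrow> nat" where
  "sweep_at lev e = (if w e \<le> \<tau> then foldl (improve e) lev [0..<Suc L] else lev)"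

definition sweep :: "(nat \<Rightarrow> nat) \<Rightarrow> nat \<Rightarrow> nat" where
  "sweep lev = foldl sweep_at lev [0..<n]"

definition settle :: "(nat \<Rightarrow> nat) \<Rightarrow> nat \<Rightarrow> nat" where
  "settle = sweep ^^ R"

text \<open>A second component \<open>0\<close> means that nothing has been found yet; otherwise it
  is the level to be assigned, between \<open>1\<close> and \<open>L\<close>.\<close>

definition better :: "(nat \<Rightarrow> nat) \<Rightarrow> real \<Rightarrow> nat \<Rightarrow> nat \<times> nat \<Rightarrow> nat \<Rightarrow> nat \<times> nat" where
  "better lev cur e b l =
     (if cur + \<theta> \<le> Psi (lev(e := Suc l)) \<and> (snd b = 0 \<or> w e < w (fst b)) then (e, Suc l) else b)"

definition scan_at :: "(nat \<Rightarrow> nat) \<Rightarrow> real \<Rightarrow> nat \<times> nat \<Rightarrow> nat \<Rightarrow> nat \<times> nat" where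
  "scan_at lev cur b e = (if \<tau> < w e \<and> lev e = 0 then foldl (better lev cur e) b [0..<L] else b)"

definition scan :: "(nat \<Rightarrow> nat) \<Rightarrow> real \<Rightarrow> nat \<times> nat" where
  "scan lev cur = foldl (scan_at lev cur) (0, 0) [0..<n]"

definition vacate :: "nat \<Rightarrow> (nat \<Rightarrow> nat) \<Rightarrow> (nat \<Rightarrow> nat) \<Rightarrow> nat \<Rightarrow> nat" where
  "vacate d lev sl = (if 0 < sl d then lev(sl d - 1 := 0) else lev)"

text \<open>The gain is compared with \<open>Psi lev\<close> from before the slot was vacated, so
  the cost of the removal is charged. The vacated element is absent during the scan and may return
  on another level.\<close>

definition exchange :: "nat \<Rightarrow> (nat \<Rightarrow> nat) \<Rightarrow> (nat \<Rightarrow> nat) \<Rightarrow> (nat \<Rightarrow> nat) \<times> (nat \<Rightarrow> nat)" where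
  "exchange d lev sl =
     (let b = scan (vacate d lev sl) (Psi lev) in
      if 0 < snd b then ((vacate d lev sl)(fst b := snd b), sl(d := Suc (fst b)))
      else (vacate d lev sl, sl(d := 0)))"

definition round :: "(nat \<Rightarrow> nat) \<times> (nat \<Rightarrow> nat) \<times> nat \<Rightarrow> (nat \<Rightarrow> nat) \<times> (nat \<Rightarrow> nat) \<times> nat" where
  "round s = (case s of (lev, sl, c) \<Rightarrow>
     (case exchange (c mod k) (settle lev) sl of (lev', sl') \<Rightarrow> (lev', sl', c div k)))"

text \<open>The final \<open>settle\<close> matches the moment at which the program compares with
  its output: after settling and before the next exchange.\<close>

definition candidate :: "nat \<Rightarrow> nat \<Rightarrow> nat \<Rightarrow> nat" where
  "candidate c t = settle (fst ((round ^^ t) (\<lambda>_. 0, \<lambda>_. 0, c)))"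

end

text \<open>No step loses potential, so the gain of a moving step is never undone. A fold that
  returns to its start therefore contains no moving step, which turns a fixed sweep into a local
  optimum for all its moves.\<close>

lemma foldl_progress:
  fixes \<phi> :: "'s \<Rightarrow> real"
  assumes "\<And>s x. f s x = s \<or> \<phi> s + \<eta> < \<phi> (f s x)" and "0 \<le> \<eta>"
  shows "(foldl f s xs = s \<and> (\<forall>x\<in>set xs. f s x = s)) \<or> \<phi> s + \<eta> < \<phi> (foldl f s xs)"
proof (induction xs arbitrary: s)
  case Nil
  then show ?case by simp
next
  case (Cons x xs)
  from assms(1)[of s x] show ?case
  proof
    assume "f s x = s"
    then show ?thesis using Cons.IH[of s] by auto
  next
    assume "\<phi> s + \<eta> < \<phi> (f s x)"
    then show ?thesis using Cons.IH[of "f s x"] \<open>0 \<le> \<eta>\<close> by fastforce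
  qed
qed

lemma foldl_invariant:
  assumes "P s" "\<And>s x. x \<in> set xs \<Longrightarrow> P s \<Longrightarrow> P (f s x)"
  shows "P (foldl f s xs)"
  using assms by (induction xs arbitrary: s) auto

text \<open>With an upper bound on the potential, enough iterations exclude the second alternative
  and force a fixed point.\<close>

lemma funpow_progress:
  fixes \<phi> :: "'s \<Rightarrow> real"
  assumes "\<And>s. f s = s \<or> \<phi> s + \<eta> < \<phi> (f s)"
  shows "f ((f ^^ m) s) = (f ^^ m) s \<or> \<phi> s + m * \<eta> \<le> \<phi> ((f ^^ m) s)"
proof (induction m)
  case 0
  then show ?case by simp
next
  case (Suc m)
  then show ?case using assms[of "(f ^^ m) s"] by (auto simp: algebra_simps)
qed

context knapsack_search
begin

lemma improve_cases: "improve e lev l = lev \<or> Psi lev + \<eta> < Psi (improve e lev l)"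
  by (simp add: improve_def)

lemma sweep_at_cases: "0 \<le> \<eta> \<Longrightarrow> sweep_at lev e = lev \<or> Psi lev + \<eta> < Psi (sweep_at lev e)"
  unfolding sweep_at_def
  using foldl_progress[of "improve e" Psi \<eta> lev "[0..<Suc L]"] improve_cases by auto

lemma sweep_cases: "0 \<le> \<eta> \<Longrightarrow> sweep lev = lev \<or> Psi lev + \<eta> < Psi (sweep lev)"
  unfolding sweep_def
  using foldl_progress[of sweep_at Psi \<eta> lev "[0..<n]"] sweep_at_cases by auto

lemma sweep_fixed:
  assumes "sweep lev = lev" "0 \<le> \<eta>" "e < n" "w e \<le> \<tau>" "l \<le> L"
  shows "improve e lev l = lev"
proof -
  have "foldl sweep_at lev [0..<n] = lev" using assms(1) by (simp add: sweep_def)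
  then have "sweep_at lev e = lev"
    using foldl_progress[of sweep_at Psi \<eta> lev "[0..<n]"] sweep_at_cases assms by auto
  then have "foldl (improve e) lev [0..<Suc L] = lev" using assms by (simp add: sweep_at_def)
  then show ?thesis
    using foldl_progress[of "improve e" Psi \<eta> lev "[0..<Suc L]"] improve_cases assms
    by (auto simp del: upt_Suc)
qed

definition light_inv :: "(nat \<Rightarrow> nat) \<Rightarrow> (nat \<Rightarrow> nat) \<Rightarrow> bool" where
  "light_inv lev0 lev \<longleftrightarrow> (\<forall>e. lev e \<le> L) \<and> (\<forall>e\<ge>n. lev e = 0) \<and> load lev \<le> cap \<and>
     Psi lev0 \<le> Psi lev \<and> (\<forall>e. \<tau> < w e \<longrightarrow> lev e = lev0 e)"

lemma light_inv_settle:
  assumes "light_inv lev0 lev" "0 \<le> \<eta>"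
  shows "light_inv lev0 (settle lev)"
proof -
  have improve: "light_inv lev0 (improve e lev l)"
    if "light_inv lev0 lev" "e < n" "w e \<le> \<tau>" "l \<le> L" for e l lev
  proof (cases "load (lev(e := l)) \<le> cap \<and> Psi lev + \<eta> < Psi (lev(e := l))")
    case True
    moreover have "(lev(e := l)) x \<le> L" for x using that by (simp add: light_inv_def)
    moreover have "(lev(e := l)) x = 0" if "n \<le> x" for x
      using that \<open>e < n\<close> \<open>light_inv lev0 lev\<close> by (simp add: light_inv_def)
    moreover have "(lev(e := l)) x = lev0 x" if "\<tau> < w x" for x
      using that \<open>w e \<le> \<tau>\<close> \<open>light_inv lev0 lev\<close> by (auto simp: light_inv_def)
    moreover have "Psi lev0 \<le> Psi (lev(e := l))"
      using True \<open>0 \<le> \<eta>\<close> \<open>light_inv lev0 lev\<close> by (simp add: light_inv_def)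
    ultimately show ?thesis by (simp add: improve_def light_inv_def del: fun_upd_apply)
  next
    case False
    then have "improve e lev l = lev" unfolding improve_def by (rule if_not_P)
    then show ?thesis using that(1) by simp
  qed
  have sweep_at: "light_inv lev0 (sweep_at lev e)" if "light_inv lev0 lev" "e < n" for e lev
  proof (cases "w e \<le> \<tau>")
    case True
    have "light_inv lev0 (foldl (improve e) lev [0..<Suc L])"
    proof (rule foldl_invariant[where P = "light_inv lev0"])
      fix s l assume "l \<in> set [0..<Suc L]" "light_inv lev0 s"
      then show "light_inv lev0 (improve e s l)"
        using improve \<open>e < n\<close> True by (auto simp: less_Suc_eq_le simp del: upt_Suc)
    qed (rule that(1))
    then show ?thesis using True by (simp add: sweep_at_def del: upt_Suc)
  qed (use that in \<open>simp add: sweep_at_def\<close>)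
  have sweep: "light_inv lev0 (sweep lev)" if "light_inv lev0 lev" for lev
    unfolding sweep_def by (rule foldl_invariant[where P = "light_inv lev0"]) (use that sweep_at in auto)
  have "light_inv lev0 ((sweep ^^ m) lev)" for m
    by (induction m) (use sweep assms in auto)
  then show ?thesis by (simp add: settle_def)
qed

definition choices :: "(nat \<Rightarrow> nat) \<Rightarrow> real \<Rightarrow> (nat \<times> nat) set" where
  "choices lev cur = {(e, l). e < n \<and> l < L \<and> \<tau> < w e \<and> lev e = 0 \<and> cur + \<theta> \<le> Psi (lev(e := Suc l))}"

text \<open>The set \<open>A\<close> holds the pairs of element and level index visited so far,
  which makes this the invariant of both nested folds.\<close>

definition lightest_in :: "(nat \<Rightarrow> nat) \<Rightarrow> real \<Rightarrow> (nat \<times> nat) set \<Rightarrow> nat \<times> nat \<Rightarrow> bool" where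
  "lightest_in lev cur A b \<longleftrightarrow> (0 < snd b \<longrightarrow> (fst b, snd b - 1) \<in> choices lev cur) \<and>
     (\<forall>(e, l)\<in>A \<inter> choices lev cur. 0 < snd b \<and> w (fst b) \<le> w e)"

lemma scan_lightest: "lightest_in lev cur ({..<n} \<times> {..<L}) (scan lev cur)"
proof -
  have inner: "lightest_in lev cur (A \<union> {e} \<times> {..<m}) (foldl (better lev cur e) b [0..<m])"
    if "lightest_in lev cur A b" "e < n" "\<tau> < w e" "lev e = 0" "m \<le> L" for A b e m
    using that(5)
  proof (induction m)
    case 0
    then show ?case using that by simp
  next
    case (Suc m)
    let ?b = "foldl (better lev cur e) b [0..<m]"
    have IH: "lightest_in lev cur (A \<union> {e} \<times> {..<m}) ?b" using Suc by simp
    have "A \<union> {e} \<times> {..<Suc m} = insert (e, m) (A \<union> {e} \<times> {..<m})" by auto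
    moreover have "lightest_in lev cur (insert (e, m) (A \<union> {e} \<times> {..<m})) (better lev cur e ?b m)"
    proof (cases "(e, m) \<in> choices lev cur")
      case True
      then have gain: "cur + \<theta> \<le> Psi (lev(e := Suc m))" by (simp add: choices_def)
      show ?thesis
      proof (cases "snd ?b = 0 \<or> w e < w (fst ?b)")
        case new: True
        then have "better lev cur e ?b m = (e, Suc m)" using gain by (simp add: better_def)
        moreover have "w e \<le> w e'" if "(e', l') \<in> (A \<union> {e} \<times> {..<m}) \<inter> choices lev cur" for e' l'
        proof -
          have "0 < snd ?b" "w (fst ?b) \<le> w e'" using IH that unfolding lightest_in_def by blast+
          then show ?thesis using new by auto
        qed
        ultimately show ?thesis using True by (auto simp: lightest_in_def)
      next
        case old: False
        then have "better lev cur e ?b m = ?b" by (auto simp: better_def)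
        then show ?thesis using IH old unfolding lightest_in_def by auto
      qed
    next
      case False
      then have "\<not> cur + \<theta> \<le> Psi (lev(e := Suc m))"
        using that Suc.prems by (simp add: choices_def)
      then have "better lev cur e ?b m = ?b" by (simp add: better_def)
      moreover have "insert (e, m) (A \<union> {e} \<times> {..<m}) \<inter> choices lev cur
          = (A \<union> {e} \<times> {..<m}) \<inter> choices lev cur" using False by blast
      ultimately show ?thesis using IH by (simp only: lightest_in_def)
    qed
    ultimately show ?case by simp
  qed
  have "lightest_in lev cur ({..<m} \<times> {..<L}) (foldl (scan_at lev cur) (0, 0) [0..<m])" if "m \<le> n" for m
    using that
  proof (induction m)
    case 0
    then show ?case by (simp add: lightest_in_def)
  next
    case (Suc m)
    let ?b = "foldl (scan_at lev cur) (0, 0) [0..<m]"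
    have IH: "lightest_in lev cur ({..<m} \<times> {..<L}) ?b" using Suc by simp
    have eq: "{..<Suc m} \<times> {..<L} = {..<m} \<times> {..<L} \<union> {m} \<times> {..<L}" by auto
    show ?case
    proof (cases "\<tau> < w m \<and> lev m = 0")
      case True
      then have "scan_at lev cur ?b m = foldl (better lev cur m) ?b [0..<L]" by (simp add: scan_at_def)
      then show ?thesis using inner[OF IH, of m L] True Suc.prems unfolding eq by simp
    next
      case False
      then have "({m} \<times> {..<L}) \<inter> choices lev cur = {}" by (auto simp: choices_def)
      then have "lightest_in lev cur ({..<m} \<times> {..<L} \<union> {m} \<times> {..<L}) ?b"
        using IH unfolding lightest_in_def by (simp add: Int_Un_distrib2)
      moreover have "scan_at lev cur ?b m = ?b" using False by (auto simp: scan_at_def)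
      ultimately show ?thesis unfolding eq by simp
    qed
  qed
  then show ?thesis by (simp add: scan_def)
qed

end

text \<open>
  \<open>Y\<close> is the comparison solution and \<open>v\<close> an upper bound on the value of a feasible set; the last
  assumption on \<open>K\<close> keeps the load of a local optimum away from the hard bound \<open>cap\<close>.
\<close>

locale knapsack_analysis = knapsack_search n g lin L w \<tau> K W cap \<eta> \<theta> R k M
  for n g lin L w \<tau> K W cap \<eta> \<theta> R k M +
  fixes Y :: "nat set" and v err :: real
  assumes Y_sub: "Y \<subseteq> {..<n}"
    and tau_nonneg: "0 \<le> \<tau>" and eta_nonneg: "0 \<le> \<eta>" and theta_nonneg: "0 \<le> \<theta>"
    and k_pos: "0 < k" and slots_enough: "card {y \<in> Y. \<tau> < w y} \<le> k"
    and light_fits: "sum w {y \<in> Y. w y \<le> \<tau>} \<le> W"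
    and heavy_fits: "sum w {y \<in> Y. \<tau> < w y} + cap \<le> 1"
    and W_le_cap: "W + 2 * \<tau> \<le> cap"
    and value_le: "\<And>S. S \<subseteq> {..<n} \<Longrightarrow> sum w S \<le> 1 \<Longrightarrow> g S + sum lin S \<le> v"
    and err: "n * \<eta> + k * \<theta> + K * \<tau> / 2 * (W + cap) \<le> err"
    and sweeps_enough: "L * v < R * \<eta>"
    and rounds_enough: "L * v < M * \<theta>"
    and steep: "0 < \<tau> \<Longrightarrow> n * \<eta> + L * v < K * (cap - W - 3 / 2 * \<tau>) * W"
begin

section \<open>Slots and their owners in the comparison solution\<close>

abbreviation heavy_Y :: "nat set" where
  "heavy_Y \<equiv> {y \<in> Y. \<tau> < w y}"

lemma finite_Y: "finite Y"
  using Y_sub finite_subset by blast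

lemma W_nonneg: "0 \<le> W"
proof -
  have "0 \<le> sum w {y \<in> Y. w y \<le> \<tau>}" using w_nonneg Y_sub by (intro sum_nonneg) auto
  then show ?thesis using light_fits by simp
qed

text \<open>\<open>sg\<close> assigns every heavy element of \<open>Y\<close> its own slot, and
  whoever occupies that slot is no heavier than the owner. Only the analysis knows
  \<open>sg\<close>; it certifies the weight of the heavy part.\<close>

definition matching :: "(nat \<Rightarrow> nat) \<Rightarrow> (nat \<Rightarrow> nat) \<Rightarrow> bool" where
  "matching sl sg \<longleftrightarrow> inj_on sg heavy_Y \<and> sg ` heavy_Y \<subseteq> {..<k} \<and>
     (\<forall>i. 0 < sl i \<longrightarrow> i \<in> sg ` heavy_Y) \<and> (\<forall>y\<in>heavy_Y. \<forall>e. sl (sg y) = Suc e \<longrightarrow> w e \<le> w y)"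

definition slots_hold :: "(nat \<Rightarrow> nat) \<Rightarrow> (nat \<Rightarrow> nat) \<Rightarrow> bool" where
  "slots_hold lev sl \<longleftrightarrow> (\<forall>i j. sl i = sl j \<longrightarrow> 0 < sl i \<longrightarrow> i = j) \<and>
     {e \<in> support lev. \<tau> < w e} = {e. \<exists>i. sl i = Suc e}"

definition inv :: "(nat \<Rightarrow> nat) \<Rightarrow> (nat \<Rightarrow> nat) \<Rightarrow> bool" where
  "inv lev sl \<longleftrightarrow> (\<forall>e. lev e \<le> L) \<and> (\<forall>e\<ge>n. lev e = 0) \<and> load lev \<le> cap \<and> 0 \<le> Psi lev \<and>
     slots_hold lev sl \<and> (\<exists>sg. matching sl sg)"

text \<open>Slot by slot, the heavy elements present weigh no more than distinct heavy elements of
  \<open>Y\<close>. The light ones weigh at most \<open>cap\<close>, and \<open>heavy_fits\<close>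
  reserves room for both.\<close>

lemma inv_feasible:
  assumes "inv lev sl"
  shows "sum w (support lev) \<le> 1"
proof -
  obtain sg where sg: "matching sl sg" using assms by (auto simp: inv_def)
  let ?H = "{e \<in> support lev. \<tau> < w e}" and ?Q = "{y \<in> heavy_Y. 0 < sl (sg y)}"
  have H: "?H = {e. \<exists>i. sl i = Suc e}" using assms by (auto simp: inv_def slots_hold_def)
  have img: "?H \<subseteq> (\<lambda>y. sl (sg y) - 1) ` ?Q"
  proof
    fix e assume "e \<in> ?H"
    then obtain i where i: "sl i = Suc e" using H by auto
    then obtain y where "y \<in> heavy_Y" "i = sg y"
      using sg unfolding matching_def by (metis (no_types, lifting) imageE zero_less_Suc)
    then show "e \<in> (\<lambda>y. sl (sg y) - 1) ` ?Q" using i by (intro image_eqI[of _ _ y]) auto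
  qed
  have Q: "finite ?Q" using finite_Y by simp
  have img_n: "(\<lambda>y. sl (sg y) - 1) ` ?Q \<subseteq> {..<n}"
  proof
    fix e assume "e \<in> (\<lambda>y. sl (sg y) - 1) ` ?Q"
    then have "e \<in> ?H" unfolding H by force
    then show "e \<in> {..<n}" using support_sub by auto
  qed
  have "sum w ?H \<le> sum w ((\<lambda>y. sl (sg y) - 1) ` ?Q)"
    using img img_n Q w_nonneg by (intro sum_mono2) auto
  also have "\<dots> \<le> (\<Sum>y\<in>?Q. w (sl (sg y) - 1))"
  proof -
    have "0 \<le> w (sl (sg y) - 1)" if "y \<in> ?Q" for y
      using img_n w_nonneg that by blast
    then show ?thesis using sum_image_le[OF Q, of w "\<lambda>y. sl (sg y) - 1"] by (simp add: o_def)
  qed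
  also have "\<dots> \<le> (\<Sum>y\<in>?Q. w y)"
  proof (rule sum_mono)
    fix y assume "y \<in> ?Q"
    then show "w (sl (sg y) - 1) \<le> w y" using sg by (auto simp: matching_def gr0_conv_Suc)
  qed
  also have "\<dots> \<le> sum w heavy_Y"
    using finite_Y Y_sub w_nonneg by (intro sum_mono2) auto
  finally have "sum w ?H \<le> sum w heavy_Y" .
  moreover have "sum w (support lev) = load lev + sum w ?H"
    unfolding load_def using finite_support
    by (subst sum.union_disjoint[symmetric]) (auto intro: sum.cong)
  ultimately show ?thesis using assms heavy_fits by (auto simp: inv_def)
qed

lemma inv_Psi_le:
  assumes "inv lev sl"
  shows "Phi lev \<le> L * v" "Psi lev \<le> L * v"
proof -
  have "g (support lev) + sum lin (support lev) \<le> v"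
    using value_le[OF support_sub inv_feasible[OF assms]] .
  then have "L * (g (support lev) + sum lin (support lev)) \<le> L * v" by (intro mult_left_mono) auto
  then show "Phi lev \<le> L * v" using Phi_le[of lev] by simp
  then show "Psi lev \<le> L * v" using penalty_nonneg[of "load lev"] by (simp add: Psi_def)
qed

lemma inv_start: "inv (\<lambda>_. 0) (\<lambda>_. 0)"
proof -
  have s: "support (\<lambda>_. 0) = {}" by (simp add: support_def)
  have load: "load (\<lambda>_. 0) = 0" by (simp add: load_def s)
  have cap: "0 \<le> cap" using W_le_cap W_nonneg tau_nonneg by simp
  have "Psi (\<lambda>_. 0) = Phi (\<lambda>_. 0)" using W_nonneg by (simp add: Psi_def penalty_def load)
  then have "0 \<le> Psi (\<lambda>_. 0)" using Phi_nonneg by simp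
  moreover obtain h where "inj_on h heavy_Y" "h ` heavy_Y \<subseteq> {..<k}"
    using slots_enough finite_Y inj_on_iff_card_le[of heavy_Y "{..<k}"] by auto
  ultimately show ?thesis
    using load cap s by (auto simp: inv_def slots_hold_def matching_def)
qed

lemma inv_settle:
  assumes "inv lev sl"
  shows "inv (settle lev) sl" "Psi lev \<le> Psi (settle lev)"
proof -
  have "light_inv lev lev" using assms by (auto simp: inv_def light_inv_def)
  then have l: "light_inv lev (settle lev)" using eta_nonneg by (rule light_inv_settle)
  then have "{e \<in> support (settle lev). \<tau> < w e} = {e \<in> support lev. \<tau> < w e}"
    by (auto simp: light_inv_def support_def)
  then show "inv (settle lev) sl" "Psi lev \<le> Psi (settle lev)"
    using l assms by (auto simp: inv_def light_inv_def slots_hold_def)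
qed

text \<open>Otherwise each of the \<open>R\<close> sweeps would gain more than
  \<open>\<eta>\<close>, and the potential would exceed its bound \<open>L * v\<close>.\<close>

lemma settle_fixed:
  assumes "inv lev sl" "e < n" "w e \<le> \<tau>" "l \<le> L"
  shows "improve e (settle lev) l = settle lev"
proof -
  have "sweep (settle lev) = settle lev \<or> Psi lev + R * \<eta> \<le> Psi (settle lev)"
    unfolding settle_def using sweep_cases eta_nonneg by (intro funpow_progress) auto
  moreover have "Psi (settle lev) < Psi lev + R * \<eta>"
    using inv_Psi_le(2)[OF inv_settle(1)[OF assms(1)]] sweeps_enough assms(1) by (auto simp: inv_def)
  ultimately show ?thesis using sweep_fixed eta_nonneg assms by fastforce
qed

text \<open>Near \<open>cap\<close> the slope of the penalty is so large that removing some light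
  element would pay: \<open>load_bound\<close> contradicts \<open>steep\<close>. The remaining room
  \<open>\<tau>\<close> means that the test against \<open>cap\<close> blocks no light insertion, so
  a fixed point is a genuine local optimum.\<close>

lemma settled_load:
  assumes inv: "inv lev sl" and fixed: "\<And>e l. e < n \<Longrightarrow> w e \<le> \<tau> \<Longrightarrow> l \<le> L \<Longrightarrow> improve e lev l = lev"
  shows "load lev + \<tau> \<le> cap"
proof (cases "\<tau> = 0")
  case True
  moreover have "load lev \<le> cap" using inv by (simp add: inv_def)
  ultimately show ?thesis by linarith
next
  case False
  then have tau: "0 < \<tau>" using tau_nonneg by simp
  show ?thesis
  proof (rule ccontr)
    assume "\<not> load lev + \<tau> \<le> cap"
    then have big: "cap - W - \<tau> \<le> load lev - W" by simp
    have opt: "Psi (lev(s := 0)) \<le> Psi lev + \<eta>" if s: "s \<in> support lev" "w s \<le> \<tau>" for s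
    proof -
      have sn: "s < n" using s by (simp add: support_def)
      have "load (lev(s := 0)) \<le> cap"
        using load_remove[OF s] w_nonneg[of s] inv sn by (auto simp: inv_def)
      moreover have "improve s lev 0 = lev" using fixed sn s by auto
      moreover have "lev(s := 0) \<noteq> lev" using s by (auto simp: support_def fun_eq_iff)
      ultimately show ?thesis by (auto simp: improve_def split: if_splits)
    qed
    have "K * (max 0 (load lev - W) - \<tau> / 2) * load lev \<le> n * \<eta> + L * v"
      using load_bound[OF opt eta_nonneg] inv_Psi_le(1)[OF inv] by simp
    moreover have "K * (cap - W - 3 / 2 * \<tau>) * W \<le> K * (max 0 (load lev - W) - \<tau> / 2) * load lev"
      using big W_nonneg K_nonneg W_le_cap tau by (intro mult_mono) auto
    ultimately show False using steep[OF tau] by simp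
  qed
qed

lemma settled_light:
  assumes inv: "inv lev sl" and fixed: "\<And>e l. e < n \<Longrightarrow> w e \<le> \<tau> \<Longrightarrow> l \<le> L \<Longrightarrow> improve e lev l = lev"
    and e: "e < n" "w e \<le> \<tau>" "l \<le> L"
  shows "Psi (lev(e := l)) \<le> Psi lev + \<eta>"
proof -
  have "load (lev(e := l)) \<le> load lev + \<tau>"
  proof (cases "e \<in> support lev")
    case True
    then show ?thesis using load_remove[of e lev] load_move[of e lev l] e w_nonneg[of e] tau_nonneg
      by (cases "l = 0") auto
  next
    case False
    then have "lev e = 0" using e by (auto simp: support_def)
    then have "l = 0 \<Longrightarrow> lev(e := l) = lev" by auto
    then show ?thesis using load_add[of e lev l] e False tau_nonneg by (cases "l = 0") auto
  qed
  then have "load (lev(e := l)) \<le> cap" using settled_load[OF inv fixed] by simp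
  moreover have "\<not> Psi lev + \<eta> < Psi (lev(e := l))" if "load (lev(e := l)) \<le> cap"
  proof
    assume "Psi lev + \<eta> < Psi (lev(e := l))"
    then have "lev(e := l) = lev" using fixed[OF e] that by (simp add: improve_def)
    then show False using \<open>Psi lev + \<eta> < Psi (lev(e := l))\<close> eta_nonneg by simp
  qed
  ultimately show ?thesis by simp
qed

text \<open>Take a matching with the most elements in their own slots. If \<open>y\<close> sits in
  the slot of \<open>z\<close>, then \<open>w y \<le> w z\<close>, so exchanging the slots of
  \<open>y\<close> and \<open>z\<close> preserves the weight condition; now \<open>y\<close> is in
  its own slot, while \<open>z\<close> was not in its own before. \<open>local_optimum\<close> needs
  this so that an element of \<open>Y\<close> already present replaces itself.\<close>

lemma own_matching:
  assumes "slots_hold lev sl" "matching sl sg0"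
  shows "\<exists>sg. matching sl sg \<and> (\<forall>y\<in>heavy_Y. y \<in> support lev \<longrightarrow> sl (sg y) = Suc y)"
proof -
  define own where "own sg = card {y \<in> heavy_Y. sl (sg y) = Suc y}" for sg
  have "\<exists>sg. matching sl sg \<and> (\<forall>sg'. matching sl sg' \<longrightarrow> own sg' \<le> own sg)"
  proof (rule ex_has_greatest_nat[of "matching sl" sg0 own "Suc (card heavy_Y)"])
    show "\<forall>sg. matching sl sg \<longrightarrow> own sg < Suc (card heavy_Y)"
      unfolding own_def using finite_Y by (auto simp: less_Suc_eq_le intro!: card_mono)
  qed (rule assms)
  then obtain sg where sg: "matching sl sg" and max: "\<And>sg'. matching sl sg' \<Longrightarrow> own sg' \<le> own sg"
    by blast
  have "sl (sg y) = Suc y" if y: "y \<in> heavy_Y" "y \<in> support lev" for y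
  proof (rule ccontr)
    assume not_own: "sl (sg y) \<noteq> Suc y"
    have "y \<in> {e \<in> support lev. \<tau> < w e}" using y by auto
    then have "y \<in> {e. \<exists>i. sl i = Suc e}" using assms(1) unfolding slots_hold_def by blast
    then obtain i where i: "sl i = Suc y" by blast
    then obtain z where z: "z \<in> heavy_Y" "i = sg z"
      using sg unfolding matching_def by (metis (no_types, lifting) imageE zero_less_Suc)
    have yz: "y \<noteq> z" using i z not_own by auto
    define sg' where "sg' = sg(y := sg z, z := sg y)"
    have inj: "inj_on sg heavy_Y" using sg by (simp add: matching_def)
    have img: "sg' ` heavy_Y = sg ` heavy_Y"
      using y z yz unfolding sg'_def by (auto simp: image_iff)
    have inj': "inj_on sg' heavy_Y"
      by (rule eq_card_imp_inj_on) (use finite_Y img card_image[OF inj] in auto)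
    have wyz: "w y \<le> w z" using sg i z by (auto simp: matching_def)
    have "matching sl sg'"
      unfolding matching_def img
    proof (intro conjI inj' ballI allI impI)
      fix x e assume x: "x \<in> heavy_Y" and e: "sl (sg' x) = Suc e"
      consider "x = y" | "x = z" | "x \<noteq> y" "x \<noteq> z" by blast
      then show "w e \<le> w x"
      proof cases
        case 1
        then have "Suc e = Suc y" using e i z yz by (simp add: sg'_def)
        then show ?thesis using 1 by simp
      next
        case 2
        then have "w e \<le> w y" using e sg y by (auto simp: sg'_def matching_def)
        then show ?thesis using wyz 2 by simp
      next
        case 3
        then show ?thesis using e sg x by (auto simp: sg'_def matching_def)
      qed
    qed (use sg in \<open>auto simp: matching_def\<close>)
    moreover have "own sg < own sg'"
      unfolding own_def
    proof (rule psubset_card_mono)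
      show "finite {y \<in> heavy_Y. sl (sg' y) = Suc y}" using finite_Y by simp
      have "sl (sg z) \<noteq> Suc z" using i z yz by simp
      then have "{x \<in> heavy_Y. sl (sg x) = Suc x} \<subseteq> {x \<in> heavy_Y. sl (sg' x) = Suc x}"
        using not_own by (auto simp: sg'_def)
      moreover have "y \<in> {x \<in> heavy_Y. sl (sg' x) = Suc x}"
        using y i z yz by (auto simp: sg'_def)
      ultimately show "{x \<in> heavy_Y. sl (sg x) = Suc x} \<subset> {x \<in> heavy_Y. sl (sg' x) = Suc x}"
        using not_own by blast
    qed
    ultimately show False using max by fastforce
  qed
  then show ?thesis using sg by blast
qed

text \<open>By \<open>local_optimum\<close>, a settled state of too small a value has a profitable
  exchange inserting some heavy \<open>y\<close> of \<open>Y\<close> into the slot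
  \<open>sg y\<close>. The scan may prefer another element, but never one heavier than
  \<open>y\<close>, so the same injection still certifies the new state.\<close>

lemma exchange_progress:
  assumes inv: "inv lev sl"
    and fixed: "\<And>e l. e < n \<Longrightarrow> w e \<le> \<tau> \<Longrightarrow> l \<le> L \<Longrightarrow> improve e lev l = lev"
    and bad: "g (support lev) + sum lin (support lev) < beta L * g Y + sum lin Y - err"
  shows "\<exists>d<k. \<exists>lev' sl'. exchange d lev sl = (lev', sl') \<and> inv lev' sl' \<and> Psi lev + \<theta> \<le> Psi lev'"
proof -
  obtain sg where sg: "matching sl sg"
    and own: "\<And>y. y \<in> heavy_Y \<Longrightarrow> y \<in> support lev \<Longrightarrow> sl (sg y) = Suc y"
    using own_matching inv unfolding inv_def by blast
  have hold: "slots_hold lev sl" using inv by (simp add: inv_def)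
  define \<rho> where "\<rho> y = {e. sl (sg y) = Suc e}" for y
  have "\<exists>y\<in>heavy_Y. \<exists>j<L. Psi lev + \<theta> < Psi (place lev y j (\<rho> y))"
  proof (rule ccontr)
    assume "\<not> ?thesis"
    then have heavy: "\<And>y j. y \<in> heavy_Y \<Longrightarrow> j < L \<Longrightarrow> Psi (place lev y j (\<rho> y)) \<le> Psi lev + \<theta>"
      by (meson linorder_not_less)
    have "beta L * g Y + sum lin Y - (g (support lev) + sum lin (support lev))
      \<le> card {..<n} * \<eta> + card heavy_Y * \<theta> + K * \<tau> / 2 * (sum w {e \<in> Y. w e \<le> \<tau>} + load lev)"
    proof (rule local_optimum[where \<rho> = \<rho>])
      show "lev e \<le> L" for e using inv by (auto simp: inv_def)
      show "Y \<subseteq> {..<n}" by (rule Y_sub)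
      show "Psi (lev(e := l)) \<le> Psi lev + \<eta>" if "e \<in> support lev \<union> Y" "w e \<le> \<tau>" "l \<le> L" for e l
        using settled_light[OF inv fixed, of e l] that Y_sub by (auto simp: support_def)
      show "Psi (place lev e j (\<rho> e)) \<le> Psi lev + \<theta>" if "e \<in> Y" "\<tau> < w e" "j < L" for e j
        using heavy that by auto
      show "\<rho> e = {} \<or> (\<exists>s. \<rho> e = {s})" for e
        by (cases "sl (sg e)") (auto simp: \<rho>_def)
      show "disjoint_family_on \<rho> heavy_Y"
        unfolding disjoint_family_on_def
      proof (intro ballI impI)
        fix y z assume yz: "y \<in> heavy_Y" "z \<in> heavy_Y" "y \<noteq> z"
        then have "sg y \<noteq> sg z" using sg unfolding matching_def inj_on_def by blast
        then have "sl (sg y) = sl (sg z) \<Longrightarrow> \<not> 0 < sl (sg y)"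
          using hold unfolding slots_hold_def by blast
        then show "\<rho> y \<inter> \<rho> z = {}" by (force simp: \<rho>_def)
      qed
      show "\<Union> (\<rho> ` heavy_Y) = {s \<in> support lev. \<tau> < w s}"
      proof -
        have "\<Union> (\<rho> ` heavy_Y) = {e. \<exists>i. sl i = Suc e}"
        proof (intro equalityI subsetI)
          fix e assume "e \<in> {e. \<exists>i. sl i = Suc e}"
          then obtain i where i: "sl i = Suc e" by blast
          then have "i \<in> sg ` heavy_Y" using sg unfolding matching_def by simp
          then show "e \<in> \<Union> (\<rho> ` heavy_Y)" using i by (auto simp: \<rho>_def)
        qed (auto simp: \<rho>_def)
        then show ?thesis using hold by (simp add: slots_hold_def)
      qed
      show "e \<in> \<rho> e" if "e \<in> Y" "\<tau> < w e" "e \<in> support lev" for e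
        using own that by (auto simp: \<rho>_def)
    qed (use light_fits eta_nonneg tau_nonneg in auto)
    moreover have "card heavy_Y * \<theta> \<le> k * \<theta>"
      using slots_enough theta_nonneg by (intro mult_right_mono) auto
    moreover have "K * \<tau> / 2 * (sum w {e \<in> Y. w e \<le> \<tau>} + load lev) \<le> K * \<tau> / 2 * (W + cap)"
      using light_fits inv K_nonneg tau_nonneg by (intro mult_left_mono) (auto simp: inv_def)
    ultimately show False using err bad by simp
  qed
  then obtain y j where y: "y \<in> heavy_Y" "j < L" and gain: "Psi lev + \<theta> < Psi (place lev y j (\<rho> y))"
    by blast
  let ?d = "sg y" and ?lev = "vacate (sg y) lev sl"
  have yn: "y < n" using y Y_sub by auto
  have dk: "?d < k" using sg y by (auto simp: matching_def)
  have vac: "?lev = (\<lambda>x. if x \<in> \<rho> y then 0 else lev x)"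
    by (cases "sl (sg y)") (auto simp: vacate_def \<rho>_def)
  have y0: "?lev y = 0"
    using own[OF y(1)] yn by (auto simp: vac \<rho>_def support_def)
  have "place lev y j (\<rho> y) = ?lev(y := Suc j)" by (auto simp: vac place_def)
  then have "(y, j) \<in> choices ?lev (Psi lev)" using gain y yn y0 by (auto simp: choices_def)
  moreover obtain be bl where b: "scan ?lev (Psi lev) = (be, bl)" by fastforce
  ultimately have "0 < bl" "w be \<le> w y" and ch: "(be, bl - 1) \<in> choices ?lev (Psi lev)"
    using scan_lightest[of ?lev "Psi lev"] y yn unfolding lightest_in_def by auto
  then have be: "be < n" "bl \<le> L" "\<tau> < w be" "?lev be = 0" "Psi lev + \<theta> \<le> Psi (?lev(be := bl))"
    by (auto simp: choices_def)
  let ?lev' = "?lev(be := bl)" and ?sl' = "sl(?d := Suc be)"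
  have ex: "exchange ?d lev sl = (?lev', ?sl')"
    using b \<open>0 < bl\<close> by (simp add: exchange_def)
  have heavy_rho: "e \<in> support lev \<and> \<tau> < w e" if "e \<in> \<rho> y" for e
    using hold that by (auto simp: slots_hold_def \<rho>_def)
  have "inv ?lev' ?sl'"
    unfolding inv_def
  proof (intro conjI allI impI)
    show "?lev' e \<le> L" for e using be inv by (auto simp: vac inv_def)
    show "?lev' e = 0" if "n \<le> e" for e using be inv that by (auto simp: vac inv_def)
    have "{x \<in> support ?lev'. w x \<le> \<tau>} = {x \<in> support lev. w x \<le> \<tau>}"
      using be heavy_rho by (force simp: support_def vac split: if_splits)
    then have "load ?lev' = load lev" by (simp add: load_def)
    then show "load ?lev' \<le> cap" using inv by (simp add: inv_def)
    show "0 \<le> Psi ?lev'" using be(5) theta_nonneg inv by (auto simp: inv_def)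
    have new: "sl i \<noteq> Suc be" if "i \<noteq> ?d" for i
    proof
      assume i: "sl i = Suc be"
      then have "be \<in> {e \<in> support lev. \<tau> < w e}" using hold unfolding slots_hold_def by auto
      then have "be \<in> \<rho> y" using be(4) by (auto simp: vac support_def split: if_splits)
      then have "sl ?d = Suc be" by (simp add: \<rho>_def)
      then have "i = ?d" using hold i unfolding slots_hold_def by simp
      then show False using that by simp
    qed
    show "slots_hold ?lev' ?sl'"
      unfolding slots_hold_def
    proof (intro conjI allI impI)
      fix i i' assume "?sl' i = ?sl' i'" "0 < ?sl' i"
      then show "i = i'" using new hold unfolding slots_hold_def
        by (cases "i = ?d"; cases "i' = ?d") auto
    next
      have old: "{e \<in> support lev. \<tau> < w e} = {e. \<exists>i. sl i = Suc e}" using hold by (simp add: slots_hold_def)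
      have "{e \<in> support ?lev'. \<tau> < w e} = insert be ({e \<in> support lev. \<tau> < w e} - \<rho> y)"
        using be \<open>0 < bl\<close> by (auto simp: support_def vac split: if_splits)
      also have "{e \<in> support lev. \<tau> < w e} - \<rho> y = {e. \<exists>i. i \<noteq> ?d \<and> sl i = Suc e}"
      proof (intro equalityI subsetI)
        fix e assume "e \<in> {e. \<exists>i. i \<noteq> ?d \<and> sl i = Suc e}"
        then obtain i where i: "i \<noteq> ?d" "sl i = Suc e" by blast
        have "sl ?d \<noteq> Suc e"
        proof
          assume "sl ?d = Suc e"
          then have "i = ?d" using hold i(2) unfolding slots_hold_def by simp
          then show False using i(1) by simp
        qed
        then show "e \<in> {e \<in> support lev. \<tau> < w e} - \<rho> y" using i old by (auto simp: \<rho>_def)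
      next
        fix e assume "e \<in> {e \<in> support lev. \<tau> < w e} - \<rho> y"
        then have "sl ?d \<noteq> Suc e" and "\<exists>i. sl i = Suc e" using old by (auto simp: \<rho>_def)
        then obtain i where "sl i = Suc e" by blast
        moreover from this \<open>sl ?d \<noteq> Suc e\<close> have "i \<noteq> ?d" by auto
        ultimately show "e \<in> {e. \<exists>i. i \<noteq> ?d \<and> sl i = Suc e}" by blast
      qed
      also have "insert be \<dots> = {e. \<exists>i. ?sl' i = Suc e}" by auto
      finally show "{e \<in> support ?lev'. \<tau> < w e} = {e. \<exists>i. ?sl' i = Suc e}" .
    qed
    have "matching ?sl' sg"
      unfolding matching_def
    proof (intro conjI ballI allI impI)
      fix z e assume z: "z \<in> heavy_Y" "?sl' (sg z) = Suc e"
      show "w e \<le> w z"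
      proof (cases "sg z = ?d")
        case True
        then have "z = y" using sg y z unfolding matching_def inj_on_def by blast
        then show ?thesis using z \<open>w be \<le> w y\<close> by simp
      next
        case False
        then show ?thesis using z sg unfolding matching_def by simp
      qed
    next
      fix i assume "0 < ?sl' i"
      then show "i \<in> sg ` heavy_Y" using sg y by (cases "i = ?d") (auto simp: matching_def)
    qed (use sg in \<open>auto simp: matching_def\<close>)
    then show "\<exists>sg. matching ?sl' sg" by blast
  qed
  then show ?thesis using ex dk be(5) by blast
qed

text \<open>\<open>m\<close> counts the rounds that the bound on the potential still allows. The
  slot supplied by \<open>exchange_progress\<close> becomes the lowest digit of the code. A good
  state may occur before the last round, and nothing is known about the rounds after it, hence the
  existential \<open>t\<close>.\<close>

lemma good_round:
  assumes "inv lev sl" and "L * v < Psi lev + m * \<theta>"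
  shows "\<exists>c<k ^ m. \<exists>t<m. \<exists>lev' sl'. settle (fst ((round ^^ t) (lev, sl, c))) = lev' \<and> inv lev' sl' \<and>
    beta L * g Y + sum lin Y - err \<le> g (support lev') + sum lin (support lev')"
  using assms
proof (induction m arbitrary: lev sl)
  case 0
  then show ?case using inv_Psi_le(2) by fastforce
next
  case (Suc m)
  let ?lev = "settle lev"
  have inv: "inv ?lev sl" and up: "Psi lev \<le> Psi ?lev" using inv_settle Suc.prems by auto
  show ?case
  proof (cases "g (support ?lev) + sum lin (support ?lev) < beta L * g Y + sum lin Y - err")
    case True
    then obtain d lev' sl' where d: "d < k" "exchange d ?lev sl = (lev', sl')" "inv lev' sl'"
      "Psi ?lev + \<theta> \<le> Psi lev'"
      using exchange_progress[OF inv settle_fixed[OF Suc.prems(1)]] by blast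
    have "L * v < Psi lev' + m * \<theta>" using d(4) up Suc.prems(2) by (simp add: algebra_simps)
    from Suc.IH[OF d(3) this] obtain c t lev'' sl'' where c: "c < k ^ m" "t < m"
      "settle (fst ((round ^^ t) (lev', sl', c))) = lev''" "inv lev'' sl''"
      "beta L * g Y + sum lin Y - err \<le> g (support lev'') + sum lin (support lev'')"
      by blast
    have "round (lev, sl, d + k * c) = (lev', sl', c)" using d by (simp add: round_def)
    then have "(round ^^ Suc t) (lev, sl, d + k * c) = (round ^^ t) (lev', sl', c)"
      by (simp add: funpow_swap1)
    moreover have "d + k * c < k ^ Suc m"
    proof -
      have "d + k * c < k * Suc c" using d by simp
      also have "\<dots> \<le> k * k ^ m" using c(1) by (intro mult_left_mono) auto
      finally show ?thesis by simp
    qed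
    ultimately show ?thesis using c by (metis Suc_less_eq)
  next
    case False
    moreover have "0 < k ^ Suc m" using k_pos by simp
    ultimately show ?thesis using inv by (intro exI[of _ 0] conjI exI[of _ ?lev] exI[of _ sl]) auto
  qed
qed

lemma good_candidate:
  "\<exists>c<k ^ M. \<exists>t<M. sum w (support (candidate c t)) \<le> 1 \<and>
    beta L * g Y + sum lin Y - err \<le> g (support (candidate c t)) + sum lin (support (candidate c t))"
proof -
  have "L * v < Psi (\<lambda>_. 0) + M * \<theta>" using rounds_enough inv_start by (auto simp: inv_def)
  from good_round[OF inv_start this] show ?thesis
    unfolding candidate_def using inv_feasible by blast
qed

end

section \<open>Reasoning about coin-free programs\<close>

text \<open>There is no rule for \<open>CFlip\<close>: a derivation witnesses an execution without
  coin flips, whose distribution is a point mass after exactly the counted number of steps.\<close>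

inductive bs :: "rinstance \<Rightarrow> com \<Rightarrow> rstate \<Rightarrow> nat \<Rightarrow> rstate \<Rightarrow> bool" for I where
  bs_skip: "bs I CSkip s 1 s"
| bs_nat: "bs I (CNatSet k a b) s 1 (nat_store k (neval I s a) (neval I s b) s)"
| bs_real: "bs I (CRealSet k a r) s 1 (real_store k (neval I s a) (reval I s r) s)"
| bs_seq: "bs I c s t s' \<Longrightarrow> bs I d s' t' s'' \<Longrightarrow> bs I (CSeq c d) s (Suc (t + t')) s''"
| bs_if: "bs I (if beval I s b then c else d) s t s' \<Longrightarrow> bs I (CIf b c d) s (Suc t) s'"
| bs_stop: "\<not> beval I s b \<Longrightarrow> bs I (CWhile b c) s 1 s"
| bs_loop: "beval I s b \<Longrightarrow> bs I c s t s' \<Longrightarrow> bs I (CWhile b c) s' t' s'' \<Longrightarrow>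
    bs I (CWhile b c) s (Suc (t + t')) s''"

text \<open>The arbitrary rest \<open>K\<close> of the stack is what carries the induction through
  sequences and loops.\<close>

lemma bs_run:
  "bs I c s t s' \<Longrightarrow> ((\<lambda>p. bind_pmf p (rstep I)) ^^ t) (return_pmf (c # K, s)) = return_pmf (K, s')"
proof (induction arbitrary: K rule: bs.induct)
  case (bs_seq c s t s' d t' s'')
  then show ?case
    by (simp add: bind_return_pmf funpow_swap1 del: funpow.simps(2) add: funpow_Suc_right)
       (simp add: add.commute[of t] funpow_add)
next
  case (bs_loop s b c t s' t' s'')
  then show ?case
    by (simp add: bind_return_pmf del: funpow.simps(2) add: funpow_Suc_right)
       (simp add: add.commute[of t] funpow_add)
next
  case (bs_if s b c d t s')
  then show ?case
    by (simp add: bind_return_pmf del: funpow.simps(2) add: funpow_Suc_right)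
qed (simp_all add: bind_return_pmf)

text \<open>A number names both a natural-number array and a real array; one set of numbers serves
  as the footprint in both memories.\<close>

primrec writes :: "com \<Rightarrow> nat set" where
  "writes CSkip = {}"
| "writes (CNatSet k a b) = {k}"
| "writes (CRealSet k a r) = {k}"
| "writes (CFlip k a r) = {k}"
| "writes (CSeq c d) = writes c \<union> writes d"
| "writes (CIf b c d) = writes c \<union> writes d"
| "writes (CWhile b c) = writes c"

definition agree :: "nat set \<Rightarrow> rstate \<Rightarrow> rstate \<Rightarrow> bool" where
  "agree A s s' \<longleftrightarrow> (\<forall>k\<in>A. nmem s' k = nmem s k \<and> rmem s' k = rmem s k)"

lemma nmem_nat_store [simp]:
  "nmem (nat_store k i v s) k' = (if k' = k then (nmem s k)(i := v) else nmem s k')"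
  by (simp add: nat_store_def)

lemma rmem_nat_store [simp]: "rmem (nat_store k i v s) = rmem s"
  by (simp add: nat_store_def)

lemma nmem_real_store [simp]: "nmem (real_store k i v s) = nmem s"
  by (simp add: real_store_def)

lemma rmem_real_store [simp]:
  "rmem (real_store k i v s) k' = (if k' = k then (rmem s k)(i := v) else rmem s k')"
  by (simp add: real_store_def)

lemma bs_agree: "bs I c s t s' \<Longrightarrow> agree (- writes c) s s'"
  by (induction rule: bs.induct) (auto simp: agree_def split: if_splits)

text \<open>Total correctness with a step budget. Since \<open>bs\<close> yields a point mass,
  exhibiting one execution describes all outcomes.\<close>

definition wp :: "rinstance \<Rightarrow> com \<Rightarrow> (rstate \<Rightarrow> bool) \<Rightarrow> nat \<Rightarrow> rstate \<Rightarrow> bool" where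
  "wp I c Q T s \<longleftrightarrow> (\<exists>s' t. t \<le> T \<and> bs I c s t s' \<and> Q s')"

lemma wp_mono: "wp I c Q T s \<Longrightarrow> (\<And>s'. Q s' \<Longrightarrow> Q' s') \<Longrightarrow> T \<le> T' \<Longrightarrow> wp I c Q' T' s"
  by (auto simp: wp_def intro: order_trans)

lemma wp_time: "wp I c Q T s \<Longrightarrow> T \<le> T' \<Longrightarrow> wp I c Q T' s"
  by (rule wp_mono)

lemma wp_frame: "wp I c Q T s \<Longrightarrow> wp I c (\<lambda>s'. Q s' \<and> agree (- writes c) s s') T s"
  unfolding wp_def using bs_agree by blast

lemma wp_use:
  "wp I c P T s \<Longrightarrow> (\<And>s'. P s' \<Longrightarrow> agree (- writes c) s s' \<Longrightarrow> Q s') \<Longrightarrow> wp I c Q T s"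
  using wp_frame[of I c P T s] wp_mono[of I c _ T s Q T] by blast

lemma wp_skip: "Q s \<Longrightarrow> wp I CSkip Q 1 s"
  unfolding wp_def using bs_skip by blast

lemma wp_nat: "Q (nat_store k (neval I s a) (neval I s b) s) \<Longrightarrow> wp I (CNatSet k a b) Q 1 s"
  unfolding wp_def using bs_nat by blast

lemma wp_real: "Q (real_store k (neval I s a) (reval I s r) s) \<Longrightarrow> wp I (CRealSet k a r) Q 1 s"
  unfolding wp_def using bs_real by blast

lemma wp_seq: "wp I c (wp I d Q T') T s \<Longrightarrow> wp I (CSeq c d) Q (Suc (T + T')) s"
  unfolding wp_def by (meson add_mono bs_seq Suc_le_mono)

lemma wp_call:
  assumes "wp I c P T s" "\<And>s'. P s' \<Longrightarrow> agree (- writes c) s s' \<Longrightarrow> wp I d Q T' s'"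
  shows "wp I (CSeq c d) Q (Suc (T + T')) s"
  using assms by (intro wp_seq) (rule wp_use)

text \<open>The budgets of the branches are added, which keeps \<open>max\<close> out of all later
  time bounds.\<close>

lemma wp_if:
  assumes "beval I s b \<Longrightarrow> wp I c Q T s" "\<not> beval I s b \<Longrightarrow> wp I d Q T' s"
  shows "wp I (CIf b c d) Q (Suc (T + T')) s"
proof (cases "beval I s b")
  case True
  then obtain s' t where "t \<le> T" "bs I c s t s'" "Q s'" using assms unfolding wp_def by blast
  moreover from this True have "bs I (CIf b c d) s (Suc t) s'" by (intro bs_if) simp
  ultimately show ?thesis unfolding wp_def by (intro exI[of _ s'] exI[of _ "Suc t"]) simp
next
  case False
  then obtain s' t where "t \<le> T'" "bs I d s t s'" "Q s'" using assms unfolding wp_def by blast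
  moreover from this False have "bs I (CIf b c d) s (Suc t) s'" by (intro bs_if) simp
  ultimately show ?thesis unfolding wp_def by (intro exI[of _ s'] exI[of _ "Suc t"]) simp
qed

lemma wp_while:
  assumes start: "Inv 0 s"
    and step: "\<And>i s. Inv i s \<Longrightarrow> beval I s b \<Longrightarrow> i < m \<and> wp I c (Inv (Suc i)) T s"
    and stop: "\<And>i s. i \<le> m \<Longrightarrow> Inv i s \<Longrightarrow> \<not> beval I s b \<Longrightarrow> Q s"
  shows "wp I (CWhile b c) Q (m * Suc T + 1) s"
proof -
  have "wp I (CWhile b c) Q ((m - i) * Suc T + 1) s" if "i \<le> m" "Inv i s" for i s
    using that
  proof (induction "m - i" arbitrary: i s)
    case 0
    then have "\<not> beval I s b" using step[of i s] by auto
    then have "bs I (CWhile b c) s 1 s" "Q s" using bs_stop stop[of i s] 0 by auto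
    then show ?case unfolding wp_def by (metis le_add2)
  next
    case (Suc d)
    show ?case
    proof (cases "beval I s b")
      case True
      then have "i < m" "wp I c (Inv (Suc i)) T s" using step Suc.prems by auto
      then obtain s1 t1 where 1: "t1 \<le> T" "bs I c s t1 s1" "Inv (Suc i) s1" unfolding wp_def by blast
      have d: "d = m - Suc i" using Suc.hyps(2) by simp
      from Suc.hyps(1)[OF d _ 1(3)] \<open>i < m\<close> obtain s2 t2
        where 2: "t2 \<le> (m - Suc i) * Suc T + 1" "bs I (CWhile b c) s1 t2 s2" "Q s2"
        unfolding wp_def by auto
      have "m - i = Suc (m - Suc i)" using \<open>i < m\<close> by simp
      then have "Suc (t1 + t2) \<le> (m - i) * Suc T + 1" using 1(1) 2(1) by simp
      then show ?thesis using bs_loop[OF True 1(2) 2(2)] 2(3) unfolding wp_def by blast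
    next
      case False
      then have "bs I (CWhile b c) s 1 s" "Q s" using bs_stop stop[of i s] Suc.prems by auto
      then show ?thesis unfolding wp_def by (metis le_add2)
    qed
  qed
  from this[of 0 s] start show ?thesis by simp
qed

section \<open>Loops and arithmetic on natural numbers\<close>

abbreviation V :: "nat \<Rightarrow> nexp" where "V k \<equiv> NRead k (NConst 0)"
abbreviation RV :: "nat \<Rightarrow> rexp" where "RV k \<equiv> RRead k (NConst 0)"
abbreviation nset :: "nat \<Rightarrow> nexp \<Rightarrow> com" where "nset k a \<equiv> CNatSet k (NConst 0) a"
abbreviation rset :: "nat \<Rightarrow> rexp \<Rightarrow> com" where "rset k r \<equiv> CRealSet k (NConst 0) r"
abbreviation only_if :: "bexp \<Rightarrow> com \<Rightarrow> com" where "only_if b c \<equiv> CIf b c CSkip"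
abbreviation cseq :: "com \<Rightarrow> com \<Rightarrow> com"  (infixr ";;" 60) where "c ;; d \<equiv> CSeq c d"

definition for_loop :: "nat \<Rightarrow> nexp \<Rightarrow> com \<Rightarrow> com" where
  "for_loop v bnd c =
     (nset v (NConst 0) ;; CWhile (BNatLess (V v) bnd) (c ;; nset v (NAdd (V v) (NConst 1))))"

lemma writes_for_loop [simp]: "writes (for_loop v bnd c) = insert v (writes c)"
  by (auto simp: for_loop_def)

text \<open>The rule tracks the counter cell itself and passes its value to the body, so the
  invariant has to be insensitive to that cell.\<close>

lemma wp_for:
  assumes start: "Inv 0 s"
    and bnd: "\<And>i s. Inv i s \<Longrightarrow> neval I s bnd = m"
    and indep: "\<And>i s x. Inv i s \<Longrightarrow> Inv i (nat_store v 0 x s)"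
    and step: "\<And>i s. i < m \<Longrightarrow> nmem s v 0 = i \<Longrightarrow> Inv i s \<Longrightarrow> wp I c (Inv (Suc i)) T s"
    and fresh: "v \<notin> writes c"
  shows "wp I (for_loop v bnd c) (Inv m) (m * (T + 3) + 3) s"
proof -
  let ?Inv = "\<lambda>i s. i \<le> m \<and> nmem s v 0 = i \<and> Inv i s"
  have "wp I (CWhile (BNatLess (V v) bnd) (c ;; nset v (NAdd (V v) (NConst 1)))) (Inv m)
      (m * Suc (Suc (T + 1)) + 1) (nat_store v 0 0 s)"
  proof (rule wp_while[where Inv = ?Inv])
    show "0 \<le> m \<and> nmem (nat_store v 0 0 s) v 0 = 0 \<and> Inv 0 (nat_store v 0 0 s)"
      using start indep by simp
  next
    fix i s assume i: "?Inv i s" and b: "beval I s (BNatLess (V v) bnd)"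
    then have "i < m" using bnd by auto
    moreover have "wp I (c ;; nset v (NAdd (V v) (NConst 1))) (?Inv (Suc i)) (Suc (T + 1)) s"
    proof (rule wp_seq, rule wp_use[OF step[OF \<open>i < m\<close>]])
      show "nmem s v 0 = i" "Inv i s" using i by auto
      fix s' assume s': "Inv (Suc i) s'" "agree (- writes c) s s'"
      then have "nmem s' v 0 = i" using fresh i by (auto simp: agree_def)
      then show "wp I (nset v (NAdd (V v) (NConst 1))) (?Inv (Suc i)) 1 s'"
        using \<open>i < m\<close> s' indep[OF s'(1)] by (intro wp_nat) simp
    qed
    ultimately show "i < m \<and> wp I (c ;; nset v (NAdd (V v) (NConst 1))) (?Inv (Suc i)) (Suc (T + 1)) s"
      by blast
  next
    fix i s assume "i \<le> m" "?Inv i s" "\<not> beval I s (BNatLess (V v) bnd)"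
    then show "Inv m s" using bnd[of i s] by auto
  qed
  then have "wp I (for_loop v bnd c) (Inv m) (Suc (1 + (m * Suc (Suc (T + 1)) + 1))) s"
    unfolding for_loop_def by (intro wp_seq wp_nat) simp
  then show ?thesis by (rule wp_time) (simp add: algebra_simps)
qed

text \<open>The machine cannot multiply naturals in one step. Repeated addition takes time linear in
  the first factor, which is therefore chosen small.\<close>

definition mul_prog :: "nat \<Rightarrow> nat \<Rightarrow> nexp \<Rightarrow> nexp \<Rightarrow> com" where
  "mul_prog z v a b = (nset z (NConst 0) ;; for_loop v a (nset z (NAdd (V z) b)))"

primrec mentions :: "nexp \<Rightarrow> nat set" where
  "mentions (NConst c) = {}"
| "mentions NSize = {}"
| "mentions (NRead k a) = insert k (mentions a)"
| "mentions (NAdd a b) = mentions a \<union> mentions b"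
| "mentions (NSub a b) = mentions a \<union> mentions b"

lemma neval_agree: "agree (mentions a) s s' \<Longrightarrow> neval I s' a = neval I s a"
  by (induction a) (auto simp: agree_def)

lemma wp_mul:
  assumes "z \<notin> mentions a \<union> mentions b" "v \<notin> mentions a \<union> mentions b" "z \<noteq> v"
  shows "wp I (mul_prog z v a b) (\<lambda>s'. nmem s' z 0 = neval I s a * neval I s b)
    (neval I s a * 4 + 5) s"
proof -
  let ?A = "- {z, v}"
  have ev: "neval I s' a = neval I s a" "neval I s' b = neval I s b" if "agree ?A s s'" for s'
  proof -
    have "agree (mentions a) s s'" "agree (mentions b) s s'" using that assms by (auto simp: agree_def)
    then show "neval I s' a = neval I s a" "neval I s' b = neval I s b" by (simp_all add: neval_agree)
  qed
  let ?Inv = "\<lambda>i s'. agree ?A s s' \<and> nmem s' z 0 = i * neval I s b"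
  have "wp I (for_loop v a (nset z (NAdd (V z) b))) (?Inv (neval I s a)) (neval I s a * (1 + 3) + 3)
      (nat_store z 0 0 s)"
  proof (rule wp_for)
    show "?Inv 0 (nat_store z 0 0 s)" by (simp add: agree_def)
    show "neval I s' a = neval I s a" if "?Inv i s'" for i s'
      using ev(1) that by blast
    show "?Inv i (nat_store v 0 x s')" if "?Inv i s'" for i s' x
      using that assms(3) by (simp add: agree_def)
    show "wp I (nset z (NAdd (V z) b)) (?Inv (Suc i)) 1 s'" if "?Inv i s'" for i s'
    proof (rule wp_nat)
      have "neval I s' b = neval I s b" using ev(2) that by blast
      then show "?Inv (Suc i) (nat_store z (neval I s' (NConst 0)) (neval I s' (NAdd (V z) b)) s')"
        using that by (simp add: agree_def)
    qed
    show "v \<notin> writes (nset z (NAdd (V z) b))" using assms(3) by simp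
  qed
  then have "wp I (mul_prog z v a b) (?Inv (neval I s a)) (Suc (1 + (neval I s a * (1 + 3) + 3))) s"
    unfolding mul_prog_def by (intro wp_seq wp_nat) simp
  then show ?thesis by (rule wp_mono) auto
qed

lemma writes_mul_prog [simp]: "writes (mul_prog z v a b) = {z, v}"
  by (auto simp: mul_prog_def)

lemma wp_mul_values:
  assumes "z \<notin> mentions a \<union> mentions b" "v \<notin> mentions a \<union> mentions b" "z \<noteq> v"
    and "neval I s a = x" "neval I s b = y"
  shows "wp I (mul_prog z v a b) (\<lambda>s'. nmem s' z 0 = x * y) (x * 4 + 5) s"
  using wp_mul[OF assms(1-3)] assms(4,5) by blast

text \<open>Division by repeated subtraction: the remainder stays in \<open>x\<close>, and the
  quotient is counted in \<open>q\<close>.\<close>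

definition div_prog :: "nat \<Rightarrow> nat \<Rightarrow> nexp \<Rightarrow> com" where
  "div_prog x q b =
     (nset q (NConst 0) ;;
      CWhile (BNot (BNatLess (V x) b)) (nset x (NSub (V x) b) ;; nset q (NAdd (V q) (NConst 1))))"

lemma writes_div_prog [simp]: "writes (div_prog x q b) = {x, q}"
  by (auto simp: div_prog_def)

lemma wp_div:
  assumes "x \<notin> mentions b" "q \<notin> mentions b" "x \<noteq> q"
    and b: "neval I s b = k" "0 < k" and c: "nmem s x 0 = c"
  shows "wp I (div_prog x q b) (\<lambda>s'. nmem s' x 0 = c mod k \<and> nmem s' q 0 = c div k) (4 * c + 4) s"
proof -
  define Inv where "Inv i s' \<longleftrightarrow> agree (mentions b) s s' \<and> nmem s' x 0 = c - i * k \<and> i * k \<le> c \<and>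
      nmem s' q 0 = i" for i s'
  have ev: "neval I s' b = k" if "Inv i s'" for i s'
    using that neval_agree b(1) by (auto simp: Inv_def)
  let ?body = "nset x (NSub (V x) b) ;; nset q (NAdd (V q) (NConst 1))"
  have loop: "wp I (CWhile (BNot (BNatLess (V x) b)) ?body)
      (\<lambda>s'. nmem s' x 0 = c mod k \<and> nmem s' q 0 = c div k) (c * Suc (Suc (1 + 1)) + 1) s0"
    if "Inv 0 s0" for s0
  proof (rule wp_while[where Inv = Inv])
    fix i s' assume inv: "Inv i s'" and g: "beval I s' (BNot (BNatLess (V x) b))"
    then have le: "i * k + k \<le> c" using ev[OF inv] by (auto simp: Inv_def)
    have "i * 1 \<le> i * k" using b(2) by (intro mult_left_mono) auto
    then have "i < c" using le b(2) by linarith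
    moreover have "wp I ?body (Inv (Suc i)) (Suc (1 + 1)) s'"
      using inv le ev[OF inv] assms(1-3) by (intro wp_seq wp_nat) (auto simp: Inv_def agree_def)
    ultimately show "i < c \<and> wp I ?body (Inv (Suc i)) (Suc (1 + 1)) s'" by blast
  next
    fix i s' assume inv: "Inv i s'" and "\<not> beval I s' (BNot (BNatLess (V x) b))"
    then have i: "c - i * k < k" "i * k \<le> c" "nmem s' x 0 = c - i * k" "nmem s' q 0 = i"
      using ev[OF inv] by (auto simp: Inv_def)
    then have ce: "c = (c - i * k) + i * k" by simp
    have "c div k = i" "c mod k = c - i * k"
      using i(1) by (subst ce; simp)+
    then show "nmem s' x 0 = c mod k \<and> nmem s' q 0 = c div k" using i by simp
  qed (rule that)
  have "wp I (div_prog x q b) (\<lambda>s'. nmem s' x 0 = c mod k \<and> nmem s' q 0 = c div k)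
      (Suc (1 + (c * Suc (Suc (1 + 1)) + 1))) s"
    unfolding div_prog_def
    by (rule wp_seq, rule wp_nat, rule loop) (use assms in \<open>auto simp: Inv_def agree_def\<close>)
  then show ?thesis by (rule wp_time) simp
qed

lemma wp_halts:
  assumes "wp I P Q T \<lparr>nmem = (\<lambda>_ _. 0), rmem = (\<lambda>_ _. 0)\<rparr>"
  shows "\<exists>t\<le>T. \<exists>s'. run_pmf P I t = return_pmf ([], s') \<and> Q s'"
  using assms bs_run[of I P _ _ _ "[]"] unfolding wp_def run_pmf_def by blast

section \<open>The program\<close>

text \<open>
  Names of natural-number arrays are below \<open>100\<close>, those of real arrays above. Scalars are kept in
  cell \<open>0\<close>. Array \<open>aX\<close> holds, for each \<open>J < 2 ^ L\<close>, the characteristic vector of the elements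
  whose level is in \<open>Suc ` set_decode J\<close>, starting at position \<open>J * n\<close>; \<open>aBIT\<close> tabulates
  \<open>level_bit J l\<close> at position \<open>J * (L + 1) + l\<close>.
\<close>

abbreviation (input) "vN \<equiv> 29 :: nat"
abbreviation (input) "vL \<equiv> 2 :: nat"
abbreviation (input) "vP \<equiv> 3 :: nat"
abbreviation (input) "vB \<equiv> 4 :: nat"
abbreviation (input) "vk \<equiv> 5 :: nat"
abbreviation (input) "vM \<equiv> 6 :: nat"
abbreviation (input) "vR \<equiv> 7 :: nat"
abbreviation (input) "vC \<equiv> 8 :: nat"
abbreviation (input) "aBIT \<equiv> 9 :: nat"
abbreviation (input) "vx \<equiv> 10 :: nat"
abbreviation (input) "vu \<equiv> 11 :: nat"
abbreviation (input) "vp \<equiv> 12 :: nat"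
abbreviation (input) "vc \<equiv> 13 :: nat"
abbreviation (input) "vt \<equiv> 14 :: nat"
abbreviation (input) "vcode \<equiv> 15 :: nat"
abbreviation (input) "aSL \<equiv> 16 :: nat"
abbreviation (input) "vd \<equiv> 17 :: nat"
abbreviation (input) "vi \<equiv> 18 :: nat"
abbreviation (input) "ve \<equiv> 19 :: nat"
abbreviation (input) "vl \<equiv> 20 :: nat"
abbreviation (input) "vold \<equiv> 21 :: nat"
abbreviation (input) "vbe \<equiv> 22 :: nat"
abbreviation (input) "vbl \<equiv> 23 :: nat"
abbreviation (input) "vq \<equiv> 24 :: nat"
abbreviation (input) "aLEV \<equiv> 30 :: nat"
abbreviation (input) "aX \<equiv> 31 :: nat"
abbreviation (input) "vse \<equiv> 32 :: nat"
abbreviation (input) "vsl \<equiv> 33 :: nat"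
abbreviation (input) "vj \<equiv> 34 :: nat"
abbreviation (input) "vxp \<equiv> 35 :: nat"
abbreviation (input) "vbp \<equiv> 36 :: nat"
abbreviation (input) "rA \<equiv> 101 :: nat"
abbreviation (input) "rLIN \<equiv> 102 :: nat"
abbreviation (input) "rG \<equiv> 103 :: nat"
abbreviation (input) "rM \<equiv> 104 :: nat"
abbreviation (input) "rAL \<equiv> 105 :: nat"
abbreviation (input) "rv \<equiv> 110 :: nat"
abbreviation (input) "rtau \<equiv> 111 :: nat"
abbreviation (input) "rK \<equiv> 112 :: nat"
abbreviation (input) "rW \<equiv> 113 :: nat"
abbreviation (input) "rcap \<equiv> 114 :: nat"
abbreviation (input) "reta \<equiv> 115 :: nat"
abbreviation (input) "rth \<equiv> 116 :: nat"
abbreviation (input) "rcur \<equiv> 117 :: nat"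
abbreviation (input) "rls \<equiv> 130 :: nat"
abbreviation (input) "rws \<equiv> 131 :: nat"
abbreviation (input) "rpsi \<equiv> 135 :: nat"
abbreviation (input) "rtw \<equiv> 137 :: nat"

abbreviation inc :: "nat \<Rightarrow> nexp \<Rightarrow> com" where "inc v a \<equiv> nset v (NAdd (V v) a)"

text \<open>Updating the two sums incrementally makes an evaluation of the potential independent of
  \<open>n\<close>, which matters for the exponent of \<open>n\<close> in the running time.\<close>

definition set_level_account :: com where
  "set_level_account =
     (only_if (BNatLess (NConst 0) (NRead aLEV (V vse)))
        (rset rls (RSub (RV rls) (RRead rLIN (V vse))) ;;
         only_if (BNot (BRealLess (RV rtau) (RWeight (V vse)))) (rset rws (RSub (RV rws) (RWeight (V vse))))) ;;
      only_if (BNatLess (NConst 0) (V vsl))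
        (rset rls (RAdd (RV rls) (RRead rLIN (V vse))) ;;
         only_if (BNot (BRealLess (RV rtau) (RWeight (V vse)))) (rset rws (RAdd (RV rws) (RWeight (V vse))))) ;;
      CNatSet aLEV (V vse) (V vsl) ;; nset vxp (V vse) ;; nset vbp (V vsl))"

text \<open>Walks down one column of \<open>aX\<close> and one of \<open>aBIT\<close>. Running
  positions replace the products \<open>J * n\<close> and \<open>J * (L + 1)\<close>.\<close>

definition set_level_loop :: com where
  "set_level_loop =
     for_loop vj (V vP)
       (CNatSet aX (V vxp) (NRead aBIT (V vbp)) ;; inc vxp NSize ;; inc vbp (NAdd (V vL) (NConst 1)))"

definition set_level :: com where
  "set_level = (set_level_account ;; set_level_loop)"

text \<open>The oracle returns the whole objective, so the averaged sum contains only the fraction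
  \<open>beta L\<close> of the modular part; \<open>rG\<close> holds the missing fraction (see
  \<open>Phi_by_values\<close>).\<close>

definition eval_psi :: com where
  "eval_psi =
     (rset rpsi (ROfNat (NConst 0)) ;; nset vxp (NConst 0) ;;
      for_loop vj (V vP)
        (rset rpsi (RAdd (RV rpsi) (RMul (RRead rA (V vj)) (RQuery aX (V vxp)))) ;; inc vxp NSize) ;;
      rset rpsi (RAdd (RV rpsi) (RMul (RV rG) (RV rls))) ;;
      only_if (BRealLess (RV rW) (RV rws))
        (rset rpsi (RSub (RV rpsi) (RMul (RDiv (RV rK) (ROfNat (NConst 2)))
          (RMul (RSub (RV rws) (RV rW)) (RSub (RV rws) (RV rW)))))))"

text \<open>The move is made tentatively and undone if it is refused, since the potential can be
  evaluated only for the stored state.\<close>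

definition try_level :: com where
  "try_level =
     (nset vold (NRead aLEV (V ve)) ;; nset vse (V ve) ;; nset vsl (V vl) ;; set_level ;; eval_psi ;;
      CIf (BAnd (BNot (BRealLess (RV rcap) (RV rws))) (BRealLess (RAdd (RV rcur) (RV reta)) (RV rpsi)))
        (rset rcur (RV rpsi)) (nset vsl (V vold) ;; set_level))"

definition settle_prog :: com where
  "settle_prog =
     (eval_psi ;; rset rcur (RV rpsi) ;;
      for_loop vi (V vR) (for_loop ve NSize
        (only_if (BNot (BRealLess (RV rtau) (RWeight (V ve))))
          (for_loop vl (NAdd (V vL) (NConst 1)) try_level))))"

definition try_choice :: com where
  "try_choice =
     (nset vse (V ve) ;; nset vsl (NAdd (V vl) (NConst 1)) ;; set_level ;; eval_psi ;;
      nset vsl (NConst 0) ;; set_level ;;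
      only_if (BAnd (BNot (BRealLess (RV rpsi) (RAdd (RV rcur) (RV rth))))
          (BNot (BAnd (BNatLess (NConst 0) (V vbl)) (BNot (BRealLess (RWeight (V ve)) (RWeight (V vbe)))))))
        (nset vbe (V ve) ;; nset vbl (NAdd (V vl) (NConst 1))))"

definition scan_prog :: com where
  "scan_prog =
     (nset vbe (NConst 0) ;; nset vbl (NConst 0) ;;
      for_loop ve NSize
        (only_if (BAnd (BRealLess (RV rtau) (RWeight (V ve))) (BNot (BNatLess (NConst 0) (NRead aLEV (V ve)))))
          (for_loop vl (V vL) try_choice)))"

definition exchange_prog :: com where
  "exchange_prog =
     (only_if (BNatLess (NConst 0) (NRead aSL (V vd)))
        (nset vse (NSub (NRead aSL (V vd)) (NConst 1)) ;; nset vsl (NConst 0) ;; set_level) ;;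
      scan_prog ;;
      CIf (BNatLess (NConst 0) (V vbl))
        (nset vse (V vbe) ;; nset vsl (V vbl) ;; set_level ;;
         CNatSet aSL (V vd) (NAdd (V vbe) (NConst 1)))
        (CNatSet aSL (V vd) (NConst 0)))"

text \<open>Wrong guesses can produce infeasible states, so the total weight is computed afresh
  before a state may replace the output. Array \<open>0\<close> initially describes the empty set,
  which is feasible.\<close>

definition record_prog :: com where
  "record_prog =
     (rset rtw (ROfNat (NConst 0)) ;;
      for_loop ve NSize
        (only_if (BNatLess (NConst 0) (NRead aLEV (V ve))) (rset rtw (RAdd (RV rtw) (RWeight (V ve))))) ;;
      only_if (BAnd (BNot (BRealLess (ROfNat (NConst 1)) (RV rtw)))
          (BRealLess (RQuery 0 (NConst 0)) (RQuery aLEV (NConst 0))))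
        (for_loop ve NSize (CNatSet 0 (V ve) (NRead aLEV (V ve)))))"

definition digit_prog :: com where
  "digit_prog = (div_prog vcode vq (V vk) ;; nset vd (V vcode) ;; nset vcode (V vq))"

text \<open>Clearing through \<open>set_level\<close> empties the rows of \<open>aX\<close> as well.
  The running sums are overwritten afterwards, so nothing is assumed about their previous
  contents.\<close>

definition reset_prog :: com where
  "reset_prog =
     (for_loop ve NSize (nset vse (V ve) ;; nset vsl (NConst 0) ;; set_level) ;;
      rset rls (ROfNat (NConst 0)) ;; rset rws (ROfNat (NConst 0)) ;;
      for_loop vi (V vk) (CNatSet aSL (V vi) (NConst 0)) ;;
      nset vcode (V vc))"

definition run_prog :: com where
  "run_prog =
     (reset_prog ;;
      for_loop vt (V vM) (settle_prog ;; record_prog ;; digit_prog ;; exchange_prog))"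

section \<open>Footprints of the programs\<close>

lemma writes_set_level: "writes set_level = {rls, rws, aLEV, vxp, vbp, vj, aX}"
  by (auto simp: set_level_def set_level_account_def set_level_loop_def)

lemma writes_eval_psi: "writes eval_psi = {rpsi, vxp, vj}"
  by (auto simp: eval_psi_def)

lemma writes_try_level:
  "writes try_level = {vold, vse, vsl, rcur, rls, rws, aLEV, vxp, vbp, vj, aX, rpsi}"
  by (auto simp: try_level_def writes_set_level writes_eval_psi)

lemma writes_settle_prog:
  "writes settle_prog = {vi, ve, vl, vold, vse, vsl, rcur, rls, rws, aLEV, vxp, vbp, vj, aX, rpsi}"
  by (auto simp: settle_prog_def writes_try_level writes_eval_psi)

lemma writes_try_choice:
  "writes try_choice = {vbe, vbl, vse, vsl, rls, rws, aLEV, vxp, vbp, vj, aX, rpsi}"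
  by (auto simp: try_choice_def writes_set_level writes_eval_psi)

lemma writes_scan_prog:
  "writes scan_prog = {ve, vl, vbe, vbl, vse, vsl, rls, rws, aLEV, vxp, vbp, vj, aX, rpsi}"
  by (auto simp: scan_prog_def writes_try_choice)

lemma writes_exchange_prog:
  "writes exchange_prog = {aSL, ve, vl, vbe, vbl, vse, vsl, rls, rws, aLEV, vxp, vbp, vj, aX, rpsi}"
  by (auto simp: exchange_prog_def writes_scan_prog writes_set_level)

lemma writes_record_prog: "writes record_prog = {0, rtw, ve}"
  by (auto simp: record_prog_def)

lemma writes_digit_prog: "writes digit_prog = {vcode, vq, vd}"
  by (auto simp: digit_prog_def)

lemma writes_reset_prog:
  "writes reset_prog = {vi, ve, aSL, vcode, vse, vsl, rls, rws, aLEV, vxp, vbp, vj, aX}"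
  by (auto simp: reset_prog_def writes_set_level)

lemma writes_run_prog:
  "writes run_prog = {0, rtw, vcode, vq, vd, vt, vi, aSL, ve, vl, vbe, vbl, vold, vse, vsl, rcur, rls,
     rws, aLEV, vxp, vbp, vj, aX, rpsi}"
  by (auto simp: run_prog_def writes_reset_prog writes_settle_prog writes_record_prog
      writes_digit_prog writes_exchange_prog)

section \<open>Correctness of a single run\<close>

fun level_bit :: "nat \<Rightarrow> nat \<Rightarrow> nat" where
  "level_bit J 0 = 0"
| "level_bit J (Suc j) = of_bool (j \<in> set_decode J)"

lemma set_decode_less:
  assumes "J < 2 ^ L"
  shows "set_decode J \<subseteq> {..<L}"
proof
  fix j assume "j \<in> set_decode J"
  then have "odd (J div 2 ^ j)" by (simp add: set_decode_def)
  then have "2 ^ j \<le> J" by (metis div_less even_zero not_le_imp_less)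
  then have "(2::nat) ^ j < 2 ^ L" using assms by (rule le_less_trans)
  then have "j < L" using power_less_imp_less_exp[of "2::nat" j L] by linarith
  then show "j \<in> {..<L}" by simp
qed

lemma sum_set_decode:
  fixes h :: "nat set \<Rightarrow> real"
  shows "(\<Sum>J<2 ^ L. h (set_decode J)) = (\<Sum>A\<in>Pow {..<L}. h A)"
proof (rule sum.reindex_bij_witness[of _ set_encode set_decode])
  show "set_decode J \<in> Pow {..<L}" if "J \<in> {..<2 ^ L}" for J
    using set_decode_less[of J L] that by simp
next
  fix A assume A: "A \<in> Pow {..<L}"
  then have fin: "finite A" by (auto intro: finite_subset)
  then show "set_decode (set_encode A) = A" by simp
  have "set_encode A \<le> set_encode {..<L}"
    unfolding set_encode_def using fin A by (auto intro: sum_mono2)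
  also have "set_encode {..<L} < 2 ^ L"
    by (simp add: set_encode_def lessThan_atLeast0 sum_power2)
  finally show "set_encode A \<in> {..<2 ^ L}" by simp
qed auto

lemma row_index_eq:
  fixes x y :: nat
  assumes "x < n" "y < n"
  shows "J * n + x = J' * n + y \<longleftrightarrow> J = J' \<and> x = y"
proof
  assume eq: "J * n + x = J' * n + y"
  have "(J * n + x) div n = J" "(J' * n + y) div n = J'" using assms by auto
  then have "J = J'" using eq by metis
  then show "J = J' \<and> x = y" using eq by simp
qed auto

text \<open>Formulated so as to compose: successive runs unite their candidate sets
  (\<open>improves_trans\<close>), and an infeasible candidate imposes no demand.\<close>

definition improves :: "rinstance \<Rightarrow> nat set set \<Rightarrow> nat set \<Rightarrow> nat set \<Rightarrow> bool" where
  "improves I C A A' \<longleftrightarrow> (sum (weight_at I) A \<le> 1 \<longrightarrow> sum (weight_at I) A' \<le> 1) \<and>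
     set_value I A \<le> set_value I A' \<and>
     (\<forall>S\<in>C. sum (weight_at I) S \<le> 1 \<longrightarrow> set_value I S \<le> set_value I A')"

lemma improves_refl: "improves I {} A A"
  by (simp add: improves_def)

lemma improves_trans: "improves I C A A' \<Longrightarrow> improves I C' A' A'' \<Longrightarrow> improves I (C \<union> C') A A''"
  unfolding improves_def by (auto intro: order_trans)

locale ram_search = knapsack_search n g lin L w \<tau> K W cap \<eta> \<theta> R k M
  for n g lin L w \<tau> K W cap \<eta> \<theta> R k M +
  fixes I :: rinstance
  assumes size: "ground_size I = n" and weights: "weight_at I = w"
    and "values": "\<And>S. S \<subseteq> {..<n} \<Longrightarrow> set_value I S = g S + sum lin S"
    and k_pos: "0 < k"
begin

definition params :: "rstate \<Rightarrow> bool" where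
  "params s \<longleftrightarrow> nmem s vL 0 = L \<and> nmem s vP 0 = 2 ^ L \<and> nmem s vk 0 = k \<and> nmem s vM 0 = M \<and>
     nmem s vR 0 = R \<and> (\<forall>J<2 ^ L. \<forall>l\<le>L. nmem s aBIT (J * (L + 1) + l) = level_bit J l) \<and>
     (\<forall>J<2 ^ L. rmem s rA J = alpha L (card (set_decode J))) \<and> (\<forall>e<n. rmem s rLIN e = lin e) \<and>
     rmem s rG 0 = 1 - beta L \<and> rmem s rtau 0 = \<tau> \<and> rmem s rK 0 = K \<and> rmem s rW 0 = W \<and>
     rmem s rcap 0 = cap \<and> rmem s reta 0 = \<eta> \<and> rmem s rth 0 = \<theta>"

abbreviation (input) "param_ids \<equiv>
  {vL, vP, vk, vM, vR, aBIT, rA, rLIN, rG, rtau, rK, rW, rcap, reta, rth}"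

definition holds :: "(nat \<Rightarrow> nat) \<Rightarrow> rstate \<Rightarrow> bool" where
  "holds lev s \<longleftrightarrow> nmem s aLEV = lev \<and> (\<forall>J<2 ^ L. \<forall>x<n. nmem s aX (J * n + x) = level_bit J (lev x)) \<and>
     rmem s rls 0 = sum lin (support lev) \<and> rmem s rws 0 = load lev"

abbreviation (input) "state_ids \<equiv> {aLEV, aX, rls, rws}"

lemma params_agree: "params s \<Longrightarrow> agree A s s' \<Longrightarrow> param_ids \<subseteq> A \<Longrightarrow> params s'"
  by (simp add: params_def agree_def)

lemma holds_agree: "holds lev s \<Longrightarrow> agree A s s' \<Longrightarrow> state_ids \<subseteq> A \<Longrightarrow> holds lev s'"
  by (simp add: holds_def agree_def)

lemma params_store [simp]:
  "v \<notin> param_ids \<Longrightarrow> params (nat_store v i x s) = params s"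
  "v \<notin> param_ids \<Longrightarrow> params (real_store v i y s) = params s"
  by (auto simp: params_def)

lemma holds_store [simp]:
  "v \<notin> state_ids \<Longrightarrow> holds lev (nat_store v i x s) = holds lev s"
  "v \<notin> state_ids \<Longrightarrow> holds lev (real_store v i y s) = holds lev s"
  by (auto simp: holds_def)

lemma wp_set_level_account:
  assumes "params s" "nmem s vse 0 = e" "nmem s vsl 0 = l" "e < n"
  shows "wp I set_level_account (\<lambda>s'. nmem s' aLEV = (nmem s aLEV)(e := l) \<and> nmem s' vxp 0 = e \<and> nmem s' vbp 0 = l \<and>
      rmem s' rls 0 = rmem s rls 0 - (if 0 < nmem s aLEV e then lin e else 0) + (if 0 < l then lin e else 0) \<and>
      rmem s' rws 0 = rmem s rws 0 - (if 0 < nmem s aLEV e \<and> w e \<le> \<tau> then w e else 0)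
        + (if 0 < l \<and> w e \<le> \<tau> then w e else 0)) 30 s"
proof -
  have h: "rmem s rLIN e = lin e" "rmem s rtau 0 = \<tau>" using assms by (simp_all add: params_def)
  show ?thesis
    unfolding set_level_account_def
    by (rule wp_time, (rule wp_seq wp_if wp_nat wp_real wp_skip | (simp add: h assms weights; fail))+)
qed

text \<open>Stated without \<open>holds\<close>, because \<open>reset_prog\<close> calls
  \<open>set_level\<close> when the tables need not represent any assignment.\<close>

lemma wp_set_level_raw:
  assumes p: "params s" and e: "nmem s vse 0 = e" "e < n" and l: "nmem s vsl 0 = l" "l \<le> L"
  shows "wp I set_level (\<lambda>s'. nmem s' aLEV = (nmem s aLEV)(e := l) \<and>
      (\<forall>J<2 ^ L. \<forall>x<n. nmem s' aX (J * n + x) = (if x = e then level_bit J l else nmem s aX (J * n + x))) \<and>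
      rmem s' rls 0 = rmem s rls 0 - (if 0 < nmem s aLEV e then lin e else 0) + (if 0 < l then lin e else 0) \<and>
      rmem s' rws 0 = rmem s rws 0 - (if 0 < nmem s aLEV e \<and> w e \<le> \<tau> then w e else 0)
        + (if 0 < l \<and> w e \<le> \<tau> then w e else 0)) (8 * 2 ^ L + 40) s"
    (is "wp I set_level ?Q _ s")
proof -
  have loop: "wp I set_level_loop ?Q (2 ^ L * (5 + 3) + 3) s1"
    if s1: "agree (- {rls, rws, aLEV, vxp, vbp}) s s1" "nmem s1 aLEV = (nmem s aLEV)(e := l)"
      "nmem s1 vxp 0 = e" "nmem s1 vbp 0 = l"
      "rmem s1 rls 0 = rmem s rls 0 - (if 0 < nmem s aLEV e then lin e else 0) + (if 0 < l then lin e else 0)"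
      "rmem s1 rws 0 = rmem s rws 0 - (if 0 < nmem s aLEV e \<and> w e \<le> \<tau> then w e else 0)
        + (if 0 < l \<and> w e \<le> \<tau> then w e else 0)" for s1
  proof -
    have p1: "params s1" using p s1(1) by (rule params_agree) auto
    have X1: "nmem s1 aX = nmem s aX" using s1(1) by (simp add: agree_def)
    define Inv where "Inv i s' \<longleftrightarrow> agree (- {aX, vxp, vbp, vj}) s1 s' \<and>
      nmem s' vxp 0 = i * n + e \<and> nmem s' vbp 0 = i * (L + 1) + l \<and>
      (\<forall>J<2 ^ L. \<forall>x<n. nmem s' aX (J * n + x) = (if x = e \<and> J < i then level_bit J l else nmem s aX (J * n + x)))"
      for i s'
    have p': "params s'" if "Inv i s'" for i s'
      using p1 that unfolding Inv_def by (elim params_agree conjE) auto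
    have "wp I set_level_loop (Inv (2 ^ L)) (2 ^ L * (5 + 3) + 3) s1"
      unfolding set_level_loop_def
    proof (rule wp_for)
      show "Inv 0 s1" using s1 X1 by (simp add: Inv_def agree_def)
      show "neval I s' (V vP) = 2 ^ L" if "Inv i s'" for i s'
        using p'[OF that] by (simp add: params_def)
      show "Inv i (nat_store vj 0 x s')" if "Inv i s'" for i s' x
        using that by (simp add: Inv_def agree_def)
      fix i s' assume i: "i < 2 ^ L" and inv: "Inv i s'"
      have bit: "nmem s' aBIT (i * (L + 1) + l) = level_bit i l"
        using p'[OF inv] i l unfolding params_def by blast
      have h: "nmem s' vxp 0 = i * n + e" "nmem s' vbp 0 = i * (L + 1) + l" "nmem s' vL 0 = L"
        using inv p'[OF inv] by (simp_all add: Inv_def params_def)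
      have next_inv: "Inv (Suc i) (nat_store vbp 0 (i * (L + 1) + l + (L + 1))
         (nat_store vxp 0 (i * n + e + n) (nat_store aX (i * n + e) (level_bit i l) s')))"
        using inv e(2) by (auto simp: Inv_def agree_def row_index_eq less_Suc_eq)
      show "wp I (CNatSet aX (V vxp) (NRead aBIT (V vbp)) ;; inc vxp NSize ;;
          inc vbp (NAdd (V vL) (NConst 1))) (Inv (Suc i)) 5 s'"
        by (rule wp_time, (rule wp_seq wp_nat)+)
           (use next_inv bit h in \<open>simp_all add: size\<close>)
    qed auto
    then show ?thesis
      by (rule wp_mono) (use s1 in \<open>auto simp: Inv_def agree_def\<close>)
  qed
  have "wp I set_level ?Q (Suc (30 + (2 ^ L * (5 + 3) + 3))) s"
    unfolding set_level_def
    by (rule wp_seq, rule wp_use[OF wp_set_level_account[OF p e(1) l(1) e(2)]])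
       (rule loop, auto simp: agree_def set_level_account_def)
  then show ?thesis by (rule wp_time) simp
qed


lemma set_level_holds:
  assumes lev: "\<forall>x. lev x \<le> L" and e: "e < n" and l: "l \<le> L"
    and h: "holds lev s"
    and s': "nmem s' aLEV = (nmem s aLEV)(e := l) \<and>
      (\<forall>J<2 ^ L. \<forall>x<n. nmem s' aX (J * n + x) = (if x = e then level_bit J l else nmem s aX (J * n + x))) \<and>
      rmem s' rls 0 = rmem s rls 0 - (if 0 < nmem s aLEV e then lin e else 0) + (if 0 < l then lin e else 0) \<and>
      rmem s' rws 0 = rmem s rws 0 - (if 0 < nmem s aLEV e \<and> w e \<le> \<tau> then w e else 0)
        + (if 0 < l \<and> w e \<le> \<tau> then w e else 0)"
  shows "holds (lev(e := l)) s'"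
proof -
  have supp: "support (lev(e := l)) = (if 0 < l then insert e (support lev) else support lev - {e})"
    using e by (auto simp: support_def)
  have e_supp: "e \<in> support lev \<longleftrightarrow> 0 < lev e" using e by (simp add: support_def)
  have "sum lin (support (lev(e := l)))
      = sum lin (support lev) - (if 0 < lev e then lin e else 0) + (if 0 < l then lin e else 0)"
    unfolding supp using e_supp finite_support[of lev] by (auto simp: sum_diff1 insert_absorb)
  moreover have "load (lev(e := l))
      = load lev - (if 0 < lev e \<and> w e \<le> \<tau> then w e else 0) + (if 0 < l \<and> w e \<le> \<tau> then w e else 0)"
  proof -
    have "{x \<in> support (lev(e := l)). w x \<le> \<tau>} = (if 0 < l \<and> w e \<le> \<tau>
        then insert e {x \<in> support lev. w x \<le> \<tau>} else {x \<in> support lev. w x \<le> \<tau>} - {e})"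
      unfolding supp by auto
    then show ?thesis
      unfolding load_def using e_supp finite_support[of lev] by (auto simp: sum_diff1 insert_absorb)
  qed
  ultimately show ?thesis using s' h by (auto simp: holds_def)
qed

lemma wp_set_level:
  assumes "params s" "holds lev s" "\<forall>x. lev x \<le> L" "nmem s vse 0 = e" "e < n" "nmem s vsl 0 = l" "l \<le> L"
  shows "wp I set_level (holds (lev(e := l))) (8 * 2 ^ L + 40) s"
  using wp_set_level_raw[OF assms(1,4-7)] set_level_holds[OF assms(3,5,7,2)] by (rule wp_mono) auto

lemma stored_set_row:
  assumes "holds lev s" "J < 2 ^ L"
  shows "stored_set I s aX (J * n) = at_levels lev (set_decode J)"
proof -
  have "nmem s aX (J * n + x) \<noteq> 0 \<longleftrightarrow> lev x \<in> Suc ` set_decode J" if "x < n" for x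
    using assms that by (cases "lev x") (auto simp: holds_def)
  then show ?thesis by (auto simp: stored_set_def at_levels_def size)
qed

text \<open>Only the sum of curved and modular part can be queried. By
  \<open>alpha_marked_sum\<close> the average contains \<open>beta L\<close> copies of the modular
  part, and adding \<open>1 - beta L\<close> copies completes it.\<close>

lemma Phi_by_values:
  assumes "\<forall>x. lev x \<le> L"
  shows "Phi lev = (\<Sum>J<2 ^ L. alpha L (card (set_decode J)) * set_value I (at_levels lev (set_decode J)))
    + (1 - beta L) * sum lin (support lev)"
proof -
  let ?a = "\<lambda>A. alpha L (card A)"
  have "(\<Sum>A\<in>Pow {..<L}. ?a A * sum lin (at_levels lev A)) = beta L * sum lin (support lev)"
  proof -
    have "sum lin (at_levels lev A) = (\<Sum>x\<in>support lev. if lev x - 1 \<in> A then lin x else 0)"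
      if "A \<in> Pow {..<L}" for A
    proof -
      have "at_levels lev A = {x \<in> support lev. lev x - 1 \<in> A}"
        unfolding at_levels_def support_def by (auto simp: image_iff) (metis One_nat_def Suc_pred)
      then show ?thesis using finite_support by (simp add: sum.inter_filter)
    qed
    then have "(\<Sum>A\<in>Pow {..<L}. ?a A * sum lin (at_levels lev A))
        = (\<Sum>A\<in>Pow {..<L}. \<Sum>x\<in>support lev. if lev x - 1 \<in> A then ?a A * lin x else 0)"
      by (auto simp: sum_distrib_left intro!: sum.cong)
    also have "\<dots> = (\<Sum>x\<in>support lev. \<Sum>A\<in>Pow {..<L}. if lev x - 1 \<in> A then ?a A * lin x else 0)"
      by (rule sum.swap)
    also have "\<dots> = (\<Sum>x\<in>support lev. beta L * lin x)"
    proof (rule sum.cong)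
      fix x assume x: "x \<in> support lev"
      have "lev x - 1 < L" using assms[rule_format, of x] x unfolding support_def by auto
      have "(\<Sum>A\<in>Pow {..<L}. if lev x - 1 \<in> A then ?a A * lin x else 0)
          = (\<Sum>A\<in>{A \<in> Pow {..<L}. lev x - 1 \<in> A}. ?a A * lin x)"
        by (rule sum.inter_filter[symmetric]) auto
      also have "\<dots> = (\<Sum>A\<in>{A \<in> Pow {..<L}. lev x - 1 \<in> A}. ?a A) * lin x"
        by (rule sum_distrib_right[symmetric])
      also have "\<dots> = beta L * lin x" unfolding alpha_marked_sum[OF \<open>lev x - 1 < L\<close>] ..
      finally show "(\<Sum>A\<in>Pow {..<L}. if lev x - 1 \<in> A then ?a A * lin x else 0) = beta L * lin x" .
    qed simp
    finally show ?thesis by (simp add: sum_distrib_left)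
  qed
  moreover have "(\<Sum>J<2 ^ L. alpha L (card (set_decode J)) * set_value I (at_levels lev (set_decode J)))
      = (\<Sum>A\<in>Pow {..<L}. ?a A * (g (at_levels lev A) + sum lin (at_levels lev A)))"
    using sum_set_decode[of "\<lambda>A. ?a A * (g (at_levels lev A) + sum lin (at_levels lev A))" L]
      "values" at_levels_sub by simp
  ultimately show ?thesis
    by (simp add: Phi_def distrib_left sum.distrib left_diff_distrib)
qed

lemma wp_eval_psi:
  assumes p: "params s" and h: "holds lev s" and lev: "\<forall>x. lev x \<le> L"
  shows "wp I eval_psi (\<lambda>s'. rmem s' rpsi 0 = Psi lev) (6 * 2 ^ L + 20) s"
proof -
  define val where "val J = alpha L (card (set_decode J)) * set_value I (at_levels lev (set_decode J))" for J
  define Inv where "Inv i s' \<longleftrightarrow> params s' \<and> holds lev s' \<and> nmem s' vxp 0 = i * n \<and>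
    rmem s' rpsi 0 = (\<Sum>J<i. val J)" for i s'
  have loop: "wp I (for_loop vj (V vP)
        (rset rpsi (RAdd (RV rpsi) (RMul (RRead rA (V vj)) (RQuery aX (V vxp)))) ;; inc vxp NSize))
      (Inv (2 ^ L)) (2 ^ L * (3 + 3) + 3) s0" if "Inv 0 s0" for s0
  proof (rule wp_for)
    show "Inv 0 s0" by (rule that)
    show "neval I s' (V vP) = 2 ^ L" if "Inv i s'" for i s' using that by (simp add: Inv_def params_def)
    show "Inv i (nat_store vj 0 x s')" if "Inv i s'" for i s' x using that by (simp add: Inv_def)
    fix i s' assume i: "i < 2 ^ L" "nmem s' vj 0 = i" and inv: "Inv i s'"
    have f: "rmem s' rA i = alpha L (card (set_decode i))" "nmem s' vxp 0 = i * n"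
      "stored_set I s' aX (i * n) = at_levels lev (set_decode i)" "rmem s' rpsi 0 = (\<Sum>J<i. val J)"
      using inv i stored_set_row[of lev s' i] by (auto simp: Inv_def params_def)
    show "wp I (rset rpsi (RAdd (RV rpsi) (RMul (RRead rA (V vj)) (RQuery aX (V vxp)))) ;; inc vxp NSize)
        (Inv (Suc i)) 3 s'"
      by (rule wp_time, (rule wp_seq wp_nat wp_real)+)
         (use inv i f in \<open>simp_all add: Inv_def size val_def\<close>)
  qed simp
  have psi: "Psi lev = (\<Sum>J<2 ^ L. val J) + (1 - beta L) * sum lin (support lev)
      - K / 2 * (max 0 (load lev - W) * max 0 (load lev - W))"
    by (simp add: Psi_def Phi_by_values[OF lev] val_def penalty_def power2_eq_square)
  have final: "wp I (rset rpsi (RAdd (RV rpsi) (RMul (RV rG) (RV rls))) ;;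
      only_if (BRealLess (RV rW) (RV rws))
        (rset rpsi (RSub (RV rpsi) (RMul (RDiv (RV rK) (ROfNat (NConst 2)))
          (RMul (RSub (RV rws) (RV rW)) (RSub (RV rws) (RV rW)))))))
      (\<lambda>s'. rmem s' rpsi 0 = Psi lev) 5 s0" if inv: "Inv (2 ^ L) s0" for s0
  proof -
    have f: "rmem s0 rG 0 = 1 - beta L" "rmem s0 rls 0 = sum lin (support lev)" "rmem s0 rW 0 = W"
      "rmem s0 rws 0 = load lev" "rmem s0 rK 0 = K" "rmem s0 rpsi 0 = (\<Sum>J<2 ^ L. val J)"
      using inv by (simp_all add: Inv_def params_def holds_def)
    show ?thesis
      by (rule wp_time, (rule wp_seq wp_if wp_nat wp_real wp_skip | (simp add: f psi; fail))+)
  qed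
  have "wp I eval_psi (\<lambda>s'. rmem s' rpsi 0 = Psi lev)
      (Suc (1 + Suc (1 + Suc ((2 ^ L * (3 + 3) + 3) + 5)))) s"
    unfolding eval_psi_def
    by (rule wp_seq wp_real wp_nat)+ (rule wp_mono[OF loop final], simp_all add: Inv_def p h)
  then show ?thesis by (rule wp_time) simp
qed

section \<open>Local search, exchanges and recording on the machine\<close>

abbreviation "psi_time \<equiv> 6 * 2 ^ L + 20 :: nat"
abbreviation "set_time \<equiv> 8 * 2 ^ L + 40 :: nat"

definition bounded :: "(nat \<Rightarrow> nat) \<Rightarrow> bool" where
  "bounded lev \<longleftrightarrow> (\<forall>x. lev x \<le> L) \<and> (\<forall>x\<ge>n. lev x = 0)"

lemma bounded_upd: "bounded lev \<Longrightarrow> e < n \<Longrightarrow> l \<le> L \<Longrightarrow> bounded (lev(e := l))"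
  by (auto simp: bounded_def)

definition ready :: "(nat \<Rightarrow> nat) \<Rightarrow> rstate \<Rightarrow> bool" where
  "ready lev s \<longleftrightarrow> params s \<and> holds lev s \<and> bounded lev"

lemma ready_store [simp]:
  "v \<notin> param_ids \<union> state_ids \<Longrightarrow> ready lev (nat_store v i x s) = ready lev s"
  "v \<notin> param_ids \<union> state_ids \<Longrightarrow> ready lev (real_store v i y s) = ready lev s"
  by (auto simp: ready_def)

lemma wp_set_ready:
  assumes "ready lev s" "nmem s vse 0 = e" "e < n" "nmem s vsl 0 = l" "l \<le> L"
  shows "wp I set_level (ready (lev(e := l))) set_time s"
proof (rule wp_use)
  show "wp I set_level (holds (lev(e := l))) set_time s"
    using assms by (intro wp_set_level) (auto simp: ready_def bounded_def)
  fix s' assume "holds (lev(e := l)) s'" and ag: "agree (- writes set_level) s s'"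
  moreover have "params s'"
    using ag by (rule params_agree[rotated]) (use assms in \<open>auto simp: ready_def writes_set_level\<close>)
  ultimately show "ready (lev(e := l)) s'" using assms bounded_upd by (auto simp: ready_def)
qed

lemma wp_psi_ready:
  assumes "ready lev s"
  shows "wp I eval_psi (\<lambda>s'. ready lev s' \<and> rmem s' rpsi 0 = Psi lev) psi_time s"
proof (rule wp_use)
  show "wp I eval_psi (\<lambda>s'. rmem s' rpsi 0 = Psi lev) psi_time s"
    using assms by (intro wp_eval_psi) (auto simp: ready_def bounded_def)
  fix s' assume "rmem s' rpsi 0 = Psi lev" and ag: "agree (- writes eval_psi) s s'"
  moreover have "params s'" "holds lev s'"
    using ag params_agree[OF _ ag] holds_agree[OF _ ag] assms by (auto simp: ready_def writes_eval_psi)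
  ultimately show "ready lev s' \<and> rmem s' rpsi 0 = Psi lev" using assms by (simp add: ready_def)
qed

lemma wp_try_level:
  assumes r: "ready lev s" and v: "nmem s ve 0 = e" "e < n" "nmem s vl 0 = l" "l \<le> L"
    and cur: "rmem s rcur 0 = Psi lev"
  shows "wp I try_level (\<lambda>s'. ready (improve e lev l) s' \<and> rmem s' rcur 0 = Psi (improve e lev l))
    (2 * set_time + psi_time + 15) s"
proof -
  let ?s = "nat_store vsl 0 l (nat_store vse 0 e (nat_store vold 0 (lev e) s))"
  let ?lev = "lev(e := l)"
  have le: "nmem s aLEV e = lev e" using r by (simp add: ready_def holds_def)
  have levL: "lev e \<le> L" using r by (simp add: ready_def bounded_def)
  let ?if = "CIf (BAnd (BNot (BRealLess (RV rcap) (RV rws))) (BRealLess (RAdd (RV rcur) (RV reta)) (RV rpsi)))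
        (rset rcur (RV rpsi)) (nset vsl (V vold) ;; set_level)"
  let ?Q = "\<lambda>s'. ready (improve e lev l) s' \<and> rmem s' rcur 0 = Psi (improve e lev l)"
  have last: "wp I ?if ?Q (Suc (1 + (Suc (1 + set_time)))) s2"
    if r2: "ready ?lev s2" and psi: "rmem s2 rpsi 0 = Psi ?lev" and cur2: "rmem s2 rcur 0 = Psi lev"
      and e2: "nmem s2 vse 0 = e" and old2: "nmem s2 vold 0 = lev e" for s2
  proof (rule wp_if)
    have f: "rmem s2 rcap 0 = cap" "rmem s2 rws 0 = load ?lev" "rmem s2 reta 0 = \<eta>"
      using r2 by (simp_all add: ready_def params_def holds_def)
    {
      assume "beval I s2 (BAnd (BNot (BRealLess (RV rcap) (RV rws))) (BRealLess (RAdd (RV rcur) (RV reta)) (RV rpsi)))"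
      then have "improve e lev l = ?lev" using f psi cur2 by (simp add: improve_def)
      then show "wp I (rset rcur (RV rpsi)) ?Q 1 s2"
        using r2 psi by (intro wp_real) simp
    next
      assume "\<not> beval I s2 (BAnd (BNot (BRealLess (RV rcap) (RV rws))) (BRealLess (RAdd (RV rcur) (RV reta)) (RV rpsi)))"
      then have same: "improve e lev l = lev" using f psi cur2 by (auto simp: improve_def)
      have undo: "?lev(e := lev e) = lev" by simp
      show "wp I (nset vsl (V vold) ;; set_level) ?Q (Suc (1 + set_time)) s2"
        unfolding same
      proof (intro wp_seq wp_nat wp_use[OF wp_set_ready[of ?lev _ e "lev e"]])
        fix s' assume "ready (?lev(e := lev e)) s'"
          "agree (- writes set_level) (nat_store vsl (neval I s2 (NConst 0)) (neval I s2 (V vold)) s2) s'"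
        then show "ready lev s' \<and> rmem s' rcur 0 = Psi lev"
          using cur2 unfolding undo by (simp add: agree_def writes_set_level)
      qed (use r2 e2 old2 v levL in auto)
    }
  qed
  have mid: "wp I (eval_psi ;; ?if) ?Q (Suc (psi_time + (Suc (1 + (Suc (1 + set_time)))))) s1"
    if "ready ?lev s1" "agree (- writes set_level) ?s s1" for s1
  proof (rule wp_call[OF wp_psi_ready[OF that(1)]])
    fix s2 assume "ready ?lev s2 \<and> rmem s2 rpsi 0 = Psi ?lev" "agree (- writes eval_psi) s1 s2"
    then show "wp I ?if ?Q (Suc (1 + (Suc (1 + set_time)))) s2"
      using that cur by (intro last) (simp_all add: agree_def writes_set_level writes_eval_psi)
  qed
  have one: "wp I (set_level ;; eval_psi ;; ?if) ?Q
      (Suc (set_time + Suc (psi_time + (Suc (1 + (Suc (1 + set_time))))))) ?s"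
    by (rule wp_call[OF wp_set_ready[of lev _ e l] mid]) (use r v in simp_all)
  have "wp I try_level ?Q
     (Suc (1 + Suc (1 + Suc (1 + Suc (set_time + Suc (psi_time + (Suc (1 + (Suc (1 + set_time)))))))))) s"
    unfolding try_level_def by ((rule wp_seq, rule wp_nat)+) (use one v le in simp)
  then show ?thesis by (rule wp_time) simp
qed

lemma wp_settle:
  assumes r: "ready lev s"
  shows "wp I settle_prog (\<lambda>s'. ready (settle lev) s' \<and> rmem s' rcur 0 = Psi (settle lev))
    (psi_time + R * (n * ((L + 1) * (2 * set_time + psi_time + 18) + 10) + 6) + 10) s"
proof -
  let ?try = "for_loop vl (NAdd (V vL) (NConst 1)) try_level"
  let ?visit = "only_if (BNot (BRealLess (RV rtau) (RWeight (V ve)))) ?try"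
  let ?sweep = "for_loop ve NSize ?visit"
  define reach where "reach lev s \<longleftrightarrow> ready lev s \<and> rmem s rcur 0 = Psi lev" for lev and s :: rstate
  have reach_store: "reach lev (nat_store v i x s) = reach lev s" if "v \<notin> param_ids \<union> state_ids" for lev v i x s
    using that by (simp add: reach_def)
  have L: "nmem s' vL 0 = L" "nmem s' vR 0 = R" "rmem s' rtau 0 = \<tau>" if "reach lev' s'" for lev' s'
    using that by (simp_all add: reach_def ready_def params_def)
  let ?T1 = "(L + 1) * ((2 * set_time + psi_time + 15) + 3) + 3"
  have levels: "wp I ?try (reach (foldl (improve e) lev1 [0..<Suc L])) ?T1 s1"
    if s1: "reach lev1 s1" "nmem s1 ve 0 = e" "e < n" for lev1 s1 e
  proof -
    let ?Inv = "\<lambda>i s'. reach (foldl (improve e) lev1 [0..<i]) s' \<and> nmem s' ve 0 = e"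
    have "wp I ?try (?Inv (L + 1)) ?T1 s1"
    proof (rule wp_for[where Inv = ?Inv])
      fix i s' assume i: "i < L + 1" "nmem s' vl 0 = i" and inv: "?Inv i s'"
      show "wp I try_level (?Inv (Suc i)) (2 * set_time + psi_time + 15) s'"
        by (rule wp_use[OF wp_try_level[of "foldl (improve e) lev1 [0..<i]" s' e i]])
           (use inv i s1 in \<open>auto simp: reach_def agree_def writes_try_level\<close>)
    qed (use s1 L in \<open>auto simp: reach_store writes_try_level\<close>)
    then show ?thesis by (rule wp_mono) (simp_all del: upt_Suc)
  qed
  let ?T2 = "n * ((?T1 + 3) + 3) + 3"
  have sweeps: "wp I ?sweep (reach (sweep lev1)) ?T2 s1" if s1: "reach lev1 s1" for lev1 s1
  proof -
    have "wp I ?sweep (reach (foldl sweep_at lev1 [0..<n])) ?T2 s1"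
    proof (rule wp_for[where Inv = "\<lambda>i. reach (foldl sweep_at lev1 [0..<i])"])
      fix i s' assume i: "i < n" "nmem s' ve 0 = i" and inv: "reach (foldl sweep_at lev1 [0..<i]) s'"
      have "wp I ?visit (reach (sweep_at (foldl sweep_at lev1 [0..<i]) i)) (Suc (?T1 + 1)) s'"
      proof (rule wp_if)
        assume "beval I s' (BNot (BRealLess (RV rtau) (RWeight (V ve))))"
        then have "w i \<le> \<tau>" using L(3)[OF inv] i by (simp add: weights)
        then show "wp I ?try (reach (sweep_at (foldl sweep_at lev1 [0..<i]) i)) ?T1 s'"
          using levels[OF inv i(2,1)] by (simp add: sweep_at_def del: upt_Suc)
      next
        assume "\<not> beval I s' (BNot (BRealLess (RV rtau) (RWeight (V ve))))"
        then have "\<not> w i \<le> \<tau>" using L(3)[OF inv] i by (simp add: weights)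
        then have "sweep_at (foldl sweep_at lev1 [0..<i]) i = foldl sweep_at lev1 [0..<i]"
          unfolding sweep_at_def by (rule if_not_P)
        then show "wp I CSkip (reach (sweep_at (foldl sweep_at lev1 [0..<i]) i)) 1 s'"
          using inv by (intro wp_skip) simp
      qed
      then show "wp I ?visit (reach (foldl sweep_at lev1 [0..<Suc i])) (?T1 + 3) s'"
        by (rule wp_mono) simp_all
    qed (use s1 in \<open>auto simp: reach_store writes_try_level size\<close>)
    then show ?thesis by (simp add: sweep_def)
  qed
  have loop: "wp I (for_loop vi (V vR) ?sweep) (reach ((sweep ^^ R) lev)) (R * (?T2 + 3) + 3) s1" if "reach lev s1" for s1
    by (rule wp_for[where Inv = "\<lambda>i. reach ((sweep ^^ i) lev)"])
       (use that L sweeps in \<open>auto simp: reach_store writes_try_level\<close>)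
  have "wp I settle_prog (reach (settle lev)) (Suc (psi_time + Suc (1 + (R * (?T2 + 3) + 3)))) s"
    unfolding settle_prog_def settle_def
    by (rule wp_call[OF wp_psi_ready[OF r]], rule wp_seq, rule wp_real, rule loop)
       (simp add: reach_def)
  then show ?thesis by (rule wp_mono) (simp_all add: reach_def algebra_simps)
qed

lemma wp_try_choice:
  assumes r: "ready lev s" and v: "nmem s ve 0 = e" "e < n" "lev e = 0" "nmem s vl 0 = l" "l < L"
    and b: "nmem s vbe 0 = fst b" "nmem s vbl 0 = snd b" and cur: "rmem s rcur 0 = cur"
  shows "wp I try_choice (\<lambda>s'. ready lev s' \<and> nmem s' vbe 0 = fst (better lev cur e b l) \<and>
      nmem s' vbl 0 = snd (better lev cur e b l)) (2 * set_time + psi_time + 15) s"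
proof -
  let ?lev = "lev(e := Suc l)" and ?b = "better lev cur e b l"
  let ?Q = "\<lambda>s'. ready lev s' \<and> nmem s' vbe 0 = fst ?b \<and> nmem s' vbl 0 = snd ?b"
  let ?if = "only_if (BAnd (BNot (BRealLess (RV rpsi) (RAdd (RV rcur) (RV rth))))
          (BNot (BAnd (BNatLess (NConst 0) (V vbl)) (BNot (BRealLess (RWeight (V ve)) (RWeight (V vbe)))))))
        (nset vbe (V ve) ;; nset vbl (NAdd (V vl) (NConst 1)))"
  define keep where "keep s' \<longleftrightarrow> nmem s' ve 0 = e \<and> nmem s' vl 0 = l \<and> nmem s' vbe 0 = fst b \<and>
      nmem s' vbl 0 = snd b \<and> rmem s' rcur 0 = cur" for s' :: rstate
  have last: "wp I ?if ?Q 5 s3" if r3: "ready lev s3" and k3: "keep s3" and psi: "rmem s3 rpsi 0 = Psi ?lev" for s3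
  proof -
    have f: "rmem s3 rth 0 = \<theta>" using r3 by (simp add: ready_def params_def)
    let ?c = "cur + \<theta> \<le> Psi ?lev \<and> (snd b = 0 \<or> w e < w (fst b))"
    have c: "beval I s3 (BAnd (BNot (BRealLess (RV rpsi) (RAdd (RV rcur) (RV rth))))
          (BNot (BAnd (BNatLess (NConst 0) (V vbl)) (BNot (BRealLess (RWeight (V ve)) (RWeight (V vbe))))))) \<longleftrightarrow> ?c"
      using f psi k3 by (auto simp: keep_def weights)
    have "wp I ?if ?Q (Suc (Suc (1 + 1) + 1)) s3"
    proof (rule wp_if, unfold c)
      assume ?c
      then have "?b = (e, Suc l)" by (simp add: better_def)
      then show "wp I (nset vbe (V ve) ;; nset vbl (NAdd (V vl) (NConst 1))) ?Q (Suc (1 + 1)) s3"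
        using r3 k3 by (intro wp_seq wp_nat) (simp add: keep_def)
    next
      assume "\<not> ?c"
      then have "?b = b" unfolding better_def by (rule if_not_P)
      then show "wp I CSkip ?Q 1 s3" using r3 k3 by (intro wp_skip) (simp add: keep_def)
    qed
    then show ?thesis by (rule wp_time) simp
  qed
  have three: "wp I (nset vsl (NConst 0) ;; set_level ;; ?if) ?Q (Suc (1 + Suc (set_time + 5))) s2"
    if s2: "ready ?lev s2" "keep s2" "rmem s2 rpsi 0 = Psi ?lev" "nmem s2 vse 0 = e" for s2
  proof (rule wp_seq, rule wp_nat, rule wp_call[OF wp_set_ready[of ?lev _ e 0]])
    fix s' assume r': "ready (?lev(e := 0)) s'"
      and ag: "agree (- writes set_level) (nat_store vsl (neval I s2 (NConst 0)) (neval I s2 (NConst 0)) s2) s'"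
    have "?lev(e := 0) = lev" using v(3) by auto
    then have "ready lev s'" using r' by simp
    moreover have "keep s'" "rmem s' rpsi 0 = Psi ?lev"
      using ag s2 by (simp_all add: keep_def agree_def writes_set_level)
    ultimately show "wp I ?if ?Q 5 s'" by (rule last)
  qed (use s2 v in auto)
  have two: "wp I (eval_psi ;; nset vsl (NConst 0) ;; set_level ;; ?if) ?Q
      (Suc (psi_time + Suc (1 + Suc (set_time + 5)))) s1"
    if s1: "ready ?lev s1" "keep s1" "nmem s1 vse 0 = e" for s1
    by (rule wp_call[OF wp_psi_ready[OF s1(1)] three])
       (use s1 in \<open>simp_all add: keep_def agree_def writes_eval_psi\<close>)
  have one: "wp I (set_level ;; eval_psi ;; nset vsl (NConst 0) ;; set_level ;; ?if) ?Q
      (Suc (set_time + Suc (psi_time + Suc (1 + Suc (set_time + 5))))) (nat_store vsl 0 (Suc l) (nat_store vse 0 e s))"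
    by (rule wp_call[OF wp_set_ready[of lev _ e "Suc l"] two])
       (use r v b cur in \<open>simp_all add: keep_def agree_def writes_set_level\<close>)
  have "wp I try_choice ?Q
      (Suc (1 + Suc (1 + (Suc (set_time + Suc (psi_time + Suc (1 + Suc (set_time + 5)))))))) s"
    unfolding try_choice_def by ((rule wp_seq, rule wp_nat)+) (use one v in simp)
  then show ?thesis by (rule wp_time) simp
qed

lemma wp_scan:
  assumes r: "ready lev s" and cur: "rmem s rcur 0 = cur"
  shows "wp I scan_prog (\<lambda>s'. ready lev s' \<and> nmem s' vbe 0 = fst (scan lev cur) \<and>
      nmem s' vbl 0 = snd (scan lev cur)) (n * (L * (2 * set_time + psi_time + 18) + 10) + 10) s"
proof -
  let ?try = "for_loop vl (V vL) try_choice"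
  let ?visit = "only_if (BAnd (BRealLess (RV rtau) (RWeight (V ve))) (BNot (BNatLess (NConst 0) (NRead aLEV (V ve))))) ?try"
  define reach where "reach b s \<longleftrightarrow> ready lev s \<and> rmem s rcur 0 = cur \<and> nmem s vbe 0 = fst b \<and>
      nmem s vbl 0 = snd b" for b :: "nat \<times> nat" and s :: rstate
  have reach_store: "reach b (nat_store v i x s) = reach b s"
    if "v \<notin> param_ids \<union> state_ids" "v \<noteq> vbe" "v \<noteq> vbl" for b v i x s
    using that by (simp add: reach_def)
  have f: "nmem s' vL 0 = L" "rmem s' rtau 0 = \<tau>" "nmem s' aLEV = lev" if "reach b s'" for b s'
    using that by (simp_all add: reach_def ready_def params_def holds_def)
  let ?T1 = "L * ((2 * set_time + psi_time + 15) + 3) + 3"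
  have levels: "wp I ?try (reach (foldl (better lev cur e) b [0..<L])) ?T1 s1"
    if s1: "reach b s1" "nmem s1 ve 0 = e" "e < n" "lev e = 0" for b s1 e
  proof -
    let ?Inv = "\<lambda>i s'. reach (foldl (better lev cur e) b [0..<i]) s' \<and> nmem s' ve 0 = e"
    have "wp I ?try (?Inv L) ?T1 s1"
    proof (rule wp_for[where Inv = ?Inv])
      fix i s' assume i: "i < L" "nmem s' vl 0 = i" and inv: "?Inv i s'"
      show "wp I try_choice (?Inv (Suc i)) (2 * set_time + psi_time + 15) s'"
        by (rule wp_use[OF wp_try_choice[of lev s' e i "foldl (better lev cur e) b [0..<i]" cur]])
           (use inv i s1 in \<open>auto simp: reach_def agree_def writes_try_choice\<close>)
    next
      fix i s' assume "?Inv i s'"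
      then have "reach (foldl (better lev cur e) b [0..<i]) s'" by simp
      from f(1)[OF this] show "neval I s' (V vL) = L" by simp
    qed (use s1 in \<open>auto simp: reach_store writes_try_choice\<close>)
    then show ?thesis by (rule wp_mono) simp_all
  qed
  let ?T2 = "n * ((?T1 + 3) + 3) + 3"
  have outer: "wp I (for_loop ve NSize ?visit) (reach (scan lev cur)) ?T2 s1" if s1: "reach (0, 0) s1" for s1
  proof -
    have "wp I (for_loop ve NSize ?visit) (reach (foldl (scan_at lev cur) (0, 0) [0..<n])) ?T2 s1"
    proof (rule wp_for[where Inv = "\<lambda>i. reach (foldl (scan_at lev cur) (0, 0) [0..<i])"])
      fix i s' assume i: "i < n" "nmem s' ve 0 = i" and inv: "reach (foldl (scan_at lev cur) (0, 0) [0..<i]) s'"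
      let ?b = "foldl (scan_at lev cur) (0, 0) [0..<i]"
      have "wp I ?visit (reach (scan_at lev cur ?b i)) (Suc (?T1 + 1)) s'"
      proof (rule wp_if)
        assume "beval I s' (BAnd (BRealLess (RV rtau) (RWeight (V ve))) (BNot (BNatLess (NConst 0) (NRead aLEV (V ve)))))"
        then have c: "\<tau> < w i \<and> lev i = 0" using f[OF inv] i by (simp add: weights)
        then show "wp I ?try (reach (scan_at lev cur ?b i)) ?T1 s'"
          using levels[OF inv i(2,1)] by (simp add: scan_at_def)
      next
        assume "\<not> beval I s' (BAnd (BRealLess (RV rtau) (RWeight (V ve))) (BNot (BNatLess (NConst 0) (NRead aLEV (V ve)))))"
        then have "\<not> (\<tau> < w i \<and> lev i = 0)" using f[OF inv] i by (simp add: weights)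
        then have "scan_at lev cur ?b i = ?b" unfolding scan_at_def by (rule if_not_P)
        then show "wp I CSkip (reach (scan_at lev cur ?b i)) 1 s'" using inv by (intro wp_skip) simp
      qed
      then show "wp I ?visit (reach (foldl (scan_at lev cur) (0, 0) [0..<Suc i])) (?T1 + 3) s'"
        by (rule wp_mono) simp_all
    qed (use s1 in \<open>auto simp: reach_store writes_try_choice size\<close>)
    then show ?thesis by (simp add: scan_def)
  qed
  have "wp I scan_prog (reach (scan lev cur)) (Suc (1 + Suc (1 + ?T2))) s"
    unfolding scan_prog_def
    by ((rule wp_seq, rule wp_nat)+, rule outer) (use r cur in \<open>simp add: reach_def\<close>)
  then show ?thesis by (rule wp_mono) (simp_all add: reach_def algebra_simps)
qed


lemma ready_agree: "ready lev s \<Longrightarrow> agree A s s' \<Longrightarrow> param_ids \<union> state_ids \<subseteq> A \<Longrightarrow> ready lev s'"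
  unfolding ready_def using params_agree[of s A s'] holds_agree[of lev s A s'] by auto

abbreviation "settle_time \<equiv> psi_time + R * (n * ((L + 1) * (2 * set_time + psi_time + 18) + 10) + 6) + 10"
abbreviation "scan_time \<equiv> n * (L * (2 * set_time + psi_time + 18) + 10) + 10"

lemma wp_exchange:
  assumes r: "ready lev s" and sl: "nmem s aSL = sl" "nmem s vd 0 = d" "sl d \<le> n"
    and cur: "rmem s rcur 0 = Psi lev"
  shows "wp I exchange_prog (\<lambda>s'. ready (fst (exchange d lev sl)) s' \<and> nmem s' aSL = snd (exchange d lev sl))
    (2 * set_time + scan_time + 20) s"
proof -
  let ?lev = "vacate d lev sl"
  define b where "b = scan ?lev (Psi lev)"
  let ?Q = "\<lambda>s'. ready (fst (exchange d lev sl)) s' \<and> nmem s' aSL = snd (exchange d lev sl)"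
  let ?if = "CIf (BNatLess (NConst 0) (V vbl))
        (nset vse (V vbe) ;; nset vsl (V vbl) ;; set_level ;; CNatSet aSL (V vd) (NAdd (V vbe) (NConst 1)))
        (CNatSet aSL (V vd) (NConst 0))"
  have ex: "exchange d lev sl
      = (if 0 < snd b then (?lev(fst b := snd b), sl(d := Suc (fst b))) else (?lev, sl(d := 0)))"
    by (simp add: exchange_def b_def Let_def)
  have b: "0 < snd b \<Longrightarrow> fst b < n \<and> snd b \<le> L"
    using scan_lightest[of ?lev "Psi lev"] unfolding b_def lightest_in_def choices_def by auto
  have last: "wp I ?if ?Q (Suc (Suc (1 + Suc (1 + Suc (set_time + 1))) + 1)) s2"
    if s2: "ready ?lev s2" "nmem s2 aSL = sl" "nmem s2 vd 0 = d" "nmem s2 vbe 0 = fst b" "nmem s2 vbl 0 = snd b" for s2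
  proof (rule wp_if)
    assume "beval I s2 (BNatLess (NConst 0) (V vbl))"
    then have pos: "0 < snd b" using s2 by simp
    let ?s = "nat_store vsl 0 (snd b) (nat_store vse 0 (fst b) s2)"
    have fin: "wp I (CNatSet aSL (V vd) (NAdd (V vbe) (NConst 1))) ?Q 1 s3"
      if s3: "ready (?lev(fst b := snd b)) s3" "agree (- writes set_level) ?s s3" for s3
    proof (rule wp_nat)
      have "nmem s3 aSL = sl" "nmem s3 vd 0 = d" "nmem s3 vbe 0 = fst b"
        using s3(2) s2 by (simp_all add: agree_def writes_set_level)
      then show "?Q (nat_store aSL (neval I s3 (V vd)) (neval I s3 (NAdd (V vbe) (NConst 1))) s3)"
        using s3(1) pos by (simp add: ex)
    qed
    have "wp I (set_level ;; CNatSet aSL (V vd) (NAdd (V vbe) (NConst 1))) ?Q (Suc (set_time + 1)) ?s"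
      by (rule wp_call[OF wp_set_ready[of ?lev _ "fst b" "snd b"] fin]) (use s2 b pos in auto)
    then show "wp I (nset vse (V vbe) ;; nset vsl (V vbl) ;; set_level ;; CNatSet aSL (V vd) (NAdd (V vbe) (NConst 1)))
        ?Q (Suc (1 + Suc (1 + Suc (set_time + 1)))) s2"
      using s2 by - ((rule wp_seq, rule wp_nat)+, simp)
  next
    assume "\<not> beval I s2 (BNatLess (NConst 0) (V vbl))"
    then have "snd b = 0" using s2 by simp
    then show "wp I (CNatSet aSL (V vd) (NConst 0)) ?Q 1 s2"
      using s2 by (intro wp_nat) (simp add: ex)
  qed
  have mid: "wp I (scan_prog ;; ?if) ?Q (Suc (scan_time + Suc (Suc (1 + Suc (1 + Suc (set_time + 1))) + 1))) s1"
    if s1: "ready ?lev s1" "nmem s1 aSL = sl" "nmem s1 vd 0 = d" "rmem s1 rcur 0 = Psi lev" for s1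
    by (rule wp_call[OF wp_scan[OF s1(1,4)] last])
       (use s1 in \<open>auto simp: b_def agree_def writes_scan_prog\<close>)
  have "wp I (only_if (BNatLess (NConst 0) (NRead aSL (V vd)))
        (nset vse (NSub (NRead aSL (V vd)) (NConst 1)) ;; nset vsl (NConst 0) ;; set_level))
      (wp I (scan_prog ;; ?if) ?Q (Suc (scan_time + Suc (Suc (1 + Suc (1 + Suc (set_time + 1))) + 1))))
      (Suc (Suc (1 + Suc (1 + set_time)) + 1)) s"
  proof (rule wp_if)
    assume "beval I s (BNatLess (NConst 0) (NRead aSL (V vd)))"
    then have pos: "0 < sl d" using sl by simp
    let ?s = "nat_store vsl 0 0 (nat_store vse 0 (sl d - 1) s)"
    have "wp I set_level (wp I (scan_prog ;; ?if) ?Q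
        (Suc (scan_time + Suc (Suc (1 + Suc (1 + Suc (set_time + 1))) + 1)))) set_time ?s"
    proof (rule wp_use[OF wp_set_ready[of lev _ "sl d - 1" 0]])
      fix s' assume s': "ready (lev(sl d - 1 := 0)) s'" "agree (- writes set_level) ?s s'"
      show "wp I (scan_prog ;; ?if) ?Q (Suc (scan_time + Suc (Suc (1 + Suc (1 + Suc (set_time + 1))) + 1))) s'"
        by (rule mid) (use s' pos sl cur in \<open>simp_all add: vacate_def agree_def writes_set_level\<close>)
    qed (use r sl pos in auto)
    then show "wp I (nset vse (NSub (NRead aSL (V vd)) (NConst 1)) ;; nset vsl (NConst 0) ;; set_level)
      (wp I (scan_prog ;; ?if) ?Q (Suc (scan_time + Suc (Suc (1 + Suc (1 + Suc (set_time + 1))) + 1))))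
      (Suc (1 + Suc (1 + set_time))) s"
      using sl by - ((rule wp_seq, rule wp_nat)+, simp)
  next
    assume "\<not> beval I s (BNatLess (NConst 0) (NRead aSL (V vd)))"
    then have "?lev = lev" using sl by (simp add: vacate_def)
    then show "wp I CSkip (wp I (scan_prog ;; ?if) ?Q
        (Suc (scan_time + Suc (Suc (1 + Suc (1 + Suc (set_time + 1))) + 1)))) 1 s"
      using mid r sl cur by (intro wp_skip) auto
  qed
  from wp_seq[OF this] show ?thesis unfolding exchange_prog_def by (rule wp_time) simp
qed

lemma stored_support: "holds lev s \<Longrightarrow> stored_set I s aLEV 0 = support lev"
  by (auto simp: holds_def stored_set_def support_def size)

lemma wp_record:
  assumes r: "ready lev s"
  shows "wp I record_prog (\<lambda>s'. stored_set I s' 0 0 =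
      (if sum w (support lev) \<le> 1 \<and> set_value I (stored_set I s 0 0) < set_value I (support lev)
       then support lev else stored_set I s 0 0)) (14 * n + 20) s"
proof -
  let ?O = "stored_set I s 0 0"
  let ?add = "only_if (BNatLess (NConst 0) (NRead aLEV (V ve))) (rset rtw (RAdd (RV rtw) (RWeight (V ve))))"
  define Inv where "Inv i s' \<longleftrightarrow> ready lev s' \<and> nmem s' 0 = nmem s 0 \<and>
      rmem s' rtw 0 = (\<Sum>x<i. if 0 < lev x then w x else 0)" for i s'
  have lev: "nmem s' aLEV = lev" if "ready lev s'" for s' using that by (simp add: ready_def holds_def)
  have sumw: "sum w (support lev) = (\<Sum>x<n. if 0 < lev x then w x else 0)"
    by (simp add: support_def sum.inter_filter[symmetric])
  have first: "wp I (for_loop ve NSize ?add) (Inv n) (n * (3 + 3) + 3) s0" if "Inv 0 s0" for s0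
  proof (rule wp_for[where Inv = Inv])
    fix i s' assume i: "i < n" "nmem s' ve 0 = i" and inv: "Inv i s'"
    have f: "nmem s' aLEV = lev" using inv lev by (simp add: Inv_def)
    have "wp I ?add (Inv (Suc i)) (Suc (1 + 1)) s'"
    proof (rule wp_if)
      assume "beval I s' (BNatLess (NConst 0) (NRead aLEV (V ve)))"
      then have "0 < lev i" using f i by simp
      then show "wp I (rset rtw (RAdd (RV rtw) (RWeight (V ve)))) (Inv (Suc i)) 1 s'"
        using inv i by (intro wp_real) (simp add: Inv_def weights)
    next
      assume "\<not> beval I s' (BNatLess (NConst 0) (NRead aLEV (V ve)))"
      then have "\<not> 0 < lev i" using f i by simp
      then show "wp I CSkip (Inv (Suc i)) 1 s'" using inv by (intro wp_skip) (simp add: Inv_def)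
    qed
    then show "wp I ?add (Inv (Suc i)) 3 s'" by (rule wp_time) simp
  qed (use that in \<open>auto simp: Inv_def size\<close>)
  let ?copy = "for_loop ve NSize (CNatSet 0 (V ve) (NRead aLEV (V ve)))"
  let ?test = "BAnd (BNot (BRealLess (ROfNat (NConst 1)) (RV rtw)))
          (BRealLess (RQuery 0 (NConst 0)) (RQuery aLEV (NConst 0)))"
  let ?c = "sum w (support lev) \<le> 1 \<and> set_value I ?O < set_value I (support lev)"
  let ?Q = "\<lambda>s'. stored_set I s' 0 0 = (if ?c then support lev else ?O)"
  have second: "wp I (only_if ?test ?copy) ?Q (Suc ((n * (1 + 3) + 3) + 1)) s1" if inv: "Inv n s1" for s1
  proof (rule wp_if)
    have O: "stored_set I s1 0 0 = ?O" using inv by (simp add: Inv_def stored_set_def)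
    have S: "stored_set I s1 aLEV 0 = support lev" using inv stored_support by (simp add: Inv_def ready_def)
    have c: "beval I s1 ?test \<longleftrightarrow> ?c" using inv O S sumw by (auto simp: Inv_def)
    {
      assume "beval I s1 ?test"
      then have ?c using c by simp
      define Jnv where "Jnv i s' \<longleftrightarrow> ready lev s' \<and> (\<forall>x<i. nmem s' 0 x = lev x)" for i s'
      have "wp I ?copy (Jnv n) (n * (1 + 3) + 3) s1"
      proof (rule wp_for[where Inv = Jnv])
        fix i s' assume i: "i < n" "nmem s' ve 0 = i" and j: "Jnv i s'"
        then show "wp I (CNatSet 0 (V ve) (NRead aLEV (V ve))) (Jnv (Suc i)) 1 s'"
          using lev[of s'] by (intro wp_nat) (auto simp: Jnv_def less_Suc_eq)
      qed (use inv in \<open>auto simp: Jnv_def Inv_def size\<close>)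
      then show "wp I ?copy ?Q (n * (1 + 3) + 3) s1"
      proof (rule wp_mono)
        fix s' assume "Jnv n s'"
        then have "stored_set I s' 0 0 = support lev"
          by (auto simp: Jnv_def stored_set_def support_def size)
        then show "?Q s'" using \<open>?c\<close> by simp
      qed simp
    next
      assume "\<not> beval I s1 ?test"
      then have "\<not> ?c" using c by blast
      then show "wp I CSkip ?Q 1 s1" using O by (intro wp_skip) (simp only: if_False)
    }
  qed
  have "wp I record_prog ?Q (Suc (1 + Suc ((n * (3 + 3) + 3) + Suc ((n * (1 + 3) + 3) + 1)))) s"
    unfolding record_prog_def
    by (rule wp_seq, rule wp_real, rule wp_seq, rule wp_mono[OF first second])
       (use r in \<open>simp_all add: Inv_def\<close>)
  then show ?thesis by (rule wp_time) simp
qed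

lemma wp_digit:
  assumes k: "nmem s vk 0 = k" and c: "nmem s vcode 0 = c"
  shows "wp I digit_prog (\<lambda>s'. nmem s' vd 0 = c mod k \<and> nmem s' vcode 0 = c div k) (4 * c + 10) s"
proof -
  have tail: "wp I (nset vd (V vcode) ;; nset vcode (V vq))
      (\<lambda>s'. nmem s' vd 0 = c mod k \<and> nmem s' vcode 0 = c div k) (Suc (1 + 1)) s1"
    if "nmem s1 vcode 0 = c mod k \<and> nmem s1 vq 0 = c div k" for s1
    by (intro wp_seq wp_nat) (use that in simp)
  have "wp I digit_prog (\<lambda>s'. nmem s' vd 0 = c mod k \<and> nmem s' vcode 0 = c div k)
      (Suc ((4 * c + 4) + Suc (1 + 1))) s"
    unfolding digit_prog_def
    by (rule wp_call[OF wp_div tail]) (use k c k_pos in auto)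
  then show ?thesis by (rule wp_time) simp
qed

lemma wp_reset:
  assumes p: "params s" and lev0: "\<And>x. n \<le> x \<Longrightarrow> nmem s aLEV x = 0" and sl0: "\<And>i. k \<le> i \<Longrightarrow> nmem s aSL i = 0"
  shows "wp I reset_prog (\<lambda>s'. ready (\<lambda>_. 0) s' \<and> nmem s' aSL = (\<lambda>_. 0) \<and> nmem s' vcode 0 = nmem s vc 0)
    (n * (set_time + 10) + 4 * k + 20) s"
proof -
  define Inv where "Inv i s' \<longleftrightarrow> params s' \<and> (\<forall>x. x < i \<or> n \<le> x \<longrightarrow> nmem s' aLEV x = 0) \<and>
      (\<forall>J<2 ^ L. \<forall>x<n. x < i \<longrightarrow> nmem s' aX (J * n + x) = 0) \<and> nmem s' aSL = nmem s aSL \<and>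
      nmem s' vc = nmem s vc" for i s'
  have clear: "wp I (for_loop ve NSize (nset vse (V ve) ;; nset vsl (NConst 0) ;; set_level)) (Inv n)
      (n * (Suc (1 + Suc (1 + set_time)) + 3) + 3) s"
  proof (rule wp_for[where Inv = Inv])
    show "Inv 0 s" using p lev0 by (simp add: Inv_def)
    fix i s' assume i: "i < n" "nmem s' ve 0 = i" and inv: "Inv i s'"
    let ?s = "nat_store vsl 0 0 (nat_store vse 0 i s')"
    have "wp I set_level (Inv (Suc i)) set_time ?s"
    proof (rule wp_use[OF wp_set_level_raw[of ?s i 0]])
      fix s3 assume s3: "nmem s3 aLEV = (nmem ?s aLEV)(i := 0) \<and>
        (\<forall>J<2 ^ L. \<forall>x<n. nmem s3 aX (J * n + x) = (if x = i then level_bit J 0 else nmem ?s aX (J * n + x))) \<and>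
        rmem s3 rls 0 = rmem ?s rls 0 - (if 0 < nmem ?s aLEV i then lin i else 0) + (if 0 < (0::nat) then lin i else 0) \<and>
        rmem s3 rws 0 = rmem ?s rws 0 - (if 0 < nmem ?s aLEV i \<and> w i \<le> \<tau> then w i else 0)
          + (if 0 < (0::nat) \<and> w i \<le> \<tau> then w i else 0)"
        and ag: "agree (- writes set_level) ?s s3"
      have "params s3" using ag by (rule params_agree[rotated]) (use inv in \<open>auto simp: Inv_def writes_set_level\<close>)
      moreover have "nmem s3 aSL = nmem s aSL" "nmem s3 vc = nmem s vc"
        using ag inv by (simp_all add: Inv_def agree_def writes_set_level)
      ultimately show "Inv (Suc i) s3" using s3 inv by (auto simp: Inv_def less_Suc_eq)
    qed (use inv i in \<open>auto simp: Inv_def\<close>)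
    then show "wp I (nset vse (V ve) ;; nset vsl (NConst 0) ;; set_level) (Inv (Suc i)) (Suc (1 + Suc (1 + set_time))) s'"
      using i by - ((rule wp_seq, rule wp_nat)+, simp)
  qed (auto simp: Inv_def size writes_set_level)
  define Jnv where "Jnv i s' \<longleftrightarrow> ready (\<lambda>_. 0) s' \<and> (\<forall>j. j < i \<or> k \<le> j \<longrightarrow> nmem s' aSL j = 0) \<and>
      nmem s' vc = nmem s vc" for i s'
  have slots: "wp I (for_loop vi (V vk) (CNatSet aSL (V vi) (NConst 0))) (Jnv k) (k * (1 + 3) + 3) s1" if "Jnv 0 s1" for s1
  proof (rule wp_for[where Inv = Jnv])
    fix i s' assume "i < k" "nmem s' vi 0 = i" "Jnv i s'"
    then show "wp I (CNatSet aSL (V vi) (NConst 0)) (Jnv (Suc i)) 1 s'"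
      by (intro wp_nat) (auto simp: Jnv_def less_Suc_eq)
  qed (use that in \<open>auto simp: Jnv_def ready_def params_def\<close>)
  let ?Q = "\<lambda>s'. ready (\<lambda>_. 0) s' \<and> nmem s' aSL = (\<lambda>_. 0) \<and> nmem s' vcode 0 = nmem s vc 0"
  have last: "wp I (nset vcode (V vc)) ?Q 1 s1" if "Jnv k s1" for s1
  proof (rule wp_nat)
    have "nmem s1 aSL = (\<lambda>_. 0)" using that by (auto simp: Jnv_def fun_eq_iff not_less)
    then show "?Q (nat_store vcode (neval I s1 (NConst 0)) (neval I s1 (V vc)) s1)"
      using that by (simp add: Jnv_def)
  qed
  have start: "Jnv 0 (real_store rws 0 0 (real_store rls 0 0 s1))" if s1: "Inv n s1" for s1
  proof -
    have "nmem s1 aLEV = (\<lambda>_. 0)" using s1 by (auto simp: Inv_def fun_eq_iff not_less)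
    moreover have "support (\<lambda>_. 0) = {}" by (simp add: support_def)
    ultimately have "holds (\<lambda>_. 0) (real_store rws 0 0 (real_store rls 0 0 s1))"
      using s1 by (simp add: holds_def Inv_def load_def)
    then show ?thesis using s1 sl0 by (simp add: Jnv_def Inv_def ready_def bounded_def)
  qed
  have tail: "wp I (rset rls (ROfNat (NConst 0)) ;; rset rws (ROfNat (NConst 0)) ;;
      for_loop vi (V vk) (CNatSet aSL (V vi) (NConst 0)) ;; nset vcode (V vc)) ?Q
      (Suc (1 + Suc (1 + Suc ((k * (1 + 3) + 3) + 1)))) s1" if "Inv n s1" for s1
    by (rule wp_seq, rule wp_real, rule wp_seq, rule wp_real, rule wp_seq, rule wp_mono[OF slots last])
       (use start[OF that] in simp_all)
  have "wp I reset_prog ?Q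
      (Suc ((n * (Suc (1 + Suc (1 + set_time)) + 3) + 3) + Suc (1 + Suc (1 + Suc ((k * (1 + 3) + 3) + 1))))) s"
    unfolding reset_prog_def by (rule wp_call[OF clear tail])
  then show ?thesis by (rule wp_time) (simp add: algebra_simps)
qed

abbreviation "round_time c \<equiv>
  settle_time + (14 * n + 20) + (4 * c + 10) + (2 * set_time + scan_time + 20) + 10"

lemma exchange_slots:
  assumes "\<And>i. sl i \<le> n" "\<And>i. k \<le> i \<Longrightarrow> sl i = 0" "d < k"
  shows "snd (exchange d lev sl) i \<le> n" "k \<le> i \<Longrightarrow> snd (exchange d lev sl) i = 0"
proof -
  define b where "b = scan (vacate d lev sl) (Psi lev)"
  have "0 < snd b \<Longrightarrow> fst b < n"
    using scan_lightest[of "vacate d lev sl" "Psi lev"] unfolding b_def lightest_in_def choices_def by auto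
  then show "snd (exchange d lev sl) i \<le> n" "k \<le> i \<Longrightarrow> snd (exchange d lev sl) i = 0"
    using assms by (auto simp: exchange_def Let_def b_def[symmetric])
qed

lemma wp_round:
  assumes r: "ready lev s" and sl: "nmem s aSL = sl" "\<And>i. sl i \<le> n" and c: "nmem s vcode 0 = c"
    and rd: "round (lev, sl, c) = (lev', sl', c')"
  shows "wp I (settle_prog ;; record_prog ;; digit_prog ;; exchange_prog)
    (\<lambda>s'. ready lev' s' \<and> nmem s' aSL = sl' \<and> nmem s' vcode 0 = c' \<and>
      improves I {support (settle lev)} (stored_set I s 0 0) (stored_set I s' 0 0)) (round_time c) s"
proof -
  let ?lev = "settle lev" and ?O = "stored_set I s 0 0"
  let ?best = "if sum w (support ?lev) \<le> 1 \<and> set_value I ?O < set_value I (support ?lev)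
       then support ?lev else ?O"
  let ?Q = "\<lambda>s'. ready lev' s' \<and> nmem s' aSL = sl' \<and> nmem s' vcode 0 = c' \<and>
      improves I {support ?lev} ?O (stored_set I s' 0 0)"
  have ex: "exchange (c mod k) ?lev sl = (lev', sl')" "c' = c div k"
    using rd by (auto simp: round_def split: prod.splits)
  have best: "improves I {support ?lev} ?O ?best" by (auto simp: improves_def weights)
  have four: "wp I exchange_prog ?Q (2 * set_time + scan_time + 20) s3"
    if s3: "ready ?lev s3" "nmem s3 aSL = sl" "rmem s3 rcur 0 = Psi ?lev" "nmem s3 vd 0 = c mod k"
      "nmem s3 vcode 0 = c div k" "stored_set I s3 0 0 = ?best" for s3
  proof (rule wp_use[OF wp_exchange[OF s3(1,2,4) _ s3(3)]])
    show "sl (c mod k) \<le> n" by (rule sl)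
    fix s' assume s': "ready (fst (exchange (c mod k) ?lev sl)) s' \<and> nmem s' aSL = snd (exchange (c mod k) ?lev sl)"
      and ag: "agree (- writes exchange_prog) s3 s'"
    have "nmem s' 0 = nmem s3 0" "nmem s' vcode = nmem s3 vcode"
      using ag by (simp_all add: agree_def writes_exchange_prog)
    then have "stored_set I s' 0 0 = ?best" "nmem s' vcode 0 = c'"
      using s3 ex by (simp_all add: stored_set_def)
    then show "?Q s'" using s' ex best by simp
  qed
  have three: "wp I (digit_prog ;; exchange_prog) ?Q (Suc ((4 * c + 10) + (2 * set_time + scan_time + 20))) s2"
    if s2: "ready ?lev s2" "nmem s2 aSL = sl" "rmem s2 rcur 0 = Psi ?lev" "nmem s2 vcode 0 = c"
      "stored_set I s2 0 0 = ?best" for s2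
  proof (rule wp_call[OF wp_digit[of s2 c] four])
    show "nmem s2 vk 0 = k" using s2 by (simp add: ready_def params_def)
    show "nmem s2 vcode 0 = c" by (rule s2)
    fix s' assume s': "nmem s' vd 0 = c mod k \<and> nmem s' vcode 0 = c div k"
      and ag: "agree (- writes digit_prog) s2 s'"
    show "ready ?lev s'" using s2(1) ag by (rule ready_agree) (auto simp: writes_digit_prog)
    have "nmem s' 0 = nmem s2 0" "nmem s' aSL = nmem s2 aSL" "rmem s' rcur = rmem s2 rcur"
      using ag by (simp_all add: agree_def writes_digit_prog)
    then show "nmem s' aSL = sl" "rmem s' rcur 0 = Psi ?lev" "stored_set I s' 0 0 = ?best"
      using s2 by (simp_all add: stored_set_def)
    show "nmem s' vd 0 = c mod k" "nmem s' vcode 0 = c div k" using s' by auto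
  qed
  have two: "wp I (record_prog ;; digit_prog ;; exchange_prog) ?Q
      (Suc ((14 * n + 20) + Suc ((4 * c + 10) + (2 * set_time + scan_time + 20)))) s1"
    if s1: "ready ?lev s1" "rmem s1 rcur 0 = Psi ?lev" "nmem s1 aSL = sl" "nmem s1 vcode 0 = c"
      "stored_set I s1 0 0 = ?O" for s1
  proof (rule wp_call[OF wp_record[OF s1(1)] three])
    fix s' assume s': "stored_set I s' 0 0 = (if sum w (support ?lev) \<le> 1 \<and>
          set_value I (stored_set I s1 0 0) < set_value I (support ?lev)
        then support ?lev else stored_set I s1 0 0)"
      and ag: "agree (- writes record_prog) s1 s'"
    show "ready ?lev s'" using s1(1) ag by (rule ready_agree) (auto simp: writes_record_prog)
    show "nmem s' aSL = sl" "rmem s' rcur 0 = Psi ?lev" "nmem s' vcode 0 = c"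
      using ag s1 by (simp_all add: agree_def writes_record_prog)
    show "stored_set I s' 0 0 = ?best" using s' s1(5) by simp
  qed
  have "wp I (settle_prog ;; record_prog ;; digit_prog ;; exchange_prog) ?Q
      (Suc (settle_time + (Suc ((14 * n + 20) + Suc ((4 * c + 10) + (2 * set_time + scan_time + 20)))))) s"
  proof (rule wp_call[OF wp_settle[OF r] two])
    fix s' assume s': "ready ?lev s' \<and> rmem s' rcur 0 = Psi ?lev" and ag: "agree (- writes settle_prog) s s'"
    show "ready ?lev s'" "rmem s' rcur 0 = Psi ?lev" using s' by auto
    have "nmem s' 0 = nmem s 0" "nmem s' aSL = nmem s aSL" "nmem s' vcode = nmem s vcode"
      using ag by (simp_all add: agree_def writes_settle_prog)
    then show "nmem s' aSL = sl" "nmem s' vcode 0 = c" "stored_set I s' 0 0 = ?O"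
      using sl c by (simp_all add: stored_set_def)
  qed
  then show ?thesis by (rule wp_time) simp
qed

text \<open>A reset clears only the cells below \<open>n\<close> and \<open>k\<close>. Knowing that
  the others are \<open>0\<close> makes whole arrays equal to the functions of the mathematical
  search.\<close>

definition idle :: "rstate \<Rightarrow> bool" where
  "idle s \<longleftrightarrow> params s \<and> (\<forall>x\<ge>n. nmem s aLEV x = 0) \<and> (\<forall>i\<ge>k. nmem s aSL i = 0)"

lemma wp_run:
  assumes idle: "idle s" and c: "nmem s vc 0 = c"
  shows "wp I run_prog (\<lambda>s'. idle s' \<and>
      improves I ((\<lambda>t. support (candidate c t)) ` {..<M}) (stored_set I s 0 0) (stored_set I s' 0 0))
    (n * (set_time + 10) + 4 * k + 30 + M * (round_time c + 3)) s"
proof -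
  let ?start = "(\<lambda>_. 0, \<lambda>_. 0, c)" and ?O = "stored_set I s 0 0"
  let ?body = "settle_prog ;; record_prog ;; digit_prog ;; exchange_prog"
  define Inv where "Inv t s' \<longleftrightarrow> (\<exists>lev sl c'. (round ^^ t) ?start = (lev, sl, c') \<and> ready lev s' \<and>
      nmem s' aSL = sl \<and> (\<forall>i. sl i \<le> n) \<and> (\<forall>i\<ge>k. sl i = 0) \<and> nmem s' vcode 0 = c' \<and> c' \<le> c \<and>
      improves I ((\<lambda>t. support (candidate c t)) ` {..<t}) ?O (stored_set I s' 0 0))" for t s'
  have loop: "wp I (for_loop vt (V vM) ?body) (Inv M) (M * (round_time c + 3) + 3) s1" if "Inv 0 s1" for s1
  proof (rule wp_for[where Inv = Inv])
    fix t s' assume t: "t < M" and "Inv t s'"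
    then obtain lev sl c' where st: "(round ^^ t) ?start = (lev, sl, c')" "ready lev s'" "nmem s' aSL = sl"
      "\<forall>i. sl i \<le> n" "\<forall>i\<ge>k. sl i = 0" "nmem s' vcode 0 = c'" "c' \<le> c"
      "improves I ((\<lambda>t. support (candidate c t)) ` {..<t}) ?O (stored_set I s' 0 0)" unfolding Inv_def by blast
    obtain lev2 sl2 c2 where rd: "round (lev, sl, c') = (lev2, sl2, c2)" by (metis prod_cases3)
    have "candidate c t = settle lev" using st(1) by (simp add: candidate_def)
    moreover have "exchange (c' mod k) (settle lev) sl = (lev2, sl2)" "c2 = c' div k"
      using rd by (auto simp: round_def split: prod.splits)
    moreover have "c' mod k < k" using k_pos by simp
    \<comment> \<open>Extracting a digit takes time linear in the remaining code; as the code never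
      grows, the initial \<open>c\<close> bounds every round.\<close>
    moreover have "c' div k \<le> c" using div_le_dividend st(7) by (rule order_trans)
    ultimately have sl2: "sl2 i \<le> n" "k \<le> i \<Longrightarrow> sl2 i = 0" "c2 \<le> c" for i
      using exchange_slots[where sl = sl and d = "c' mod k" and lev = "settle lev" and i = i] st(4,5) by auto
    have "wp I ?body (Inv (Suc t)) (round_time c') s'"
    proof (rule wp_mono[OF wp_round[OF st(2,3) _ st(6) rd]])
      show "sl i \<le> n" for i using st(4) by blast
      fix s2 assume s2: "ready lev2 s2 \<and> nmem s2 aSL = sl2 \<and> nmem s2 vcode 0 = c2 \<and>
        improves I {support (settle lev)} (stored_set I s' 0 0) (stored_set I s2 0 0)"
      have "improves I ((\<lambda>t. support (candidate c t)) ` {..<Suc t}) ?O (stored_set I s2 0 0)"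
        using improves_trans[OF st(8), of "{support (settle lev)}"] s2 \<open>candidate c t = settle lev\<close>
        by (simp add: lessThan_Suc)
      moreover have "(round ^^ Suc t) ?start = (lev2, sl2, c2)" using st(1) rd by simp
      ultimately show "Inv (Suc t) s2" unfolding Inv_def using s2 sl2 by blast
    qed simp
    then show "wp I ?body (Inv (Suc t)) (round_time c) s'"
      by (rule wp_time) (use st(7) in simp)
  next
    show "Inv 0 s1" by (rule that)
    show "neval I s' (V vM) = M" if "Inv i s'" for i s'
      using that by (auto simp: Inv_def ready_def params_def)
    show "Inv i (nat_store vt 0 x s')" if "Inv i s'" for i s' x
      using that by (simp add: Inv_def stored_set_def)
    show "vt \<notin> writes ?body"
      by (simp add: writes_settle_prog writes_record_prog writes_digit_prog writes_exchange_prog)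
  qed
  have "wp I run_prog (Inv M) (Suc ((n * (set_time + 10) + 4 * k + 20) + (M * (round_time c + 3) + 3))) s"
    unfolding run_prog_def
  proof (rule wp_call[OF wp_reset loop])
    show "params s" "\<And>x. n \<le> x \<Longrightarrow> nmem s aLEV x = 0" "\<And>i. k \<le> i \<Longrightarrow> nmem s aSL i = 0"
      using idle by (auto simp: idle_def)
    fix s' assume s': "ready (\<lambda>_. 0) s' \<and> nmem s' aSL = (\<lambda>_. 0) \<and> nmem s' vcode 0 = nmem s vc 0"
      and ag: "agree (- writes reset_prog) s s'"
    have "nmem s' 0 = nmem s 0" using ag by (simp add: agree_def writes_reset_prog)
    then have "stored_set I s' 0 0 = ?O" by (simp add: stored_set_def)
    then show "Inv 0 s'" using s' c by (simp add: Inv_def improves_def)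
  qed
  then show ?thesis
    by (rule wp_mono) (auto simp: Inv_def idle_def ready_def bounded_def holds_def)
qed

end

section \<open>Enumerating the guesses\<close>

definition search_prog :: com where
  "search_prog =
     (nset vx (NConst 1) ;;
      CWhile (BNot (BNatLess NSize (V vx)))
        (rset rv (RMul (ROfNat (V vx)) (RV rM)) ;;
         rset reta (RDiv (RV rv) (RMul (ROfNat (NConst 16)) (RMul (ROfNat (V vN)) (ROfNat NSize)))) ;;
         rset rth (RDiv (RV rv) (RMul (ROfNat (NConst 8)) (RMul (ROfNat (V vN)) (ROfNat (V vk))))) ;;
         for_loop vu (NAdd NSize (NConst 1))
           (rset rtau (RWeight (V vu)) ;;
            for_loop vp (NAdd NSize (NConst 1))
              (rset rW (RMul (ROfNat (NAdd (V vp) (V vB))) (RV rtau)) ;;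
               rset rcap (RMul (ROfNat (NAdd (V vp) (NAdd (V vB) (V vB)))) (RV rtau)) ;;
               rset rK (RDiv (RV rv) (RMul (ROfNat (NConst 32)) (RMul (ROfNat (V vN))
                 (RMul (ROfNat (NAdd (V vp) (V vB))) (RMul (RV rtau) (RV rtau)))))) ;;
               for_loop vc (V vC) run_prog)) ;;
         nset vx (NAdd (V vx) (V vx))))"

locale ram_setting = monotone_submodular "{..<ground_size I}" "set_value I" for I :: rinstance +
  fixes N :: nat
  assumes N_pos: "0 < N" and weight_nonneg: "0 \<le> weight_at I e"
begin

abbreviation "n \<equiv> ground_size I"
abbreviation "w \<equiv> weight_at I"
abbreviation "L \<equiv> 4 * N"

text \<open>The number \<open>645 * N\<^sup>2\<close> in \<open>k = 4 * N * (645 * N\<^sup>2)\<close> is an upper bound for \<open>2 * B + 1\<close>.\<close>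

definition "B = 322 * (N * N)"
definition "k = 2580 * (N * N) * N"
text \<open>With \<open>v'\<close> the guessed scale, \<open>L * v < 8 * N * v'\<close>. Dividing by
  \<open>\<theta> = v' / (8 * N * k)\<close> gives \<open>64 * k * N * N\<close> rounds, and
  \<open>R\<close> comes in the same way from \<open>\<eta> = v' / (16 * N * n)\<close>.\<close>

definition "M = Suc (64 * (k * (N * N)))"
definition "R = Suc (128 * (n * (N * N)))"

text \<open>When all singletons are feasible, the optimum lies between \<open>peak\<close> and
  \<open>n * peak\<close>. Powers of two up to \<open>n\<close> as multipliers therefore estimate it
  within a factor of two.\<close>

definition peak :: real where
  "peak = Max (insert 0 ((\<lambda>e. set_value I {e}) ` {..<n}))"

text \<open>The error budget is \<open>v' / (4 * N)\<close>. The light moves use a quarter of it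
  through \<open>n * eta\<close>, the heavy moves half through \<open>k * theta\<close>, and
  linearizing the penalty at most three sixteenths.\<close>

definition "eta x = x * peak / (16 * (real N * real n))"
definition "theta x = x * peak / (8 * (real N * real k))"
text \<open>\<open>p\<close> counts the light weight of the comparison solution in units of the
  threshold, rounded up. The extra \<open>B\<close> units inside the width keep \<open>cap\<close>
  within twice the width even for \<open>p = 0\<close>; another \<open>B\<close> units separate the
  two.\<close>

definition "width u p = real (p + B) * w u"
definition "cap u p = real (p + (B + B)) * w u"
text \<open>Chosen so that slope times threshold times width is \<open>x * peak / (32 * N)\<close>.
  For the threshold \<open>0\<close> the quotient is \<open>0\<close> by the convention for
  division, so there is no penalty.\<close>

definition "slope x u p = x * peak / (32 * (real N * (real (p + B) * (w u * w u))))"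

lemma k_pos: "0 < k"
  using N_pos by (simp add: k_def)

lemma peak_nonneg: "0 \<le> peak"
  unfolding peak_def by (rule Max_ge) auto

lemma ram_search_instance:
  assumes "0 \<le> x"
  shows "ram_search n curved tail L w (slope x u p) k I"
proof -
  interpret c: monotone_submodular "{..<n}" curved by (rule curved_submodular)
  show ?thesis
  proof
    show "0 < L" using N_pos by simp
    show "0 \<le> tail e" for e by (rule tail_nonneg)
    show "0 \<le> w e" for e by (rule weight_nonneg)
    show "0 \<le> slope x u p" using assms peak_nonneg weight_nonneg by (simp add: slope_def)
    show "set_value I S = curved S + sum tail S" for S by (simp add: curved_def)
    show "0 < k" by (rule k_pos)
  qed auto
qed

definition trial :: "real \<Rightarrow> nat \<Rightarrow> nat \<Rightarrow> nat \<Rightarrow> nat set set" where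
  "trial x u p c = (\<lambda>t. level_potential.support {..<n} (knapsack_search.candidate n curved tail L w (w u)
     (slope x u p) (width u p) (cap u p) (eta x) (theta x) R k c t)) ` {..<M}"

definition base :: "rstate \<Rightarrow> bool" where
  "base s \<longleftrightarrow> nmem s vN 0 = N \<and> nmem s vL 0 = L \<and> nmem s vP 0 = 2 ^ L \<and> nmem s vB 0 = B \<and>
     nmem s vk 0 = k \<and> nmem s vM 0 = M \<and> nmem s vR 0 = R \<and> nmem s vC 0 = k ^ M \<and>
     (\<forall>J<2 ^ L. \<forall>l\<le>L. nmem s aBIT (J * (L + 1) + l) = level_bit J l) \<and>
     (\<forall>J<2 ^ L. rmem s rA J = alpha L (card (set_decode J))) \<and> (\<forall>e<n. rmem s rLIN e = tail e) \<and>
     rmem s rG 0 = 1 - beta L \<and> rmem s rM 0 = peak \<and>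
     (\<forall>x\<ge>n. nmem s aLEV x = 0) \<and> (\<forall>i\<ge>k. nmem s aSL i = 0)"

abbreviation "base_ids \<equiv> {vN, vL, vP, vB, vk, vM, vR, vC, aBIT, rA, rLIN, rG, rM, aLEV, aSL}"

lemma base_store [simp]:
  "v \<notin> base_ids \<Longrightarrow> base (nat_store v i y s) = base s"
  "v \<notin> base_ids \<Longrightarrow> base (real_store v i z s) = base s"
  by (auto simp: base_def)

text \<open>The bound of \<open>wp_run\<close> with the code replaced by \<open>k ^ M\<close>, hence
  the same for all guesses.\<close>

abbreviation "run_time \<equiv>
  n * ((8 * 2 ^ L + 40) + 10) + 4 * k + 30 +
  M * (((6 * 2 ^ L + 20) + R * (n * ((L + 1) * (2 * (8 * 2 ^ L + 40) + (6 * 2 ^ L + 20) + 18) + 10) + 6) + 10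
    + (14 * n + 20) + (4 * k ^ M + 10)
    + (2 * (8 * 2 ^ L + 40) + (n * (L * (2 * (8 * 2 ^ L + 40) + (6 * 2 ^ L + 20) + 18) + 10) + 10) + 20) + 10) + 3)"

lemma wp_run_base:
  assumes x: "0 \<le> x" and b: "base s"
    and v: "rmem s reta 0 = eta x" "rmem s rth 0 = theta x" "rmem s rtau 0 = w u" "rmem s rK 0 = slope x u p"
      "rmem s rW 0 = width u p" "rmem s rcap 0 = cap u p" "nmem s vc 0 = c" and c: "c < k ^ M"
  shows "wp I run_prog (\<lambda>s'. base s' \<and> improves I (trial x u p c) (stored_set I s 0 0) (stored_set I s' 0 0))
    run_time s"
proof -
  interpret r: ram_search n curved tail L w "w u" "slope x u p" "width u p" "cap u p" "eta x" "theta x" R k M I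
    using x by (rule ram_search_instance)
  have "r.idle s" using b v by (simp add: r.idle_def r.params_def base_def)
  from r.wp_run[OF this v(7)] show ?thesis
  proof (rule wp_time[OF wp_use])
    fix s' assume s': "r.idle s' \<and> improves I ((\<lambda>t. r.support (r.candidate c t)) ` {..<M})
        (stored_set I s 0 0) (stored_set I s' 0 0)" and ag: "agree (- writes run_prog) s s'"
    have "base s'"
      using s' ag b by (simp add: base_def r.idle_def r.params_def agree_def writes_run_prog)
    then show "base s' \<and> improves I (trial x u p c) (stored_set I s 0 0) (stored_set I s' 0 0)"
      using s' by (simp add: trial_def)
  next
    show "n * ((8 * 2 ^ L + 40) + 10) + 4 * k + 30 + M * (r.round_time c + 3) \<le> run_time"
      using c by (intro add_mono mult_left_mono order_refl) auto
  qed
qed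

abbreviation "codes_time \<equiv> k ^ M * (run_time + 3) + 3"
abbreviation "widths_time \<equiv> (n + 1) * (codes_time + 9) + 3"
abbreviation "thresholds_time \<equiv> (n + 1) * (widths_time + 5) + 3"

definition scale_bound :: nat where
  "scale_bound = nat \<lfloor>log 2 n\<rfloor> + 1"

text \<open>Index \<open>u = n\<close> is included because it lies outside the ground set: there
  \<open>weight_at\<close> is \<open>0\<close> for knapsack instances, which supplies the threshold
  \<open>0\<close>.\<close>

definition trials :: "nat set set" where
  "trials = (\<Union>x\<in>{2 ^ i | i. 2 ^ i \<le> n}. \<Union>u\<le>n. \<Union>p\<le>n. \<Union>c<k ^ M. trial (real x) u p c)"

lemma scale_bound: "2 ^ i \<le> n \<Longrightarrow> i < scale_bound"
proof -
  assume i: "2 ^ i \<le> n"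
  then have "real (2 ^ i) \<le> real n" by (simp only: of_nat_le_iff)
  moreover have "0 < n" using i by (cases n) auto
  ultimately have "real i \<le> log 2 n" by (simp add: le_log_iff powr_realpow)
  then have "int i \<le> \<lfloor>log 2 n\<rfloor>" by (simp add: le_floor_iff)
  then show "i < scale_bound" by (simp add: scale_bound_def)
qed

lemma wp_search:
  assumes b: "base s"
  shows "wp I search_prog (\<lambda>s'. improves I trials (stored_set I s 0 0) (stored_set I s' 0 0))
    (scale_bound * (thresholds_time + 9) + 5) s"
proof -
  let ?O = "stored_set I s 0 0"
  let ?codes = "for_loop vc (V vC) run_prog"
  define K where "K C s' \<longleftrightarrow> base s' \<and> improves I C ?O (stored_set I s' 0 0)" for C s'
  define scale where "scale x s' \<longleftrightarrow> rmem s' rv 0 = real x * peak \<and> rmem s' reta 0 = eta (real x) \<and>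
      rmem s' rth 0 = theta (real x) \<and> nmem s' vx 0 = x" for x and s' :: rstate
  define thr where "thr u s' \<longleftrightarrow> rmem s' rtau 0 = w u \<and> nmem s' vu 0 = u" for u and s' :: rstate
  define wid where "wid x u p s' \<longleftrightarrow> rmem s' rK 0 = slope (real x) u p \<and> rmem s' rW 0 = width u p \<and>
      rmem s' rcap 0 = cap u p \<and> nmem s' vp 0 = p" for x u p and s' :: rstate
  have K_store: "K C (nat_store v i y s') = K C s'" "K C (real_store v' i z s') = K C s'"
    if "v \<notin> base_ids \<union> {0}" "v' \<notin> base_ids" for C v v' i y z s'
    using that by (auto simp: K_def stored_set_def)
  have codes: "wp I ?codes (\<lambda>s'. K (C \<union> (\<Union>c<k ^ M. trial (real x) u p c)) s' \<and> scale x s' \<and> thr u s' \<and> wid x u p s')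
      codes_time s1"
    if "K C s1" "scale x s1" "thr u s1" "wid x u p s1" for C x u p s1
  proof -
    let ?Inv = "\<lambda>i s'. K (C \<union> (\<Union>c<i. trial (real x) u p c)) s' \<and> scale x s' \<and> thr u s' \<and> wid x u p s'"
    show ?thesis
    proof (rule wp_for[where Inv = ?Inv])
      show "?Inv 0 s1" using that by simp
      show "neval I s' (V vC) = k ^ M" if "?Inv i s'" for i s' using that by (simp add: K_def base_def)
      show "?Inv i (nat_store vc 0 y s')" if "?Inv i s'" for i s' y
        using that by (simp add: K_store[where v' = 0] scale_def thr_def wid_def)
      show "vc \<notin> writes run_prog" by (simp add: writes_run_prog)
      fix i s' assume i: "i < k ^ M" "nmem s' vc 0 = i" and inv: "?Inv i s'"
      show "wp I run_prog (?Inv (Suc i)) run_time s'"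
      proof (rule wp_use[OF wp_run_base[of "real x" s' u p i]])
        fix s2 assume s2: "base s2 \<and> improves I (trial (real x) u p i) (stored_set I s' 0 0) (stored_set I s2 0 0)"
          and ag: "agree (- writes run_prog) s' s2"
        have "scale x s2 \<and> thr u s2 \<and> wid x u p s2"
          using inv ag by (simp add: scale_def thr_def wid_def agree_def writes_run_prog)
        moreover have "improves I (C \<union> (\<Union>c<i. trial (real x) u p c) \<union> trial (real x) u p i) ?O (stored_set I s2 0 0)"
          using inv s2 improves_trans unfolding K_def by blast
        ultimately show "?Inv (Suc i) s2" using s2 by (simp add: K_def lessThan_Suc Un_ac)
      qed (use inv i in \<open>auto simp: K_def scale_def thr_def wid_def\<close>)
    qed
  qed
  let ?width_body = "rset rW (RMul (ROfNat (NAdd (V vp) (V vB))) (RV rtau)) ;;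
               rset rcap (RMul (ROfNat (NAdd (V vp) (NAdd (V vB) (V vB)))) (RV rtau)) ;;
               rset rK (RDiv (RV rv) (RMul (ROfNat (NConst 32)) (RMul (ROfNat (V vN))
                 (RMul (ROfNat (NAdd (V vp) (V vB))) (RMul (RV rtau) (RV rtau)))))) ;; ?codes"
  let ?widths = "for_loop vp (NAdd NSize (NConst 1)) ?width_body"
  have widths: "wp I ?widths (\<lambda>s'. K (C \<union> (\<Union>p\<le>n. \<Union>c<k ^ M. trial (real x) u p c)) s' \<and> scale x s' \<and> thr u s')
      widths_time s1"
    if "K C s1" "scale x s1" "thr u s1" for C x u s1
  proof -
    let ?Inv = "\<lambda>i s'. K (C \<union> (\<Union>p<i. \<Union>c<k ^ M. trial (real x) u p c)) s' \<and> scale x s' \<and> thr u s'"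
    have "wp I ?widths (?Inv (n + 1)) ((n + 1) * (Suc (1 + Suc (1 + Suc (1 + codes_time))) + 3) + 3) s1"
    proof (rule wp_for[where Inv = ?Inv])
      show "?Inv 0 s1" using that by simp
      show "?Inv i (nat_store vp 0 y s')" if "?Inv i s'" for i s' y
        using that by (simp add: K_store[where v' = 0] scale_def thr_def)
      fix i s' assume i: "i < n + 1" "nmem s' vp 0 = i" and inv: "?Inv i s'"
      have f: "nmem s' vB 0 = B" "nmem s' vN 0 = N" "rmem s' rtau 0 = w u" "rmem s' rv 0 = real x * peak"
        using inv by (auto simp: K_def base_def thr_def scale_def)
      let ?s = "real_store rK 0 (slope (real x) u i) (real_store rcap 0 (cap u i) (real_store rW 0 (width u i) s'))"
      have "wp I ?codes (?Inv (Suc i)) codes_time ?s"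
      proof (rule wp_mono[OF codes[of "C \<union> (\<Union>p<i. \<Union>c<k ^ M. trial (real x) u p c)" ?s x u i]])
        show "K (C \<union> (\<Union>p<i. \<Union>c<k ^ M. trial (real x) u p c)) ?s" using inv by (simp add: K_store[where v = 10])
        show "scale x ?s" "thr u ?s" "wid x u i ?s" using inv i by (simp_all add: scale_def thr_def wid_def)
      qed (simp_all add: lessThan_Suc Un_ac)
      then show "wp I ?width_body (?Inv (Suc i)) (Suc (1 + Suc (1 + Suc (1 + codes_time)))) s'"
        by - ((rule wp_seq, rule wp_real)+, use f i in \<open>simp add: width_def cap_def slope_def\<close>)
    qed (auto simp: writes_run_prog)
    then show ?thesis
      by (rule wp_mono) (simp_all add: lessThan_Suc_atMost flip: add_2_eq_Suc)
  qed
  let ?threshold_body = "rset rtau (RWeight (V vu)) ;; ?widths"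
  let ?thresholds = "for_loop vu (NAdd NSize (NConst 1)) ?threshold_body"
  have thresholds: "wp I ?thresholds
      (\<lambda>s'. K (C \<union> (\<Union>u\<le>n. \<Union>p\<le>n. \<Union>c<k ^ M. trial (real x) u p c)) s' \<and> scale x s') thresholds_time s1"
    if "K C s1" "scale x s1" for C x s1
  proof -
    let ?Inv = "\<lambda>i s'. K (C \<union> (\<Union>u<i. \<Union>p\<le>n. \<Union>c<k ^ M. trial (real x) u p c)) s' \<and> scale x s'"
    have "wp I ?thresholds (?Inv (n + 1)) ((n + 1) * (Suc (1 + widths_time) + 3) + 3) s1"
    proof (rule wp_for[where Inv = ?Inv])
      show "?Inv 0 s1" using that by simp
      show "?Inv i (nat_store vu 0 y s')" if "?Inv i s'" for i s' y
        using that by (simp add: K_store[where v' = 0] scale_def)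
      fix i s' assume i: "i < n + 1" "nmem s' vu 0 = i" and inv: "?Inv i s'"
      let ?s = "real_store rtau 0 (w i) s'"
      have "wp I ?widths (?Inv (Suc i)) widths_time ?s"
      proof (rule wp_mono[OF widths[of "C \<union> (\<Union>u<i. \<Union>p\<le>n. \<Union>c<k ^ M. trial (real x) u p c)" ?s x i]])
        show "K (C \<union> (\<Union>u<i. \<Union>p\<le>n. \<Union>c<k ^ M. trial (real x) u p c)) ?s" using inv by (simp add: K_store[where v = 10])
        show "scale x ?s" "thr i ?s" using inv i by (simp_all add: scale_def thr_def)
      qed (simp_all add: lessThan_Suc Un_ac)
      then show "wp I ?threshold_body (?Inv (Suc i)) (Suc (1 + widths_time)) s'"
        by - (rule wp_seq, rule wp_real, use i in simp)
    qed (auto simp: writes_run_prog)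
    then show ?thesis
      by (rule wp_mono) (simp_all add: lessThan_Suc_atMost)
  qed
  let ?scale_body = "rset rv (RMul (ROfNat (V vx)) (RV rM)) ;;
         rset reta (RDiv (RV rv) (RMul (ROfNat (NConst 16)) (RMul (ROfNat (V vN)) (ROfNat NSize)))) ;;
         rset rth (RDiv (RV rv) (RMul (ROfNat (NConst 8)) (RMul (ROfNat (V vN)) (ROfNat (V vk))))) ;;
         ?thresholds ;; nset vx (NAdd (V vx) (V vx))"
  define seen where "seen i = (\<Union>x\<in>{2 ^ j | j. j < i}. \<Union>u\<le>n. \<Union>p\<le>n. \<Union>c<k ^ M. trial (real x) u p c)" for i :: nat
  let ?Inv = "\<lambda>i s'. K (seen i) s' \<and> nmem s' vx 0 = 2 ^ i"
  have seen_Suc: "seen (Suc i) = seen i \<union> (\<Union>u\<le>n. \<Union>p\<le>n. \<Union>c<k ^ M. trial (real (2 ^ i)) u p c)" for i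
  proof -
    have "{2 ^ j | j. j < Suc i} = insert (2 ^ i :: nat) {2 ^ j | j. j < i}"
      by (auto simp: less_Suc_eq)
    then show ?thesis unfolding seen_def by (simp only: UN_insert Un_commute)
  qed
  have body: "wp I ?scale_body (?Inv (Suc i))
      (Suc (1 + Suc (1 + Suc (1 + Suc (thresholds_time + 1))))) s'"
    if inv: "?Inv i s'" for i s'
  proof -
    have f: "nmem s' vN 0 = N" "nmem s' vk 0 = k" "rmem s' rM 0 = peak" using inv by (auto simp: K_def base_def)
    let ?x = "2 ^ i :: nat"
    let ?s = "real_store rth 0 (theta (real ?x)) (real_store reta 0 (eta (real ?x)) (real_store rv 0 (real ?x * peak) s'))"
    have "wp I (?thresholds ;; nset vx (NAdd (V vx) (V vx))) (?Inv (Suc i)) (Suc (thresholds_time + 1)) ?s"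
    proof (rule wp_seq, rule wp_mono[OF thresholds[of "seen i" ?s ?x]])
      show "K (seen i) ?s" using inv by (simp add: K_store[where v = 10])
      show "scale ?x ?s" using inv by (simp add: scale_def)
      fix s2 assume s2: "K (seen i \<union> (\<Union>u\<le>n. \<Union>p\<le>n. \<Union>c<k ^ M. trial (real ?x) u p c)) s2 \<and> scale ?x s2"
      then show "wp I (nset vx (NAdd (V vx) (V vx))) (?Inv (Suc i)) 1 s2"
        by (intro wp_nat) (simp add: K_store[where v' = 0] scale_def seen_Suc)
    qed simp
    then show ?thesis
      by - ((rule wp_seq, rule wp_real)+, use inv f in \<open>simp add: eta_def theta_def\<close>)
  qed
  have "wp I (CWhile (BNot (BNatLess NSize (V vx))) ?scale_body)
      (\<lambda>s'. improves I trials ?O (stored_set I s' 0 0))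
      (scale_bound * Suc (Suc (1 + Suc (1 + Suc (1 + Suc (thresholds_time + 1))))) + 1) (nat_store vx 0 1 s)"
  proof (rule wp_while[where Inv = ?Inv])
    have "improves I (seen 0) ?O ?O" by (simp add: seen_def improves_refl)
    then have "K (seen 0) s" using b by (simp add: K_def)
    then show "?Inv 0 (nat_store vx 0 1 s)" by (simp add: K_store[where v' = 0])
    fix i s' assume inv: "?Inv i s'" and "beval I s' (BNot (BNatLess NSize (V vx)))"
    then have "2 ^ i \<le> n" by simp
    then show "i < scale_bound \<and> wp I ?scale_body (?Inv (Suc i))
      (Suc (1 + Suc (1 + Suc (1 + Suc (thresholds_time + 1))))) s'"
      using scale_bound body[OF inv] by blast
  next
    fix i s' assume inv: "?Inv i s'" and "\<not> beval I s' (BNot (BNatLess NSize (V vx)))"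
    then have i: "n < 2 ^ i" by simp
    have "trials \<subseteq> seen i"
    proof -
      have "j < i" if "2 ^ j \<le> n" for j
        using that i power_less_imp_less_exp[of "2 :: nat" j i] by linarith
      then show ?thesis unfolding trials_def seen_def by blast
    qed
    then show "improves I trials ?O (stored_set I s' 0 0)"
      using inv unfolding K_def improves_def by blast
  qed
  then have "wp I search_prog (\<lambda>s'. improves I trials ?O (stored_set I s' 0 0))
     (Suc (1 + (scale_bound * Suc (Suc (1 + Suc (1 + Suc (1 + Suc (thresholds_time + 1))))) + 1))) s"
    unfolding search_prog_def by - (rule wp_seq, rule wp_nat, simp)
  then show ?thesis by (rule wp_time) (simp add: algebra_simps)
qed

end

section \<open>Setting up the tables\<close>

text \<open>Reals cannot be converted to naturals on this machine, so the least \<open>N\<close>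
  with \<open>1 \<le> N * \<epsilon>\<close> is found by counting.\<close>

definition round_up_prog :: com where
  "round_up_prog =
     (nset vN (NConst 1) ;;
      CWhile (BRealLess (RMul (ROfNat (V vN)) RAccuracy) (ROfNat (NConst 1))) (inc vN (NConst 1)))"

definition number_prog :: com where
  "number_prog =
     (nset vL (NAdd (NAdd (V vN) (V vN)) (NAdd (V vN) (V vN))) ;;
      mul_prog 41 40 (V vN) (V vN) ;;
      mul_prog vB 40 (NConst 322) (V 41) ;;
      mul_prog 42 40 (NConst 2580) (V 41) ;;
      mul_prog vk 40 (V 42) (V vN) ;;
      mul_prog 43 40 (V vk) (V 41) ;;
      mul_prog 44 40 (NConst 64) (V 43) ;;
      nset vM (NAdd (V 44) (NConst 1)) ;;
      mul_prog 45 40 NSize (V 41) ;;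
      mul_prog 46 40 (NConst 128) (V 45) ;;
      nset vR (NAdd (V 46) (NConst 1)))"

definition power_prog :: com where
  "power_prog =
     (nset vP (NConst 1) ;; for_loop 47 (V vL) (nset vP (NAdd (V vP) (V vP))) ;;
      nset vC (NConst 1) ;; for_loop 47 (V vM) (mul_prog 48 40 (V vk) (V vC) ;; nset vC (V 48)))"

text \<open>Fills \<open>rAL\<close> from \<open>L\<close> downwards by \<open>alpha_step\<close>.
  At index \<open>0\<close> the divisor is \<open>0\<close>, and the resulting quotient
  \<open>0\<close> is indeed \<open>alpha L 0\<close>.\<close>

definition coefficient_prog :: com where
  "coefficient_prog =
     (rset rG (ROfNat (NConst 1)) ;;
      for_loop 47 (V vL)
        (rset rG (RMul (RV rG) (RDiv (ROfNat (V vL)) (RAdd (ROfNat (V vL)) (ROfNat (NConst 1)))))) ;;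
      CRealSet rAL (V vL) (RDiv (ROfNat (NConst 1)) (RAdd (ROfNat (V vL)) (ROfNat (NConst 1)))) ;;
      for_loop 47 (V vL)
        (nset 49 (NSub (V vL) (NAdd (V 47) (NConst 1))) ;;
         CRealSet rAL (V 49)
           (RDiv (RMul (RMul (RRead rAL (NAdd (V 49) (NConst 1))) (ROfNat (NSub (V vL) (V 49)))) (ROfNat (V vL)))
             (RMul (ROfNat (V 49)) (RAdd (ROfNat (V vL)) (ROfNat (NConst 1)))))))"

definition bit_prog :: com where
  "bit_prog =
     (div_prog 51 54 (NConst 2) ;; CNatSet aBIT (V 50) (V 51) ;; inc 52 (V 51) ;; nset 51 (V 54) ;;
      inc 50 (NConst 1))"

definition table_prog :: com where
  "table_prog =
     (nset 50 (NConst 0) ;;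
      for_loop 47 (V vP)
        (nset 51 (V 47) ;; nset 52 (NConst 0) ;; CNatSet aBIT (V 50) (NConst 0) ;; inc 50 (NConst 1) ;;
         for_loop 53 (V vL) bit_prog ;; CRealSet rA (V 47) (RRead rAL (V 52))))"

definition tail_prog :: com where
  "tail_prog =
     (for_loop 47 NSize (CNatSet 55 (V 47) (NConst 1)) ;;
      for_loop 47 NSize
        (rset 156 (RQuery 55 (NConst 0)) ;; CNatSet 55 (V 47) (NConst 0) ;;
         CRealSet rLIN (V 47) (RSub (RV 156) (RQuery 55 (NConst 0))) ;; CNatSet 55 (V 47) (NConst 1)))"

definition peak_prog :: com where
  "peak_prog =
     (rset rM (ROfNat (NConst 0)) ;;
      for_loop 47 NSize
        (CNatSet 57 (V 47) (NConst 1) ;;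
         only_if (BRealLess (RV rM) (RQuery 57 (NConst 0))) (rset rM (RQuery 57 (NConst 0))) ;;
         CNatSet 57 (V 47) (NConst 0)))"

definition knapsack_prog :: com where
  "knapsack_prog =
     (round_up_prog ;; number_prog ;; power_prog ;; coefficient_prog ;; table_prog ;; tail_prog ;;
      peak_prog ;; search_prog)"

lemma writes_setup:
  "writes round_up_prog = {vN}"
  "writes number_prog = {vL, 40, 41, vB, 42, vk, 43, 44, vM, 45, 46, vR}"
  "writes power_prog = {vP, 47, vC, 48, 40}"
  "writes coefficient_prog = {rG, 47, rAL, 49}"
  "writes bit_prog = {51, 54, aBIT, 52, 50}"
  "writes table_prog = {50, 47, 51, 52, aBIT, 53, 54, rA}"
  "writes tail_prog = {47, 55, 156, rLIN}"
  "writes peak_prog = {rM, 47, 57}"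
  by (auto simp: round_up_prog_def number_prog_def power_prog_def coefficient_prog_def bit_prog_def
      table_prog_def tail_prog_def peak_prog_def)

lemma wp_coefficients:
  assumes L: "nmem s vL 0 = L" "0 < L"
  shows "wp I coefficient_prog (\<lambda>s'. rmem s' rG 0 = 1 - beta L \<and> (\<forall>r\<le>L. rmem s' rAL r = alpha L r))
    (10 * L + 20) s"
proof -
  define G where "G i s' \<longleftrightarrow> nmem s' vL 0 = L \<and> rmem s' rG 0 = (real L / (real L + 1)) ^ i" for i and s' :: rstate
  define A where "A i s' \<longleftrightarrow> G L s' \<and> (\<forall>r\<le>L. L - i \<le> r \<longrightarrow> rmem s' rAL r = alpha L r)" for i s'
  let ?step = "rset rG (RMul (RV rG) (RDiv (ROfNat (V vL)) (RAdd (ROfNat (V vL)) (ROfNat (NConst 1)))))"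
  have powers: "wp I (for_loop 47 (V vL) ?step) (G L) (L * (1 + 3) + 3) s0" if "G 0 s0" for s0
  proof (rule wp_for[where Inv = G])
    show "wp I ?step (G (Suc i)) 1 s'" if "G i s'" for i s'
      using that by (intro wp_real) (simp add: G_def)
  qed (use that in \<open>auto simp: G_def\<close>)
  let ?down = "nset 49 (NSub (V vL) (NAdd (V 47) (NConst 1))) ;;
         CRealSet rAL (V 49)
           (RDiv (RMul (RMul (RRead rAL (NAdd (V 49) (NConst 1))) (ROfNat (NSub (V vL) (V 49)))) (ROfNat (V vL)))
             (RMul (ROfNat (V 49)) (RAdd (ROfNat (V vL)) (ROfNat (NConst 1)))))"
  have alphas: "wp I (for_loop 47 (V vL) ?down) (A L) (L * (Suc (1 + 1) + 3) + 3) s0" if "A 0 s0" for s0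
  proof (rule wp_for[where Inv = A])
    fix i s' assume i: "i < L" "nmem s' 47 0 = i" and inv: "A i s'"
    define r where "r = L - Suc i"
    have r: "Suc r = L - i" "r < L" using i by (auto simp: r_def)
    have old: "rmem s' rAL (Suc r) = alpha L (Suc r)" using inv r i by (simp add: A_def)
    have val: "alpha L (Suc r) * real (L - r) * real L / (real r * (real L + 1)) = alpha L r"
      using alpha_step[of r L] r(2) alpha_0[of L] by (cases "r = 0") auto
    have new: "A (Suc i) (real_store rAL r (alpha L r) (nat_store 49 0 r s'))"
      using inv r unfolding A_def G_def by (auto simp: r_def)
    show "wp I ?down (A (Suc i)) (Suc (1 + 1)) s'"
      by (rule wp_seq, rule wp_nat, rule wp_real)
         (use new val old inv i r_def in \<open>simp add: A_def[of i] G_def\<close>)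
  qed (use that in \<open>auto simp: A_def G_def\<close>)
  have tail: "wp I (CRealSet rAL (V vL) (RDiv (ROfNat (NConst 1)) (RAdd (ROfNat (V vL)) (ROfNat (NConst 1)))) ;;
      for_loop 47 (V vL) ?down) (A L) (Suc (1 + (L * (Suc (1 + 1) + 3) + 3))) s1" if "G L s1" for s1
    by (rule wp_seq, rule wp_real, rule alphas) (use that alpha_L[OF L(2)] in \<open>auto simp: A_def G_def\<close>)
  have "wp I coefficient_prog (A L)
      (Suc (1 + Suc ((L * (1 + 3) + 3) + Suc (1 + (L * (Suc (1 + 1) + 3) + 3))))) s"
    unfolding coefficient_prog_def
    by (rule wp_seq, rule wp_real, rule wp_call[OF powers tail]) (use L in \<open>auto simp: G_def\<close>)
  then show ?thesis by (rule wp_mono) (auto simp: A_def G_def beta_def)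
qed

lemma wp_table:
  assumes L: "nmem s vL 0 = L" and P: "nmem s vP 0 = 2 ^ L"
    and al: "\<forall>r\<le>L. rmem s rAL r = alpha L r"
  shows "wp I table_prog (\<lambda>s'. (\<forall>J<2 ^ L. \<forall>l\<le>L. nmem s' aBIT (J * (L + 1) + l) = level_bit J l) \<and>
      (\<forall>J<2 ^ L. rmem s' rA J = alpha L (card (set_decode J)))) (2 ^ L * (L * (4 * 2 ^ L + 20) + 20) + 20) s"
proof -
  define C where "C s' \<longleftrightarrow> nmem s' vL 0 = L \<and> nmem s' vP 0 = 2 ^ L \<and> (\<forall>r\<le>L. rmem s' rAL r = alpha L r)" for s' :: rstate
  define rows where "rows J s' \<longleftrightarrow> (\<forall>J'<J. \<forall>l\<le>L. nmem s' aBIT (J' * (L + 1) + l) = level_bit J' l) \<and>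
      (\<forall>J'<J. rmem s' rA J' = alpha L (card (set_decode J')))" for J and s' :: rstate
  define Inv where "Inv J s' \<longleftrightarrow> C s' \<and> rows J s' \<and> nmem s' 50 0 = J * (L + 1)" for J s'
  define bits where "bits J j s' \<longleftrightarrow> C s' \<and> rows J s' \<and> nmem s' 47 0 = J \<and> nmem s' 50 0 = J * (L + 1) + Suc j \<and>
      nmem s' 51 0 = J div 2 ^ j \<and> nmem s' 52 0 = card {i. i < j \<and> i \<in> set_decode J} \<and>
      (\<forall>l\<le>j. nmem s' aBIT (J * (L + 1) + l) = level_bit J l)" for J j s'
  have other_row: "J' * (L + 1) + l \<noteq> J * (L + 1) + l'" if "J' < J" "l \<le> L" "l' \<le> L" for J J' l l'
    using row_index_eq[of l "L + 1" l' J' J] that by auto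
  have bit: "wp I bit_prog (bits J (Suc j)) (4 * 2 ^ L + 15) s'"
    if inv: "bits J j s'" and J: "J < 2 ^ L" and j: "j < L" for J j s'
  proof -
    let ?x = "J div 2 ^ j"
    have bit_val: "?x mod 2 = of_bool (j \<in> set_decode J)"
      by (simp add: set_decode_def odd_iff_mod_2_eq_one)
    have count: "card {i. i < Suc j \<and> i \<in> set_decode J} = card {i. i < j \<and> i \<in> set_decode J} + ?x mod 2"
    proof -
      have "{i. i < Suc j \<and> i \<in> set_decode J}
          = (if j \<in> set_decode J then insert j {i. i < j \<and> i \<in> set_decode J} else {i. i < j \<and> i \<in> set_decode J})"
        by (auto simp: less_Suc_eq)
      then show ?thesis unfolding bit_val by simp
    qed
    have half: "?x div 2 = J div 2 ^ Suc j" by (simp only: power_Suc2 div_mult2_eq)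
    have step: "wp I (CNatSet aBIT (V 50) (V 51) ;; inc 52 (V 51) ;; nset 51 (V 54) ;; inc 50 (NConst 1))
        (bits J (Suc j)) (Suc (1 + Suc (1 + Suc (1 + 1)))) s1"
      if s1: "nmem s1 51 0 = ?x mod 2 \<and> nmem s1 54 0 = ?x div 2" and ag: "agree (- {51, 54}) s' s1" for s1
    proof -
      have b1: "C s1" "rows J s1" "nmem s1 47 0 = J" "nmem s1 50 0 = J * (L + 1) + Suc j"
        "nmem s1 52 0 = card {i. i < j \<and> i \<in> set_decode J}"
        "\<forall>l\<le>j. nmem s1 aBIT (J * (L + 1) + l) = level_bit J l"
        using inv ag by (simp_all add: bits_def C_def rows_def agree_def)
      let ?s = "nat_store 50 0 (J * (L + 1) + Suc (Suc j)) (nat_store 51 0 (?x div 2)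
        (nat_store 52 0 (card {i. i < j \<and> i \<in> set_decode J} + ?x mod 2)
        (nat_store aBIT (J * (L + 1) + Suc j) (?x mod 2) s1)))"
      have "rows J ?s"
        unfolding rows_def
      proof (intro conjI allI impI)
        fix J' l assume "J' < J" "l \<le> L"
        then have "J' * (L + 1) + l \<noteq> J * (L + 1) + Suc j" using other_row[of J' J l "Suc j"] j by simp
        then show "nmem ?s aBIT (J' * (L + 1) + l) = level_bit J' l"
          using b1(2) \<open>J' < J\<close> \<open>l \<le> L\<close> by (simp add: rows_def)
      qed (use b1(2) in \<open>simp add: rows_def\<close>)
      moreover have "nmem ?s aBIT (J * (L + 1) + l) = level_bit J l" if "l \<le> Suc j" for l
        using b1(6) that bit_val by (cases "l = Suc j") auto
      ultimately have "bits J (Suc j) ?s"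
        using b1 count half by (simp add: bits_def C_def)
      then show ?thesis
        by - ((rule wp_seq, rule wp_nat)+, rule wp_nat, use b1 s1 in simp)
    qed
    have run: "wp I bit_prog (bits J (Suc j)) (Suc ((4 * ?x + 4) + Suc (1 + Suc (1 + Suc (1 + 1))))) s'"
      unfolding bit_prog_def
      by (rule wp_call[OF wp_div step]) (use inv in \<open>auto simp: bits_def\<close>)
    have "?x \<le> 2 ^ L" using J div_le_dividend[of J "2 ^ j"] by linarith
    then show ?thesis by (intro wp_time[OF run]) simp
  qed
  let ?body = "nset 51 (V 47) ;; nset 52 (NConst 0) ;; CNatSet aBIT (V 50) (NConst 0) ;; inc 50 (NConst 1) ;;
         for_loop 53 (V vL) bit_prog ;; CRealSet rA (V 47) (RRead rAL (V 52))"
  have row: "wp I ?body (Inv (Suc J))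
      (Suc (1 + Suc (1 + Suc (1 + Suc (1 + Suc ((L * ((4 * 2 ^ L + 15) + 3) + 3) + 1)))))) s'"
    if inv: "Inv J s'" and J: "J < 2 ^ L" "nmem s' 47 0 = J" for J s'
  proof -
    have loop: "wp I (for_loop 53 (V vL) bit_prog) (bits J L) (L * ((4 * 2 ^ L + 15) + 3) + 3) s1"
      if "bits J 0 s1" for s1
    proof (rule wp_for[where Inv = "bits J"])
      show "bits J 0 s1" by (rule that)
      show "neval I s2 (V vL) = L" if "bits J i s2" for i s2
        using that by (simp add: bits_def C_def)
      show "wp I bit_prog (bits J (Suc i)) (4 * 2 ^ L + 15) s2" if "i < L" "bits J i s2" for i s2
        by (rule bit[OF that(2) J(1) that(1)])
      show "bits J i (nat_store 53 0 x s2)" if "bits J i s2" for i s2 x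
        using that by (simp add: bits_def C_def rows_def)
    qed (simp add: writes_setup)
    have last: "wp I (CRealSet rA (V 47) (RRead rAL (V 52))) (Inv (Suc J)) 1 s1" if b: "bits J L s1" for s1
    proof (rule wp_real)
      have "{i. i < L \<and> i \<in> set_decode J} = set_decode J" using set_decode_less[OF J(1)] by auto
      then have cnt: "nmem s1 52 0 = card (set_decode J)" using b by (simp add: bits_def)
      moreover have "card (set_decode J) \<le> L"
        using card_mono[OF _ set_decode_less[OF J(1)]] by simp
      ultimately have "rmem s1 rAL (nmem s1 52 0) = alpha L (card (set_decode J))"
        using b by (simp add: bits_def C_def)
      then show "Inv (Suc J) (real_store rA (neval I s1 (V 47)) (reval I s1 (RRead rAL (V 52))) s1)"
        using b by (auto simp: Inv_def bits_def C_def rows_def less_Suc_eq)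
    qed
    have fin: "wp I (for_loop 53 (V vL) bit_prog ;; CRealSet rA (V 47) (RRead rAL (V 52))) (Inv (Suc J))
        (Suc ((L * ((4 * 2 ^ L + 15) + 3) + 3) + 1)) s1" if "bits J 0 s1" for s1
      by (rule wp_seq, rule wp_mono[OF loop[OF that] last]) simp_all
    let ?s = "nat_store 50 0 (J * (L + 1) + 1) (nat_store aBIT (J * (L + 1)) 0 (nat_store 52 0 0 (nat_store 51 0 J s')))"
    have "rows J ?s" using inv other_row[of _ J _ 0] by (auto simp: rows_def Inv_def)
    then have "bits J 0 ?s" using inv J by (simp add: bits_def Inv_def C_def)
    then show ?thesis
      by - ((rule wp_seq, rule wp_nat)+, use fin inv J in \<open>simp add: Inv_def[of J]\<close>)
  qed
  have "wp I (for_loop 47 (V vP) ?body) (Inv (2 ^ L))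
      (2 ^ L * (Suc (1 + Suc (1 + Suc (1 + Suc (1 + Suc ((L * ((4 * 2 ^ L + 15) + 3) + 3) + 1))))) + 3) + 3)
      (nat_store 50 0 0 s)"
  proof (rule wp_for[where Inv = Inv])
    show "Inv 0 (nat_store 50 0 0 s)" using L P al by (simp add: Inv_def C_def rows_def)
    show "neval I s' (V vP) = 2 ^ L" if "Inv i s'" for i s' using that by (simp add: Inv_def C_def)
    show "Inv i (nat_store 47 0 x s')" if "Inv i s'" for i s' x
      using that by (simp add: Inv_def C_def rows_def)
    show "47 \<notin> writes ?body" by (simp add: writes_setup)
  qed (rule row)
  then have "wp I table_prog (Inv (2 ^ L)) (Suc (1 +
      (2 ^ L * (Suc (1 + Suc (1 + Suc (1 + Suc (1 + Suc ((L * ((4 * 2 ^ L + 15) + 3) + 3) + 1))))) + 3) + 3))) s"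
    unfolding table_prog_def by - (rule wp_seq, rule wp_nat, simp)
  then show ?thesis by (rule wp_mono) (simp_all add: Inv_def rows_def algebra_simps)
qed

context ram_setting
begin

lemma wp_tail: "wp I tail_prog (\<lambda>s'. \<forall>e<n. rmem s' rLIN e = tail e) (14 * n + 10) s"
proof -
  define full where "full i s' \<longleftrightarrow> (\<forall>x<i. nmem s' 55 x = 1)" for i and s' :: rstate
  have fill: "wp I (for_loop 47 NSize (CNatSet 55 (V 47) (NConst 1))) (full n) (n * (1 + 3) + 3) s"
    by (rule wp_for[where Inv = full]) (auto simp: full_def less_Suc_eq intro!: wp_nat[unfolded One_nat_def])
  define Inv where "Inv i s' \<longleftrightarrow> full n s' \<and> (\<forall>e<i. rmem s' rLIN e = tail e)" for i s'
  let ?body = "rset 156 (RQuery 55 (NConst 0)) ;; CNatSet 55 (V 47) (NConst 0) ;;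
         CRealSet rLIN (V 47) (RSub (RV 156) (RQuery 55 (NConst 0))) ;; CNatSet 55 (V 47) (NConst 1)"
  have loop: "wp I (for_loop 47 NSize ?body) (Inv n) (n * (Suc (1 + Suc (1 + Suc (1 + 1))) + 3) + 3) s1"
    if "full n s1" for s1
  proof (rule wp_for[where Inv = Inv])
    fix i s' assume i: "i < n" "nmem s' 47 0 = i" and inv: "Inv i s'"
    have all: "stored_set I s' 55 0 = {..<n}" using inv by (auto simp: Inv_def full_def stored_set_def)
    have rest: "stored_set I (nat_store 55 i 0 (real_store 156 0 y s')) 55 0 = {..<n} - {i}" for y
      using inv by (auto simp: Inv_def full_def stored_set_def)
    show "wp I ?body (Inv (Suc i)) (Suc (1 + Suc (1 + Suc (1 + 1)))) s'"
      by (rule wp_seq, rule wp_real, rule wp_seq, rule wp_nat, rule wp_seq, rule wp_real, rule wp_nat)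
         (use inv i all rest in \<open>auto simp: Inv_def full_def tail_def less_Suc_eq\<close>)
  qed (use that in \<open>auto simp: Inv_def full_def\<close>)
  have "wp I tail_prog (Inv n) (Suc ((n * (1 + 3) + 3) + (n * (Suc (1 + Suc (1 + Suc (1 + 1))) + 3) + 3))) s"
    unfolding tail_prog_def by (rule wp_call[OF fill loop])
  then show ?thesis by (rule wp_mono) (auto simp: Inv_def)
qed

lemma wp_peak:
  assumes "nmem s 57 = (\<lambda>_. 0)"
  shows "wp I peak_prog (\<lambda>s'. rmem s' rM 0 = peak) (12 * n + 10) s"
proof -
  define Inv where "Inv i s' \<longleftrightarrow> nmem s' 57 = (\<lambda>_. 0) \<and>
      rmem s' rM 0 = Max (insert 0 ((\<lambda>e. set_value I {e}) ` {..<i}))" for i and s' :: rstate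
  let ?test = "only_if (BRealLess (RV rM) (RQuery 57 (NConst 0))) (rset rM (RQuery 57 (NConst 0)))"
  let ?body = "CNatSet 57 (V 47) (NConst 1) ;; ?test ;; CNatSet 57 (V 47) (NConst 0)"
  have loop: "wp I (for_loop 47 NSize ?body) (Inv n) (n * (Suc (1 + Suc (Suc (1 + 1) + 1)) + 3) + 3) s1"
    if "Inv 0 s1" for s1
  proof (rule wp_for[where Inv = Inv])
    fix i s' assume i: "i < n" "nmem s' 47 0 = i" and inv: "Inv i s'"
    let ?s = "nat_store 57 i 1 s'"
    have one: "stored_set I ?s 57 0 = {i}" using inv i by (auto simp: Inv_def stored_set_def)
    define mx where "mx = Max (insert 0 ((\<lambda>e. set_value I {e}) ` {..<i}))"
    have max: "Max (insert 0 ((\<lambda>e. set_value I {e}) ` {..<Suc i})) = max mx (set_value I {i})"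
      unfolding mx_def by (simp add: lessThan_Suc insert_commute[of 0] max.commute)
    have fin: "wp I (CNatSet 57 (V 47) (NConst 0)) (Inv (Suc i)) 1 s2"
      if "nmem s2 57 = (\<lambda>_. 0)(i := 1)" "nmem s2 47 0 = i" "rmem s2 rM 0 = max mx (set_value I {i})" for s2
    proof (rule wp_nat)
      have "((\<lambda>_. 0)(i := 0)) = (\<lambda>_. 0 :: nat)" by auto
      then show "Inv (Suc i) (nat_store 57 (neval I s2 (V 47)) (neval I s2 (NConst 0)) s2)"
        using that max by (simp add: Inv_def)
    qed
    have "wp I ?test (wp I (CNatSet 57 (V 47) (NConst 0)) (Inv (Suc i)) 1) (Suc (1 + 1)) ?s"
    proof (rule wp_if)
      have f: "rmem ?s rM 0 = mx" "nmem ?s 57 = (\<lambda>_. 0)(i := 1)"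
        using inv by (auto simp: Inv_def mx_def)
      {
        assume "beval I ?s (BRealLess (RV rM) (RQuery 57 (NConst 0)))"
        then show "wp I (rset rM (RQuery 57 (NConst 0))) (wp I (CNatSet 57 (V 47) (NConst 0)) (Inv (Suc i)) 1) 1 ?s"
          using f one i by (intro wp_real fin) (auto simp: max_def)
      next
        assume "\<not> beval I ?s (BRealLess (RV rM) (RQuery 57 (NConst 0)))"
        then show "wp I CSkip (wp I (CNatSet 57 (V 47) (NConst 0)) (Inv (Suc i)) 1) 1 ?s"
          using f one i by (intro wp_skip fin) (auto simp: max_def)
      }
    qed
    then show "wp I ?body (Inv (Suc i)) (Suc (1 + Suc (Suc (1 + 1) + 1))) s'"
      by - (rule wp_seq, rule wp_nat, rule wp_seq, use i in simp)
  qed (use that in \<open>auto simp: Inv_def\<close>)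
  have "wp I peak_prog (Inv n) (Suc (1 + (n * (Suc (1 + Suc (Suc (1 + 1) + 1)) + 3) + 3))) s"
    unfolding peak_prog_def by (rule wp_seq, rule wp_real, rule loop) (use assms in \<open>simp add: Inv_def\<close>)
  then show ?thesis by (rule wp_mono) (auto simp: Inv_def peak_def)
qed

definition numbers :: "rstate \<Rightarrow> bool" where
  "numbers s \<longleftrightarrow> nmem s vN 0 = N \<and> nmem s vL 0 = L \<and> nmem s vB 0 = B \<and> nmem s vk 0 = k \<and>
     nmem s vM 0 = M \<and> nmem s vR 0 = R"

lemma wp_round_up:
  assumes big: "1 \<le> real N * accuracy I" and least: "\<And>m. 0 < m \<Longrightarrow> m < N \<Longrightarrow> real m * accuracy I < 1"
  shows "wp I round_up_prog (\<lambda>s'. nmem s' vN 0 = N) (2 * N + 3) s"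
proof -
  define Inv where "Inv i s' \<longleftrightarrow> nmem s' vN 0 = Suc i \<and> Suc i \<le> N" for i and s' :: rstate
  let ?test = "BRealLess (RMul (ROfNat (V vN)) RAccuracy) (ROfNat (NConst 1))"
  have "wp I (CWhile ?test (inc vN (NConst 1))) (\<lambda>s'. nmem s' vN 0 = N) (N * Suc 1 + 1) (nat_store vN 0 1 s)"
  proof (rule wp_while[where Inv = Inv])
    show "Inv 0 (nat_store vN 0 1 s)" using N_pos by (simp add: Inv_def)
    fix i s' assume inv: "Inv i s'" and t: "beval I s' ?test"
    have "Suc i \<noteq> N" using inv t big by (auto simp: Inv_def)
    then have "Suc i < N" using inv by (simp add: Inv_def)
    then show "i < N \<and> wp I (inc vN (NConst 1)) (Inv (Suc i)) 1 s'"
      using inv by (auto simp: Inv_def intro!: wp_nat[unfolded One_nat_def])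
  next
    fix i s' assume inv: "Inv i s'" and t: "\<not> beval I s' ?test"
    have "\<not> Suc i < N" using least[of "Suc i"] inv t by (auto simp: Inv_def)
    then show "nmem s' vN 0 = N" using inv by (simp add: Inv_def)
  qed
  then have "wp I round_up_prog (\<lambda>s'. nmem s' vN 0 = N) (Suc (1 + (N * Suc 1 + 1))) s"
    unfolding round_up_prog_def by - (rule wp_seq, rule wp_nat, simp)
  then show ?thesis by (rule wp_time) simp
qed

abbreviation "number_time \<equiv>
  4 * N + 4 * (2580 * (N * N)) + 4 * k + 4 * n + 15000"

lemma wp_numbers:
  assumes N: "nmem s vN 0 = N"
  shows "wp I number_prog numbers number_time s"
proof -
  let ?NN = "N * N"
  have "wp I number_prog numbers (Suc (1 + Suc ((N * 4 + 5) + Suc ((322 * 4 + 5) + Suc ((2580 * 4 + 5) +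
      Suc (((2580 * ?NN) * 4 + 5) + Suc ((k * 4 + 5) + Suc ((64 * 4 + 5) + Suc (1 + Suc ((n * 4 + 5) +
      Suc ((128 * 4 + 5) + 1))))))))))) s"
    unfolding number_prog_def
    apply (rule wp_seq, rule wp_nat)
    apply (rule wp_call[OF wp_mul_values[where x = N and y = N]])
         apply (simp_all add: N)[5]
    apply (rule wp_call[OF wp_mul_values[where x = 322 and y = ?NN]])
         apply (simp_all add: N)[5]
    apply (rule wp_call[OF wp_mul_values[where x = 2580 and y = ?NN]])
         apply (simp_all add: N agree_def)[5]
    apply (rule wp_call[OF wp_mul_values[where x = "2580 * ?NN" and y = N]])
         apply (simp_all add: N agree_def)[5]
    apply (rule wp_call[OF wp_mul_values[where x = k and y = ?NN]])
         apply (simp_all add: N agree_def k_def)[5]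
    apply (rule wp_call[OF wp_mul_values[where x = 64 and y = "k * ?NN"]])
         apply (simp_all add: N agree_def)[5]
    apply (rule wp_seq, rule wp_nat)
    apply (rule wp_call[OF wp_mul_values[where x = n and y = ?NN]])
         apply (simp_all add: N agree_def)[5]
    apply (rule wp_call[OF wp_mul_values[where x = 128 and y = "n * ?NN"]])
         apply (simp_all add: N agree_def)[5]
    apply (rule wp_nat)
    apply (simp add: N agree_def numbers_def B_def k_def M_def R_def)
    done
  then show ?thesis by (rule wp_time) simp
qed

lemma wp_powers:
  assumes "numbers s"
  shows "wp I power_prog (\<lambda>s'. nmem s' vP 0 = 2 ^ L \<and> nmem s' vC 0 = k ^ M) (4 * L + M * (4 * k + 20) + 20) s"
proof -
  define P where "P i s' \<longleftrightarrow> nmem s' vL 0 = L \<and> nmem s' vM 0 = M \<and> nmem s' vk 0 = k \<and> nmem s' vP 0 = 2 ^ i"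
    for i and s' :: rstate
  define C where "C i s' \<longleftrightarrow> P L s' \<and> nmem s' vC 0 = k ^ i" for i s'
  have two: "wp I (for_loop 47 (V vL) (nset vP (NAdd (V vP) (V vP)))) (P L) (L * (1 + 3) + 3) s1" if "P 0 s1" for s1
  proof (rule wp_for[where Inv = P])
    show "wp I (nset vP (NAdd (V vP) (V vP))) (P (Suc i)) 1 s'" if "P i s'" for i s'
      using that by (intro wp_nat) (simp add: P_def)
  qed (use that in \<open>auto simp: P_def\<close>)
  let ?body = "mul_prog 48 40 (V vk) (V vC) ;; nset vC (V 48)"
  have pow: "wp I (for_loop 47 (V vM) ?body) (C M) (M * (Suc ((k * 4 + 5) + 1) + 3) + 3) s1" if "C 0 s1" for s1
  proof (rule wp_for[where Inv = C])
    fix i s' assume inv: "C i s'"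
    show "wp I ?body (C (Suc i)) (Suc ((k * 4 + 5) + 1)) s'"
      by (rule wp_call[OF wp_mul_values[where x = k and y = "k ^ i"]])
         (use inv in \<open>auto simp: C_def P_def agree_def intro!: wp_nat[unfolded One_nat_def]\<close>)
  qed (use that in \<open>auto simp: C_def P_def\<close>)
  have tail: "wp I (nset vC (NConst 1) ;; for_loop 47 (V vM) ?body) (C M)
      (Suc (1 + (M * (Suc ((k * 4 + 5) + 1) + 3) + 3))) s1" if "P L s1" for s1
    by (rule wp_seq, rule wp_nat, rule pow) (use that in \<open>simp add: C_def P_def\<close>)
  have "wp I power_prog (C M) (Suc (1 + Suc ((L * (1 + 3) + 3) + Suc (1 + (M * (Suc ((k * 4 + 5) + 1) + 3) + 3))))) s"
    unfolding power_prog_def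
    by (rule wp_seq, rule wp_nat, rule wp_call[OF two tail]) (use assms in \<open>auto simp: P_def numbers_def\<close>)
  then show ?thesis by (rule wp_mono) (auto simp: C_def P_def algebra_simps)
qed

abbreviation "total_time \<equiv> (2 * N + 3) + number_time + (4 * L + M * (4 * k + 20) + 20) + (10 * L + 20)
  + (2 ^ L * (L * (4 * 2 ^ L + 20) + 20) + 20) + (14 * n + 10) + (12 * n + 10)
  + (scale_bound * (thresholds_time + 9) + 5) + 10"

lemma wp_knapsack:
  assumes "1 \<le> real N * accuracy I" and "\<And>m. 0 < m \<Longrightarrow> m < N \<Longrightarrow> real m * accuracy I < 1"
    and zero: "\<And>a. nmem s a = (\<lambda>_. 0)"
  shows "wp I knapsack_prog (\<lambda>s'. improves I trials {} (stored_set I s' 0 0)) total_time s"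
proof -
  define Z where "Z s' \<longleftrightarrow> nmem s' 0 = (\<lambda>_. 0) \<and> nmem s' 57 = (\<lambda>_. 0) \<and> nmem s' aLEV = (\<lambda>_. 0) \<and> nmem s' aSL = (\<lambda>_. 0)"
    for s' :: rstate
  have Lpos: "0 < L" using N_pos by simp
  let ?Q = "\<lambda>s'. improves I trials {} (stored_set I s' 0 0)"
  let ?T8 = "scale_bound * (thresholds_time + 9) + 5"
  have s8: "wp I search_prog ?Q ?T8 s1" if "base s1" "nmem s1 0 = (\<lambda>_. 0)" for s1
  proof -
    have "stored_set I s1 0 0 = {}" using that(2) by (simp add: stored_set_def)
    then show ?thesis using wp_search[OF that(1)] by simp
  qed
  define T where "T s' \<longleftrightarrow> numbers s' \<and> nmem s' vP 0 = 2 ^ L \<and> nmem s' vC 0 = k ^ M \<and> rmem s' rG 0 = 1 - beta L \<and>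
      (\<forall>J<2 ^ L. \<forall>l\<le>L. nmem s' aBIT (J * (L + 1) + l) = level_bit J l) \<and>
      (\<forall>J<2 ^ L. rmem s' rA J = alpha L (card (set_decode J)))" for s'
  let ?T7 = "Suc ((12 * n + 10) + ?T8)"
  have s7: "wp I (peak_prog ;; search_prog) ?Q ?T7 s1"
    if "T s1" "Z s1" "\<forall>e<n. rmem s1 rLIN e = tail e" for s1
    by (rule wp_call[OF wp_peak s8])
       (use that in \<open>simp_all add: T_def Z_def base_def numbers_def agree_def writes_setup\<close>)
  let ?T6 = "Suc ((14 * n + 10) + ?T7)"
  have s6: "wp I (tail_prog ;; peak_prog ;; search_prog) ?Q ?T6 s1" if "T s1" "Z s1" for s1
    by (rule wp_call[OF wp_tail s7])
       (use that in \<open>simp_all add: T_def Z_def numbers_def agree_def writes_setup\<close>)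
  let ?T5 = "Suc ((2 ^ L * (L * (4 * 2 ^ L + 20) + 20) + 20) + ?T6)"
  have s5: "wp I (table_prog ;; tail_prog ;; peak_prog ;; search_prog) ?Q ?T5 s1"
    if "numbers s1" "nmem s1 vP 0 = 2 ^ L" "nmem s1 vC 0 = k ^ M" "Z s1" "rmem s1 rG 0 = 1 - beta L"
      "\<forall>r\<le>L. rmem s1 rAL r = alpha L r" for s1
    by (rule wp_call[OF wp_table[where L = L] s6])
       (use that in \<open>simp_all add: T_def Z_def numbers_def agree_def writes_setup\<close>)
  let ?T4 = "Suc ((10 * L + 20) + ?T5)"
  have s4: "wp I (coefficient_prog ;; table_prog ;; tail_prog ;; peak_prog ;; search_prog) ?Q ?T4 s1"
    if "numbers s1" "nmem s1 vP 0 = 2 ^ L" "nmem s1 vC 0 = k ^ M" "Z s1" for s1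
    by (rule wp_call[OF wp_coefficients[where L = L] s5])
       (use that Lpos in \<open>simp_all add: Z_def numbers_def agree_def writes_setup\<close>)
  let ?T3 = "Suc ((4 * L + M * (4 * k + 20) + 20) + ?T4)"
  have s3: "wp I (power_prog ;; coefficient_prog ;; table_prog ;; tail_prog ;; peak_prog ;; search_prog) ?Q ?T3 s1"
    if "numbers s1" "Z s1" for s1
    by (rule wp_call[OF wp_powers s4])
       (use that in \<open>simp_all add: Z_def numbers_def agree_def writes_setup\<close>)
  let ?T2 = "Suc (number_time + ?T3)"
  have s2: "wp I (number_prog ;; power_prog ;; coefficient_prog ;; table_prog ;; tail_prog ;; peak_prog ;; search_prog)
      ?Q ?T2 s1" if "nmem s1 vN 0 = N" "Z s1" for s1
    by (rule wp_call[OF wp_numbers s3])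
       (use that in \<open>simp_all add: Z_def agree_def writes_setup\<close>)
  have "wp I knapsack_prog ?Q (Suc ((2 * N + 3) + ?T2)) s"
    unfolding knapsack_prog_def
    by (rule wp_call[OF wp_round_up[OF assms(1,2)] s2])
       (use zero in \<open>simp_all add: Z_def agree_def writes_setup\<close>)
  then show ?thesis by (rule wp_time) simp
qed

end

section \<open>The approximation guarantee\<close>

text \<open>
  Among \<open>q\<close> consecutive blocks of \<open>b\<close> elements, in order of decreasing weight, one contributes at
  most a fraction \<open>1 / q\<close> of the value. Dropping it frees \<open>b\<close> times the weight \<open>\<tau>\<close> of its lightest
  element, which bounds the weight of all elements after the block.
\<close>

lemma (in monotone_submodular) drop_block:
  fixes w :: "'a \<Rightarrow> real" and b q :: nat
  assumes A: "A \<subseteq> E" and w: "\<And>e. 0 \<le> w e" and w1: "sum w A \<le> 1" and b: "0 < b" and q: "0 < q"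
  shows "\<exists>Y. \<exists>\<tau> :: real. Y \<subseteq> A \<and> (\<tau> = 0 \<or> \<tau> \<in> w ` A) \<and> f A - f Y \<le> f A / q \<and>
    card {e \<in> Y. \<tau> < w e} \<le> q * b \<and> sum w Y + b * \<tau> \<le> 1"
proof (cases "card {e \<in> A. 0 < w e} \<le> q * b")
  case True
  then show ?thesis using nonneg[OF A] w1 by (intro exI[of _ A] exI[of _ 0]) auto
next
  case False
  have finA: "finite A" using A finite_sub by blast
  obtain ys where ys: "set ys = A" "distinct ys" using finite_distinct_list[OF finA] by blast
  define xs where "xs = sort_key (\<lambda>x. - w x) ys"
  have xs: "set xs = A" "distinct xs" "sorted (map (\<lambda>x. - w x) xs)" using ys by (simp_all add: xs_def)
  have decreasing: "w (xs ! j) \<le> w (xs ! i)" if "i \<le> j" "j < length xs" for i j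
    using sorted_nth_mono[OF xs(3), of i j] that by simp
  have "card {e \<in> A. 0 < w e} \<le> card A" using finA by (intro card_mono) auto
  then have len: "q * b < length xs" using False xs distinct_card[OF xs(2)] by simp
  define Pre where "Pre i = (!) xs ` {..<i * b}" for i
  define Bl where "Bl i = (!) xs ` {i * b..<Suc i * b}" for i
  have idx: "Suc i * b \<le> length xs" if "i < q" for i
  proof -
    have "Suc i * b \<le> q * b" using that by (intro mult_right_mono) auto
    then show ?thesis using len by simp
  qed
  have PreBl: "Pre (Suc i) = Pre i \<union> Bl i" for i
  proof -
    have "{..<Suc i * b} = {..<i * b} \<union> {i * b..<Suc i * b}" by auto
    then show ?thesis unfolding Pre_def Bl_def by (simp only: image_Un)
  qed
  have PreA: "Pre i \<subseteq> A" if "i \<le> q" for i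
  proof -
    have "i * b \<le> q * b" using that by (rule mult_right_mono) simp
    then have "xs ! j \<in> A" if "j < i * b" for j
      using that len nth_mem[of j xs] unfolding xs(1) by linarith
    then show ?thesis unfolding Pre_def by blast
  qed
  have "\<exists>i<q. f (Pre (Suc i)) - f (Pre i) \<le> f A / q"
  proof (rule ccontr)
    assume "\<not> ?thesis"
    then have "(\<Sum>i<q. f A / q) < (\<Sum>i<q. f (Pre (Suc i)) - f (Pre i))"
      using q by (intro sum_strict_mono) (auto simp: not_le)
    also have "\<dots> = f (Pre q) - f (Pre 0)" by (rule sum_lessThan_telescope)
    also have "\<dots> \<le> f A"
      using mono_le[OF PreA[of q] A] nonneg[OF subset_trans[OF PreA[of 0] A]] by simp
    finally show False using q by simp
  qed
  then obtain i where i: "i < q" "f (Pre (Suc i)) - f (Pre i) \<le> f A / q" by blast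
  define \<tau> where "\<tau> = w (xs ! (Suc i * b - 1))"
  have last: "Suc i * b - 1 < length xs" using idx[OF i(1)] b by simp
  have BlA: "Bl i \<subseteq> A" using PreBl[of i] PreA[of "Suc i"] i by auto
  have disj: "Pre i \<subseteq> A - Bl i"
  proof -
    have "xs ! j \<noteq> xs ! j'" if "j < i * b" "j' \<in> {i * b..<Suc i * b}" for j j'
      using that idx[OF i(1)] xs(2) by (subst nth_eq_iff_index_eq) auto
    then have "Pre i \<inter> Bl i = {}" unfolding Pre_def Bl_def by blast
    then show ?thesis using PreA[of i] i by auto
  qed
  have "f A - f (A - Bl i) \<le> f A / q"
    using deletion_le[OF BlA A disj] i(2) unfolding PreBl by linarith
  moreover have "card {e \<in> A - Bl i. \<tau> < w e} \<le> q * b"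
  proof -
    have "{e \<in> A - Bl i. \<tau> < w e} \<subseteq> Pre i"
    proof
      fix e assume e: "e \<in> {e \<in> A - Bl i. \<tau> < w e}"
      then obtain j where j: "j < length xs" "e = xs ! j" using xs(1) by (metis (no_types, lifting) DiffD1 in_set_conv_nth mem_Collect_eq)
      have "j < Suc i * b - 1" using decreasing[of "Suc i * b - 1" j] e j by (force simp: \<tau>_def not_less)
      moreover have "j \<notin> {i * b..<Suc i * b}" using e j by (auto simp: Bl_def)
      ultimately show "e \<in> Pre i" using j by (auto simp: Pre_def)
    qed
    then have "card {e \<in> A - Bl i. \<tau> < w e} \<le> card (Pre i)"
      by (intro card_mono) (auto simp: Pre_def)
    also have "\<dots> \<le> i * b" unfolding Pre_def using card_image_le[of "{..<i * b}" "(!) xs"] by simp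
    also have "\<dots> \<le> q * b" using i by (intro mult_right_mono) auto
    finally show ?thesis .
  qed
  moreover have "b * \<tau> \<le> sum w (Bl i)"
  proof -
    have "inj_on ((!) xs) {i * b..<Suc i * b}"
      using xs(2) idx[OF i(1)] by (intro inj_on_nth) auto
    then have "card (Bl i) = b" unfolding Bl_def by (simp add: card_image)
    moreover have "\<tau> \<le> w e" if "e \<in> Bl i" for e
      using that decreasing last by (auto simp: Bl_def \<tau>_def)
    ultimately show ?thesis using sum_bounded_below[of "Bl i" \<tau> w] by simp
  qed
  moreover have "sum w A = sum w (A - Bl i) + sum w (Bl i)"
    using sum.subset_diff[OF BlA finA] .
  moreover have "\<tau> \<in> w ` A" using last xs(1) by (auto simp: \<tau>_def)
  ultimately show ?thesis using w1 by (intro exI[of _ "A - Bl i"] exI[of _ \<tau>]) auto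
qed

text \<open>With \<open>z = 1 / (L + 1)\<close> one has \<open>L * z = 1 - z\<close>, so
  \<open>(1 - z) ^ L\<close> is at most \<open>exp z / exp 1\<close>. Then
  \<open>exp z \<le> 1 + 2 * z\<close> and \<open>2 \<le> exp 1\<close> bound the excess over
  \<open>1 / exp 1\<close> by \<open>z\<close>.\<close>

lemma one_minus_beta_le: "1 - beta L \<le> 1 / exp 1 + 1 / (real L + 1)"
proof -
  define z where "z = 1 / (real L + 1)"
  have z: "0 \<le> z" "z \<le> 1" by (auto simp: z_def)
  have q: "real L / (real L + 1) = 1 + - z" by (simp add: z_def field_simps)
  have "(1 + - z) ^ L \<le> exp (- z) ^ L"
    using exp_ge_add_one_self[of "- z"] z by (intro power_mono) auto
  also have "\<dots> = exp (- (1 - z))"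
  proof -
    have "real L * z = 1 - z" by (simp add: z_def field_simps)
    then show ?thesis by (simp flip: exp_of_nat_mult)
  qed
  also have "\<dots> = exp z / exp 1" by (simp add: exp_diff)
  also have "\<dots> \<le> (1 + 2 * z) / exp 1"
  proof (rule divide_right_mono)
    have "exp z \<le> 1 + z + z\<^sup>2" using z by (rule exp_bound)
    also have "z\<^sup>2 \<le> z" using z by (simp add: power2_eq_square mult_left_le)
    finally show "exp z \<le> 1 + 2 * z" by simp
  qed simp
  also have "\<dots> \<le> 1 / exp 1 + z"
  proof -
    have "2 \<le> exp (1 :: real)" using exp_ge_add_one_self[of 1] by simp
    then have "2 * z / exp 1 \<le> z" using mult_right_mono[of 2 "exp 1" z] z by (simp add: divide_le_eq mult.commute)
    then show ?thesis by (simp add: add_divide_distrib)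
  qed
  finally show ?thesis by (simp add: beta_def q z_def)
qed

context ram_setting
begin

section \<open>Choosing the guesses and accounting for the losses\<close>

lemma singleton_le_peak: "e < n \<Longrightarrow> set_value I {e} \<le> peak"
  unfolding peak_def by (intro Max_ge) auto

lemma peak_attained: "0 < peak \<Longrightarrow> \<exists>e<n. peak = set_value I {e}"
  using Max_in[of "insert 0 ((\<lambda>e. set_value I {e}) ` {..<n})"] by (auto simp: peak_def)

lemma good_trial:
  assumes opt: "A \<subseteq> {..<n}" "sum w A \<le> 1" "v = set_value I A"
    and best: "\<And>S. S \<subseteq> {..<n} \<Longrightarrow> sum w S \<le> 1 \<Longrightarrow> set_value I S \<le> v"
    and v: "0 < v" and w1: "\<And>e. e < n \<Longrightarrow> w e \<le> 1" and wn: "w n = 0" and n: "0 < n"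
  shows "\<exists>Y\<subseteq>A. v - set_value I Y \<le> v / (4 * N) \<and> (\<exists>S\<in>trials. sum w S \<le> 1 \<and>
    beta L * curved Y + sum tail Y - v / (4 * N) \<le> set_value I S)"
proof -
  have N: "0 < real N" "1 \<le> real N" using N_pos by auto
  have pos: "0 < 645 * (N * N)" "0 < 4 * N" using N_pos by simp_all
  \<comment> \<open>With \<open>4 * N\<close> blocks the deletion costs at most
    \<open>v / (4 * N)\<close>; \<open>645 * (N * N)\<close> elements of weight at least
    \<open>\<tau>\<close> make room for \<open>cap\<close>.\<close>
  obtain Y \<tau> where Y: "Y \<subseteq> A" and \<tau>: "\<tau> = 0 \<or> \<tau> \<in> w ` A"
    and drop: "set_value I A - set_value I Y \<le> set_value I A / real (4 * N)"
    and heavy: "card {e \<in> Y. \<tau> < w e} \<le> (4 * N) * (645 * (N * N))"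
    and slack: "sum w Y + real (645 * (N * N)) * \<tau> \<le> 1"
    using drop_block[OF opt(1) weight_nonneg opt(2) pos] by (elim exE conjE) (rule that)
  obtain u where u: "u \<le> n" "\<tau> = w u"
    using \<tau> wn opt(1) by (metis imageE in_mono lessThan_iff less_imp_le order_refl)
  have tau0: "0 \<le> \<tau>" using u weight_nonneg by simp
  have peak: "0 < peak" "peak \<le> v" "v \<le> n * peak"
  proof -
    show "v \<le> n * peak"
    proof (cases "A = {}")
      case True
      have "v \<le> set_value I {0}" using mono_le[of "{}" "{0}"] n opt(3) True by auto
      also have "\<dots> \<le> 1 * peak" using singleton_le_peak[OF n] by simp
      also have "\<dots> \<le> n * peak" using n peak_nonneg by (intro mult_right_mono) auto
      finally show ?thesis .
    next
      case False
      have "v \<le> (\<Sum>e\<in>A. set_value I {e})" using le_sum_singletons[OF opt(1) False] opt(3) by simp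
      also have "\<dots> \<le> card A * peak" using opt(1) singleton_le_peak by (intro sum_bounded_above) auto
      also have "\<dots> \<le> n * peak"
        using card_mono[OF _ opt(1)] peak_nonneg by (intro mult_right_mono) auto
      finally show ?thesis .
    qed
    then show "0 < peak" using v peak_nonneg by (cases "peak = 0") auto
    then obtain e where "e < n" "peak = set_value I {e}" using peak_attained by blast
    then show "peak \<le> v" using best[of "{e}"] w1 by auto
  qed
  \<comment> \<open>The least such \<open>i\<close> yields \<open>v' = 2 ^ i * peak\<close> with
    \<open>v' \<le> v < 2 * v'\<close>. The lower estimate comes from minimality, or from
    \<open>peak \<le> v\<close> when \<open>i = 0\<close>.\<close>
  have "\<exists>i. v < 2 ^ Suc i * peak"
  proof -
    obtain i where "v / peak < 2 ^ i" using real_arch_pow[of 2 "v / peak"] by auto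
    then have "v < 2 ^ i * peak" using peak by (simp add: divide_less_eq)
    also have "\<dots> \<le> 2 ^ Suc i * peak" using peak by (intro mult_right_mono) auto
    finally show ?thesis by blast
  qed
  then obtain i where i: "v < 2 ^ Suc i * peak" "\<And>j. j < i \<Longrightarrow> \<not> v < 2 ^ Suc j * peak"
    using exists_least_iff[of "\<lambda>i. v < 2 ^ Suc i * peak"] by blast
  define x where "x = (2 :: nat) ^ i"
  define v' where "v' = real x * peak"
  have v': "v' \<le> v" "v < 2 * v'"
  proof -
    show "v' \<le> v" using i(2)[of "i - 1"] peak(2) by (cases i) (auto simp: v'_def x_def not_less)
    show "v < 2 * v'" using i(1) by (simp add: v'_def x_def)
  qed
  have v'0: "0 < v'" using v' v by linarith
  have xn: "2 ^ i \<le> n"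
  proof -
    have "real x * peak \<le> n * peak" using v'(1) peak(3) by (simp add: v'_def)
    then have "real x \<le> real n" using peak(1) by (simp only: mult_le_cancel_right)
    then show ?thesis by (simp add: x_def)
  qed
  let ?light = "sum w {y \<in> Y. w y \<le> \<tau>}"
  \<comment> \<open>For \<open>\<tau> = 0\<close> the quotient is \<open>0\<close>, hence
    \<open>p = 0\<close>; the light elements then weigh nothing.\<close>
  define p where "p = nat \<lceil>?light / \<tau>\<rceil>"
  have finY: "finite Y" using finite_subset[OF subset_trans[OF Y opt(1)]] by simp
  have light0: "0 \<le> ?light" using weight_nonneg by (intro sum_nonneg) auto
  have p: "?light \<le> real p * \<tau>" "real p * \<tau> \<le> ?light + \<tau>" "p \<le> n"
  proof -
    have cardY: "card {y \<in> Y. w y \<le> \<tau>} \<le> n"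
      using card_mono[of "{..<n}" "{y \<in> Y. w y \<le> \<tau>}"] Y opt(1) by auto
    have "?light \<le> card {y \<in> Y. w y \<le> \<tau>} * \<tau>" by (rule sum_bounded_above) simp
    also have "\<dots> \<le> n * \<tau>" using cardY tau0 by (intro mult_right_mono) auto
    finally have bound: "?light \<le> n * \<tau>" .
    have ratio: "0 \<le> ?light / \<tau>" using light0 tau0 by simp
    have pc: "real p = of_int \<lceil>?light / \<tau>\<rceil>" using ratio by (simp add: p_def)
    show "?light \<le> real p * \<tau>"
    proof (cases "\<tau> = 0")
      case True
      then show ?thesis using bound by simp
    next
      case False
      have "?light / \<tau> \<le> real p" unfolding pc by (rule le_of_int_ceiling)
      then show ?thesis using False tau0 by (simp add: divide_le_eq)
    qed
    show "real p * \<tau> \<le> ?light + \<tau>"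
    proof (cases "\<tau> = 0")
      case True
      then show ?thesis using light0 by simp
    next
      case False
      have "real p \<le> ?light / \<tau> + 1" unfolding pc by (rule of_int_ceiling_le_add_one)
      then have "real p * \<tau> \<le> (?light / \<tau> + 1) * \<tau>" using tau0 by (rule mult_right_mono)
      then show ?thesis using False by (simp add: distrib_right)
    qed
    have "?light / \<tau> \<le> real n"
      using bound tau0 by (cases "\<tau> = 0") (auto simp: divide_le_eq)
    then show "p \<le> n" unfolding p_def by simp
  qed
  have NN: "1 \<le> N * N" using N_pos by (simp add: Suc_le_eq)
  have NNr: "1 \<le> real N * real N" using NN by (metis of_nat_1 of_nat_le_iff of_nat_mult)
  have B: "real B = 322 * (real N * real N)" "2 \<le> real B" "0 < real p + real B"
    using NNr by (auto simp: B_def)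
  let ?K = "slope x u p" and ?W = "width u p" and ?cap = "cap u p"
  have W: "?W = (real p + real B) * \<tau>" and cap: "?cap = (real p + 2 * real B) * \<tau>"
    by (simp_all add: width_def cap_def u(2) algebra_simps)
  have K: "?K = v' / (32 * (real N * ((real p + real B) * (\<tau> * \<tau>))))"
    by (simp add: slope_def v'_def u(2))
  have eta: "eta x = v' / (16 * (real N * real n))" and theta: "theta x = v' / (8 * (real N * real k))"
    by (simp_all add: eta_def theta_def v'_def)
  have kr: "0 < real k" using k_pos by simp
  have neta: "n * eta x = v' / (16 * N)" using n N by (simp add: eta)
  have ktheta: "k * theta x = v' / (8 * N)" using kr N by (simp add: theta)
  interpret s: ram_search n curved tail L w "w u" ?K ?W ?cap "eta x" "theta x" R k M I
    by (rule ram_search_instance) simp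
  interpret a: knapsack_analysis n curved tail L w "w u" ?K ?W ?cap "eta x" "theta x" R k M Y v "v / (4 * N)"
  proof
    show "Y \<subseteq> {..<n}" using Y opt(1) by blast
    show "0 \<le> w u" by (rule weight_nonneg)
    show "0 \<le> eta x" "0 \<le> theta x" using v'0 by (simp_all add: eta theta)
    show "0 < k" by (rule k_pos)
    show "card {y \<in> Y. w u < w y} \<le> k" using heavy by (simp add: u(2) k_def)
    have "real p * \<tau> \<le> ?W" unfolding W using tau0 by (intro mult_right_mono) auto
    then show "sum w {y \<in> Y. w y \<le> w u} \<le> ?W" using p(1) by (simp add: u(2))
    have "sum w Y = ?light + sum w {y \<in> Y. \<tau> < w y}"
      using finY by (subst sum.union_disjoint[symmetric]) (auto intro: sum.cong)
    moreover have "?cap \<le> ?light + real (645 * (N * N)) * \<tau>"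
    proof -
      have "?cap = real p * \<tau> + 2 * real B * \<tau>" by (simp add: cap algebra_simps)
      also have "\<dots> \<le> ?light + (1 + 2 * real B) * \<tau>" using p(2) by (simp add: algebra_simps)
      \<comment> \<open>The summand \<open>1\<close> pays for rounding \<open>p\<close> up.\<close>
      also have "(1 + 2 * real B) * \<tau> \<le> real (645 * (N * N)) * \<tau>"
        using NNr tau0 by (intro mult_right_mono) (auto simp: B(1))
      finally show ?thesis by simp
    qed
    ultimately show "sum w {y \<in> Y. w u < w y} + ?cap \<le> 1" using slack by (simp add: u(2))
    have "2 * \<tau> \<le> real B * \<tau>" using B(2) tau0 by (intro mult_right_mono) auto
    then show "?W + 2 * w u \<le> ?cap" unfolding W cap u(2)[symmetric] by (simp add: algebra_simps)
    show "curved S + sum tail S \<le> v" if "S \<subseteq> {..<n}" "sum w S \<le> 1" for S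
      using best[OF that] by (simp add: curved_def)
    have "?K * \<tau> / 2 * (?W + ?cap) \<le> 3 * v' / (64 * N)"
    proof (cases "\<tau> = 0")
      case True
      then show ?thesis using v'0 by simp
    next
      case False
      have "?K * \<tau> / 2 * (?W + ?cap) = v' / (64 * N) * ((2 * real p + 3 * real B) / (real p + real B))"
      proof -
        have "v' / (32 * (N * (D * (\<tau> * \<tau>)))) * \<tau> / 2 * (D * \<tau> + C * \<tau>) = v' / (64 * N) * ((D + C) / D)"
          if "D \<noteq> 0" for C D :: real
          using that False N by (simp add: field_simps)
        from this[of "real p + real B" "real p + 2 * real B"] show ?thesis
          using B(3) unfolding K W cap by (simp add: algebra_simps)
      qed
      also have "\<dots> \<le> v' / (64 * N) * 3"
        using v'0 N B(3) by (intro mult_left_mono) (auto simp: divide_le_eq)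
      finally show ?thesis by simp
    qed
    then have "n * eta x + k * theta x + ?K * \<tau> / 2 * (?W + ?cap) \<le> v' / (16 * N) + v' / (8 * N) + 3 * v' / (64 * N)"
      using neta ktheta by linarith
    also have "\<dots> = 15 / 16 * (v' / (4 * N))" by (simp add: field_simps)
    also have "\<dots> \<le> 1 * (v / (4 * N))"
      using v' v'0 N by (intro mult_mono divide_right_mono) auto
    finally show "n * eta x + k * theta x + ?K * w u / 2 * (?W + ?cap) \<le> v / (4 * N)" by (simp add: u(2))
    have Lv: "real L * v < 8 * N * v'" using v'(2) N by simp
    also have "8 * N * v' = 128 * (real n * (real N * real N)) * eta x" using n N by (simp add: eta field_simps)
    also have "\<dots> \<le> R * eta x"
      using v'0 by (intro mult_right_mono) (auto simp: R_def eta)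
    finally show "real L * v < R * eta x" .
    have "8 * N * v' = 64 * (real k * (real N * real N)) * theta x" using kr N by (simp add: theta field_simps)
    also have "\<dots> \<le> M * theta x"
      using v'0 by (intro mult_right_mono) (auto simp: M_def theta)
    finally have "8 * N * v' \<le> M * theta x" .
    with Lv show "real L * v < M * theta x" by (rule less_le_trans)
    show "n * eta x + real L * v < ?K * (?cap - ?W - 3 / 2 * w u) * ?W" if "0 < w u"
    proof -
      have t: "\<tau> \<noteq> 0" using that u(2) by simp
      have "v' / (16 * N) \<le> v'" using v'0 N by (simp add: divide_le_eq)
      then have "n * eta x \<le> v'" by (simp only: neta)
      moreover have "real L * v < 8 * (N * v')" using Lv by (simp add: mult.assoc)
      moreover have "v' * 1 \<le> N * v'" using v'0 N by (simp add: mult.commute)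
      ultimately have "n * eta x + real L * v < 10 * (N * v')" using v'0 by linarith
      then have "n * eta x + real L * v < 10 * N * v'" by (simp add: mult.assoc)
      \<comment> \<open>Cleared of denominators this is \<open>320 * N * N \<le> B - 3 / 2\<close>,
        which is where the factor \<open>322\<close> in \<open>B\<close> comes from.\<close>
      also have "10 * N * v' \<le> v' * (real B - 3 / 2) / (32 * N)"
      proof -
        have "320 * (real N * real N) \<le> real B - 3 / 2" using NNr by (simp add: B(1))
        then have "v' * (320 * (real N * real N)) \<le> v' * (real B - 3 / 2)"
          using v'0 by (intro mult_left_mono) auto
        then show ?thesis using N by (simp add: pos_le_divide_eq algebra_simps)
      qed
      also have "v' * (real B - 3 / 2) / (32 * N) = ?K * ((real B - 3 / 2) * \<tau>) * ?W"
      proof -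
        have "v' * C / (32 * N) = v' / (32 * (N * (D * (\<tau> * \<tau>)))) * (C * \<tau>) * (D * \<tau>)"
          if "D \<noteq> 0" for C D :: real
          using that t N by (simp add: field_simps)
        then show ?thesis unfolding K W using B(3) by simp
      qed
      also have "(real B - 3 / 2) * \<tau> = ?cap - ?W - 3 / 2 * w u"
        unfolding W cap u(2)[symmetric] by (simp add: algebra_simps)
      finally show ?thesis .
    qed
  qed
  obtain c t where ct: "c < k ^ M" "t < M" "sum w (s.support (s.candidate c t)) \<le> 1"
    "beta L * curved Y + sum tail Y - v / (4 * N)
      \<le> curved (s.support (s.candidate c t)) + sum tail (s.support (s.candidate c t))"
    using a.good_candidate by auto
  have "s.support (s.candidate c t) \<in> trial x u p c"
    unfolding trial_def using ct(2) by blast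
  then have "s.support (s.candidate c t) \<in> trials"
    unfolding trials_def using xn u(1) p(3) ct(1) x_def by blast
  moreover have "beta L * curved Y + sum tail Y - v / (4 * N) \<le> set_value I (s.support (s.candidate c t))"
    using ct(4) by (simp add: curved_def)
  ultimately show ?thesis using Y drop ct(3) opt(3) by auto
qed

text \<open>There are three losses of \<open>\<delta> * v\<close> with
  \<open>\<delta> = 1 / (4 * N)\<close>: the deleted block, the errors of the search, and the gap
  between \<open>1 - beta L\<close> and \<open>1 / exp 1\<close>. The curvature enters because the
  modular part of \<open>Y\<close> is at least \<open>(1 - c)\<close> times its value, so only a
  fraction \<open>(1 - beta L) * c\<close> of the value is lost.\<close>

lemma guarantee:
  assumes out: "improves I trials {} S" "S \<subseteq> {..<n}"
    and opt: "A \<subseteq> {..<n}" "sum w A \<le> 1" "v = set_value I A"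
    and best: "\<And>S. S \<subseteq> {..<n} \<Longrightarrow> sum w S \<le> 1 \<Longrightarrow> set_value I S \<le> v"
    and w1: "\<And>e. e < n \<Longrightarrow> w e \<le> 1" and wn: "w n = 0" and n: "0 < n"
    and c: "0 \<le> c" "c \<le> 1" "\<And>e. e < n \<Longrightarrow> (1 - c) * set_value I {e} \<le> tail e"
    and \<epsilon>: "1 \<le> real N * \<epsilon>"
  shows "(1 - c / exp 1 - \<epsilon>) * v \<le> set_value I S"
proof -
  have v0: "0 \<le> v" using nonneg[OF opt(1)] opt(3) by simp
  have Nr: "0 < real N" using N_pos by simp
  have eps: "1 / real N \<le> \<epsilon>" using \<epsilon> Nr by (simp add: divide_le_eq mult.commute)
  define \<delta> where "\<delta> = 1 / (4 * real N)"
  have \<delta>: "0 \<le> \<delta>" "4 * \<delta> \<le> \<epsilon>" using Nr eps by (simp_all add: \<delta>_def)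
  have empty: "set_value I {} \<le> set_value I S" using mono_le[of "{}" S] out(2) by auto
  show ?thesis
  proof (cases "v = 0")
    case True
    then show ?thesis using nonneg[OF out(2)] by simp
  next
    case False
    then have v: "0 < v" using v0 by simp
    obtain Y S' where Y: "Y \<subseteq> A" "v - set_value I Y \<le> \<delta> * v" and S': "S' \<in> trials" "sum w S' \<le> 1"
      "beta L * curved Y + sum tail Y - \<delta> * v \<le> set_value I S'"
      using good_trial[OF opt best v w1 wn n] by (auto simp: \<delta>_def)
    have le: "set_value I S' \<le> set_value I S" using out(1) S' by (auto simp: improves_def)
    show ?thesis
    \<comment> \<open>\<open>le_sum_singletons\<close> requires a nonempty set. If everything was
      deleted, the empty set itself is already within \<open>\<delta> * v\<close> of the
      optimum.\<close>
    proof (cases "Y = {}")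
      case True
      have "(1 - c / exp 1 - \<epsilon>) * v \<le> (1 - \<delta>) * v"
      proof (rule mult_right_mono)
        have "0 \<le> c / exp 1" using c(1) by simp
        then show "1 - c / exp 1 - \<epsilon> \<le> 1 - \<delta>" using \<delta> by linarith
      qed (rule v0)
      also have "\<dots> \<le> set_value I {}" using Y(2) True by (simp add: algebra_simps)
      finally show ?thesis using empty by simp
    next
      case False
      let ?F = "set_value I Y" and ?\<gamma> = "1 - beta L"
      have Yn: "Y \<subseteq> {..<n}" using Y opt(1) by blast
      have \<gamma>: "0 \<le> ?\<gamma>" "?\<gamma> \<le> 1 / exp 1 + \<delta>"
      proof -
        show "0 \<le> ?\<gamma>" using beta_le_1[of L] by simp
        have "1 / (real L + 1) \<le> \<delta>" using Nr by (simp add: \<delta>_def frac_le)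
        then show "?\<gamma> \<le> 1 / exp 1 + \<delta>" using one_minus_beta_le[of L] by linarith
      qed
      have F: "0 \<le> ?F" using nonneg[OF Yn] .
      have "(1 - c) * ?F \<le> (1 - c) * (\<Sum>e\<in>Y. set_value I {e})"
        using le_sum_singletons[OF Yn False] c(2) by (intro mult_left_mono) auto
      also have "\<dots> \<le> sum tail Y" unfolding sum_distrib_left using c(3) Yn by (intro sum_mono) auto
      finally have tail: "(1 - c) * ?F \<le> sum tail Y" .
      have "beta L * curved Y + sum tail Y = beta L * ?F + ?\<gamma> * sum tail Y"
        by (simp add: curved_def algebra_simps)
      moreover have "?\<gamma> * ((1 - c) * ?F) \<le> ?\<gamma> * sum tail Y" using tail \<gamma>(1) by (rule mult_left_mono)
      ultimately have lower: "(1 - ?\<gamma> * c) * ?F \<le> beta L * curved Y + sum tail Y"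
        by (simp add: algebra_simps)
      have "?\<gamma> * c \<le> (1 / exp 1 + \<delta>) * c" using \<gamma>(2) c(1) by (rule mult_right_mono)
      also have "\<dots> \<le> c / exp 1 + \<delta>" using c \<delta> by (simp add: distrib_right mult_left_le)
      finally have "(1 - (c / exp 1 + \<delta>)) * ?F \<le> (1 - ?\<gamma> * c) * ?F" using F by (intro mult_right_mono) auto
      then have "(1 - c / exp 1 - \<delta>) * ?F - \<delta> * v \<le> set_value I S" using lower S'(3) le by (simp add: algebra_simps)
      \<comment> \<open>The case split on the sign of the factor avoids a numerical estimate
        here.\<close>
      moreover have "(1 - c / exp 1 - \<delta>) * v - \<delta> * v \<le> (1 - c / exp 1 - \<delta>) * ?F"
      proof (cases "0 \<le> 1 - c / exp 1 - \<delta>")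
        case True
        have le1: "1 - c / exp 1 - \<delta> \<le> 1"
          using divide_nonneg_nonneg[OF c(1), of "exp 1"] \<delta>(1) by simp
        have "(1 - c / exp 1 - \<delta>) * (v - ?F) \<le> (1 - c / exp 1 - \<delta>) * (\<delta> * v)"
          using Y(2) True by (rule mult_left_mono)
        also have "\<dots> \<le> 1 * (\<delta> * v)" using le1 \<delta>(1) v0 by (intro mult_right_mono) auto
        finally have "(1 - c / exp 1 - \<delta>) * (v - ?F) \<le> 1 * (\<delta> * v)" .
        then show ?thesis by (simp add: algebra_simps)
      next
        case False
        have "?F \<le> v" using mono_le[OF Y(1) opt(1)] opt(3) by simp
        then have "(1 - c / exp 1 - \<delta>) * v \<le> (1 - c / exp 1 - \<delta>) * ?F"
          using False by (intro mult_left_mono_neg) auto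
        then show ?thesis using mult_nonneg_nonneg[OF \<delta>(1) v0] by linarith
      qed
      moreover have "(1 - c / exp 1 - \<epsilon>) * v \<le> (1 - c / exp 1 - \<delta>) * v - \<delta> * v - \<delta> * v"
        using mult_right_mono[OF \<delta>(2) v0] mult_nonneg_nonneg[OF \<delta>(1) v0] by (simp add: algebra_simps)
      ultimately show ?thesis by linarith
    qed
  qed
qed

end

section \<open>The running time\<close>

text \<open>\<open>Z\<close> will be \<open>k ^ M\<close>, which dominates every quantity depending
  on \<open>N\<close> alone. One factor \<open>n\<close> comes from a sweep over the elements and
  one from the number \<open>R\<close> of sweeps.\<close>

lemma run_time_arith:
  fixes n Z P L k M C R :: nat
  assumes n: "1 \<le> n" and Z: "1 \<le> Z" and le: "P \<le> Z" "L \<le> Z" "k \<le> Z" "M \<le> Z" "C \<le> Z" "R \<le> n * Z"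
  shows "n * ((8 * P + 40) + 10) + 4 * k + 30 +
    M * (((6 * P + 20) + R * (n * ((L + 1) * (2 * (8 * P + 40) + (6 * P + 20) + 18) + 10) + 6) + 10
      + (14 * n + 20) + (4 * C + 10)
      + (2 * (8 * P + 40) + (n * (L * (2 * (8 * P + 40) + (6 * P + 20) + 18) + 10) + 10) + 20) + 10) + 3)
    \<le> 800 * (n ^ 2 * Z ^ 4)"
proof -
  define a where "a = n * n * (Z * Z * Z)"
  define b where "b = n * (Z * Z)"
  have b: "1 \<le> b" "n \<le> b" "Z \<le> b" "b \<le> a" "n * Z \<le> b"
  proof -
    have zz: "1 \<le> Z * Z" "Z \<le> Z * Z" using Z by auto
    have "1 * 1 \<le> n * (Z * Z)" using n zz(1) by (rule mult_le_mono)
    then show "1 \<le> b" by (simp add: b_def)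
    have "n * 1 \<le> n * (Z * Z)" using zz(1) by (intro mult_le_mono) auto
    then show "n \<le> b" by (simp add: b_def)
    have "1 * Z \<le> n * (Z * Z)" using n zz(2) by (rule mult_le_mono)
    then show "Z \<le> b" by (simp add: b_def)
    show "n * Z \<le> b" using zz(2) by (simp add: b_def)
    have "1 * 1 \<le> n * Z" using n Z by (rule mult_le_mono)
    then have "b * 1 \<le> b * (n * Z)" by (intro mult_le_mono) auto
    then show "b \<le> a" by (simp add: a_def b_def algebra_simps)
  qed
  have P140: "2 * (8 * P + 40) + (6 * P + 20) + 18 \<le> 140 * Z" using le(1) Z by simp
  have c1: "(L + 1) * (2 * (8 * P + 40) + (6 * P + 20) + 18) \<le> (2 * Z) * (140 * Z)"
    using le(2) Z by (intro mult_le_mono P140) simp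
  have c2: "L * (2 * (8 * P + 40) + (6 * P + 20) + 18) \<le> Z * (140 * Z)"
    by (intro mult_le_mono P140 le(2))
  have d1: "n * ((L + 1) * (2 * (8 * P + 40) + (6 * P + 20) + 18) + 10) \<le> 280 * b + 10 * n"
    using mult_le_mono2[OF c1, of n] by (simp add: b_def algebra_simps)
  have d2: "n * (L * (2 * (8 * P + 40) + (6 * P + 20) + 18) + 10) \<le> 140 * b + 10 * n"
    using mult_le_mono2[OF c2, of n] by (simp add: b_def algebra_simps)
  have e: "R * (n * ((L + 1) * (2 * (8 * P + 40) + (6 * P + 20) + 18) + 10) + 6) \<le> (n * Z) * (296 * b)"
    using d1 b by (intro mult_le_mono le(6)) linarith
  have "(n * Z) * (296 * b) = 296 * a" by (simp add: a_def b_def algebra_simps)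
  with e have e': "R * (n * ((L + 1) * (2 * (8 * P + 40) + (6 * P + 20) + 18) + 10) + 6) \<le> 296 * a" by simp
  have sum: "((6 * P + 20) + X + 10 + (14 * n + 20) + (4 * C + 10) + (2 * (8 * P + 40) + (Y + 10) + 20) + 10) + 3 \<le> 669 * a"
    if "X \<le> 296 * a" "Y \<le> 140 * b + 10 * n" for X Y
    using that b le(1,5) by simp
  have "M * (((6 * P + 20) + R * (n * ((L + 1) * (2 * (8 * P + 40) + (6 * P + 20) + 18) + 10) + 6) + 10
      + (14 * n + 20) + (4 * C + 10)
      + (2 * (8 * P + 40) + (n * (L * (2 * (8 * P + 40) + (6 * P + 20) + 18) + 10) + 10) + 20) + 10) + 3)
    \<le> Z * (669 * a)" (is "?lhs \<le> _")
    by (rule mult_le_mono[OF le(4) sum[OF e' d2]])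
  moreover have "n * ((8 * P + 40) + 10) \<le> n * (58 * Z)" using le Z by (intro mult_le_mono) linarith+
  moreover have "n * (58 * Z) \<le> 58 * a" using b by linarith
  moreover have "a \<le> Z * a" using Z by simp
  ultimately have "n * ((8 * P + 40) + 10) + 4 * k + 30 + ?lhs \<le> 800 * (Z * a)"
    using b le by linarith
  moreover have "n ^ 2 * Z ^ 4 = Z * a" by (simp add: a_def eval_nat_numeral algebra_simps)
  ultimately show ?thesis by simp
qed

text \<open>The loops over thresholds and widths contribute two further factors \<open>n\<close>,
  and the loop over codes a further factor \<open>Z\<close>. The scales add a logarithmic factor in
  \<open>total_time_bound\<close>.\<close>

lemma search_time_arith:
  fixes n Z C run :: nat
  assumes n: "1 \<le> n" and Z: "1 \<le> Z" and C: "C \<le> Z" and run: "run \<le> 800 * (n ^ 2 * Z ^ 4)"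
  shows "(n + 1) * ((n + 1) * (C * (run + 3) + 3 + 9) + 3 + 5) + 3 \<le> 3279 * (n ^ 4 * Z ^ 5)"
proof -
  define a where "a = n ^ 2 * Z ^ 4"
  have a: "1 \<le> a" using n Z by (simp add: a_def)
  have "C * (run + 3) \<le> Z * (803 * a)" using C run a unfolding a_def by (intro mult_le_mono) linarith+
  moreover have za: "1 \<le> Z * a" using a Z by simp
  ultimately have "(n + 1) * (C * (run + 3) + 3 + 9) \<le> (2 * n) * (815 * (Z * a))"
    using n by (intro mult_le_mono) linarith+
  moreover have nza: "1 \<le> n * (Z * a)" using n za by simp
  ultimately have "(n + 1) * ((n + 1) * (C * (run + 3) + 3 + 9) + 3 + 5) \<le> (2 * n) * (1638 * (n * (Z * a)))"
    using n by (intro mult_le_mono) linarith+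
  moreover have "1 \<le> n * (n * (Z * a))" using n nza by simp
  ultimately have "(n + 1) * ((n + 1) * (C * (run + 3) + 3 + 9) + 3 + 5) + 3 \<le> 3279 * (n * (n * (Z * a)))"
    by linarith
  also have "n * (n * (Z * a)) = n ^ 4 * Z ^ 5" by (simp add: a_def eval_nat_numeral algebra_simps)
  finally show ?thesis .
qed

context ram_setting
begin

lemma total_time_bound:
  assumes n: "1 \<le> n"
  shows "total_time \<le> 40000 * (n ^ 4 * (k ^ M) ^ 5 * scale_bound)"
proof -
  define Z where "Z = k ^ M"
  have N1: "1 \<le> N" using N_pos by simp
  have Nsq: "N \<le> N * N" "1 \<le> N * N" using N1 by auto
  have k1: "N * N \<le> k" "2 \<le> k"
  proof -
    have "N * N * 1 \<le> N * N * N" using N1 by (intro mult_le_mono) auto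
    then show "N * N \<le> k" by (simp add: k_def)
    have "1 * 1 \<le> N * N * N" using Nsq(2) N1 by (rule mult_le_mono)
    then show "2 \<le> k" by (simp add: k_def)
  qed
  have kM: "64 * k \<le> M"
    using mult_le_mono2[OF Nsq(2), of k] unfolding M_def nat_mult_1_right by linarith
  have M1: "1 \<le> M" by (simp add: M_def)
  have Z: "1 \<le> Z" using k1 by (simp add: Z_def)
  have kZ: "k \<le> Z" using self_le_power[of k M] k1 M1 by (simp add: Z_def)
  have powM: "2 ^ j \<le> Z" if "j \<le> M" for j :: nat
  proof -
    have "(2 :: nat) ^ j \<le> 2 ^ M" using that by (rule power_increasing) simp
    also have "\<dots> \<le> k ^ M" using k1(2) by (rule power_mono) simp
    finally show ?thesis by (simp add: Z_def)
  qed
  have MZ: "M \<le> Z" by (rule order_trans[OF less_imp_le[OF less_exp] powM]) simp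
  have LM: "L \<le> M" using Nsq k1 kM by linarith
  have PZ: "2 ^ L \<le> Z" using LM by (rule powM)
  have LZ: "L \<le> Z" using LM MZ by simp
  have NNZ: "N * N \<le> Z" "N \<le> Z" using k1 kZ Nsq by linarith+
  have RZ: "R \<le> n * Z"
  proof -
    have "64 * (2 * (N * N)) \<le> 64 * (k * (N * N))"
      using k1(2) by (intro mult_le_mono) auto
    then have "1 + 128 * (N * N) \<le> Z" using MZ unfolding M_def by linarith
    then have "n * (1 + 128 * (N * N)) \<le> n * Z" by (rule mult_le_mono2)
    then show ?thesis using n by (simp add: R_def algebra_simps)
  qed
  have thr: "thresholds_time \<le> 3279 * (n ^ 4 * Z ^ 5)"
    by (rule search_time_arith[OF n Z _ run_time_arith[OF n Z PZ LZ kZ MZ _ RZ]]) (simp_all add: Z_def)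
  define a where "a = n ^ 4 * Z ^ 5"
  have a: "1 \<le> a" using n Z by (simp add: a_def)
  have sb: "1 \<le> scale_bound" by (simp add: scale_bound_def)
  have search: "scale_bound * (t + 9) \<le> 3288 * (a * scale_bound)" if "t \<le> 3279 * (n ^ 4 * Z ^ 5)" for t
  proof -
    have "t + 9 \<le> 3288 * a" using that a unfolding a_def by linarith
    then have "scale_bound * (t + 9) \<le> scale_bound * (3288 * a)" by (rule mult_le_mono2)
    then show ?thesis by (simp add: algebra_simps)
  qed
  have aZ: "Z * Z * Z \<le> a" "Z * Z \<le> a" "Z \<le> a" "n \<le> a"
  proof -
    have p: "Z ^ i \<le> a" if "i \<le> 5" for i
    proof -
      have "1 * Z ^ i \<le> n ^ 4 * Z ^ 5" using n Z that by (intro mult_le_mono power_increasing) auto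
      then show ?thesis by (simp add: a_def)
    qed
    show "Z * Z * Z \<le> a" "Z * Z \<le> a" "Z \<le> a"
      using p[of 3] p[of 2] p[of 1] by (simp_all add: eval_nat_numeral algebra_simps)
    have "n ^ 1 * 1 \<le> n ^ 4 * Z ^ 5" using n Z by (intro mult_le_mono power_increasing) auto
    then show "n \<le> a" by (simp add: a_def)
  qed
  have pow: "M * (4 * k + 20) \<le> 24 * (Z * Z)"
  proof -
    have "M * (4 * k + 20) \<le> Z * (24 * Z)" using MZ kZ Z by (intro mult_le_mono) linarith+
    then show ?thesis by simp
  qed
  have table: "2 ^ L * (L * (4 * 2 ^ L + 20) + 20) \<le> 44 * (Z * Z * Z)"
  proof -
    have "L * (4 * 2 ^ L + 20) \<le> Z * (24 * Z)" using LZ PZ Z by (intro mult_le_mono) linarith+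
    moreover have "1 \<le> Z * Z" using Z by simp
    ultimately have "2 ^ L * (L * (4 * 2 ^ L + 20) + 20) \<le> Z * (44 * (Z * Z))"
      by (intro mult_le_mono PZ) linarith
    then show ?thesis by (simp add: mult.assoc)
  qed
  have "a * 1 \<le> a * scale_bound" using sb by (rule mult_le_mono2)
  then have asb: "a \<le> a * scale_bound" by simp
  have total: "(2 * N + 3) + number_time + (4 * L + x + 20) + (10 * L + 20) + (y + 20) + (14 * n + 10) +
      (12 * n + 10) + (z + 5) + 10 \<le> 40000 * (a * scale_bound)"
    if "x \<le> 24 * (Z * Z)" "y \<le> 44 * (Z * Z * Z)" "z \<le> 3288 * (a * scale_bound)" for x y z
    using that asb aZ NNZ kZ LZ a by linarith
  have "total_time \<le> 40000 * (a * scale_bound)"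
    by (rule total[OF pow table search[OF thr]])
  then show ?thesis by (simp add: a_def Z_def)
qed

lemma scale_bound_le:
  assumes "1 \<le> n"
  shows "real scale_bound \<le> 1 + 2 * ln (real n)"
proof -
  have l: "0 \<le> log 2 (real n)" using assms by simp
  have half: "1 / 2 \<le> ln (2 :: real)"
    using ln_ge_iff[of 2 "1 / 2"] exp_bound[of "1 / 2"] by (simp add: power2_eq_square)
  have "real scale_bound \<le> log 2 (real n) + 1"
    using of_int_floor_le[of "log 2 (real n)"] l by (simp add: scale_bound_def)
  also have "log 2 (real n) \<le> 2 * ln (real n)"
  proof -
    have "ln (real n) * 1 \<le> ln (real n) * (2 * ln 2)"
      using half assms by (intro mult_left_mono) auto
    then show ?thesis using half by (simp add: log_def divide_le_eq algebra_simps)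
  qed
  finally show ?thesis by simp
qed

text \<open>\<open>k\<close> is of order \<open>N ^ 3\<close> and \<open>M\<close> of order
  \<open>N ^ 5\<close>. The crude bound \<open>k \<le> 2 ^ k\<close> turns the count into a power of
  two whose exponent is of order \<open>N ^ 8\<close>.\<close>

lemma guess_count_le: "(k ^ M) ^ 5 \<le> 2 ^ (2200000000 * N ^ 8)"
proof -
  have N1: "1 \<le> N" using N_pos by simp
  have "M \<le> 165121 * N ^ 5"
  proof -
    have "N ^ 5 = N * N * N * (N * N)" by (simp add: eval_nat_numeral)
    then have "64 * (k * (N * N)) = 165120 * N ^ 5" unfolding k_def by simp
    moreover have "1 \<le> N ^ 5" using N1 by simp
    ultimately show ?thesis unfolding M_def by linarith
  qed
  then have "k * M * 5 \<le> (2580 * (N * N) * N) * (165121 * N ^ 5) * 5"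
    unfolding k_def by (intro mult_le_mono) auto
  also have "\<dots> = 2130060900 * N ^ 8"
  proof -
    have "N ^ 8 = N * N * N * N ^ 5" by (simp add: eval_nat_numeral)
    then show ?thesis by simp
  qed
  also have "\<dots> \<le> 2200000000 * N ^ 8" by simp
  finally have kM: "k * M * 5 \<le> 2200000000 * N ^ 8" .
  have "k \<le> 2 ^ k" using less_exp[of k] by simp
  then have "(k ^ M) ^ 5 \<le> ((2 ^ k) ^ M) ^ 5" by (intro power_mono) auto
  also have "\<dots> = 2 ^ (k * M * 5)" by (simp only: power_mult)
  also have "\<dots> \<le> 2 ^ (2200000000 * N ^ 8)" using kM by (rule power_increasing) simp
  finally show ?thesis .
qed

end

text \<open>
  Since \<open>N < 1 / \<epsilon> + 1\<close>, a power of two suffices as base once \<open>1 / \<epsilon>\<close> is at least \<open>2\<close>; otherwise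
  \<open>N \<le> 2\<close>, and the constant in front absorbs the count.
\<close>

lemma guess_count_powr:
  fixes \<epsilon> :: real and N h :: nat
  assumes \<epsilon>: "0 < \<epsilon>" "\<epsilon> < 1" and least: "\<And>m. 0 < m \<Longrightarrow> m < N \<Longrightarrow> real m * \<epsilon> < 1"
  shows "real (2 ^ (h * N ^ 8)) \<le> 2 ^ (256 * h) * (1 / \<epsilon>) powr (256 * h * (1 / \<epsilon>) ^ 8)"
proof -
  define y where "y = 1 / \<epsilon>"
  have y: "1 < y" using \<epsilon> by (simp add: y_def)
  have N: "real m < y" if "0 < m" "m < N" for m
    using least[OF that] \<epsilon> by (simp add: y_def less_divide_eq)
  have p0: "1 \<le> y powr (256 * h * y ^ 8)" using y by (intro ge_one_powr_ge_zero) auto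
  have "real (2 ^ (h * N ^ 8)) \<le> 2 ^ (256 * h) * y powr (256 * h * y ^ 8)"
  proof (cases "y < 2")
    case True
    have "N \<le> 2" using N[of 2] True by (cases "2 < N") auto
    then have "h * N ^ 8 \<le> h * 2 ^ 8" by (intro mult_le_mono power_mono) auto
    then have "(2 :: real) ^ (h * N ^ 8) \<le> 2 ^ (256 * h)" by (intro power_increasing) auto
    also have "\<dots> * 1 \<le> 2 ^ (256 * h) * y powr (256 * h * y ^ 8)" using p0 by (intro mult_left_mono) auto
    finally show ?thesis by simp
  next
    case False
    have "real N \<le> 2 * y"
    proof (cases "N \<le> 1")
      case True
      then show ?thesis using y by linarith
    next
      case False
      then have "real (N - 1) < y" by (intro N) auto
      then show ?thesis using y by linarith
    qed
    then have "real N ^ 8 \<le> (2 * y) ^ 8" by (rule power_mono) simp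
    then have "real h * real N ^ 8 \<le> real h * (256 * y ^ 8)" by (intro mult_left_mono) (auto simp: power_mult_distrib)
    then have e: "real (h * N ^ 8) \<le> 256 * h * y ^ 8" by simp
    have "real (2 ^ (h * N ^ 8)) = 2 powr real (h * N ^ 8)" by (subst powr_realpow) auto
    also have "\<dots> \<le> y powr real (h * N ^ 8)" using False by (intro powr_mono2) auto
    also have "\<dots> \<le> y powr (256 * h * y ^ 8)" using e y by (intro powr_mono) auto
    also have "\<dots> \<le> 2 ^ (256 * h) * y powr (256 * h * y ^ 8)"
    proof -
      have "1 * y powr (256 * h * y ^ 8) \<le> 2 ^ (256 * h) * y powr (256 * h * y ^ 8)"
        by (rule mult_right_mono) simp_all
      then show ?thesis by simp
    qed
    finally show ?thesis .
  qed
  then show ?thesis by (simp add: y_def)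
qed

section \<open>The theorem\<close>

lemma (in monotone_submodular) curvature_bounds:
  shows "0 \<le> curvature E f" "curvature E f \<le> 1"
    and "e \<in> E \<Longrightarrow> (1 - curvature E f) * f {e} \<le> f E - f (E - {e})"
proof -
  define E' where "E' = {e \<in> E. f {e} \<noteq> 0}"
  define \<rho> where "\<rho> e = marginal f (E - {e}) {e} / f {e}" for e
  have gain: "marginal f (E - {e}) {e} = f E - f (E - {e})" "0 \<le> f E - f (E - {e})"
    "f E - f (E - {e}) \<le> f {e}" if "e \<in> E" for e
  proof -
    have E: "E - {e} \<union> {e} = E" "(E - {e}) \<inter> {e} = {}" using that by auto
    show "marginal f (E - {e}) {e} = f E - f (E - {e})" unfolding marginal_def E(1) ..
    show "0 \<le> f E - f (E - {e})" using mono_le[of "E - {e}" E] by auto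
    show "f E - f (E - {e}) \<le> f {e}"
      using submodD[of "E - {e}" "{e}"] nonneg[of "{}"] that unfolding E by auto
  qed
  have fin: "finite E'" using finite_ground by (simp add: E'_def)
  have pos: "0 < f {e}" if "e \<in> E'" for e
    using that nonneg[of "{e}"] by (auto simp: E'_def order_less_le)
  have \<rho>: "0 \<le> \<rho> e" "\<rho> e \<le> 1" "\<rho> e * f {e} = f E - f (E - {e})" if "e \<in> E'" for e
    using gain[of e] pos[OF that] that by (auto simp: \<rho>_def E'_def divide_le_eq)
  have c: "curvature E f = (if E' = {} then 0 else 1 - Min (\<rho> ` E'))"
    unfolding curvature_def E'_def[symmetric] \<rho>_def by (simp add: Let_def)
  have range: "0 \<le> curvature E f \<and> curvature E f \<le> 1"
  proof (cases "E' = {}")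
    case False
    then have "Min (\<rho> ` E') \<in> \<rho> ` E'" using fin by (intro Min_in) auto
    then show ?thesis using \<rho> False by (auto simp: c)
  qed (simp add: c)
  then show "0 \<le> curvature E f" "curvature E f \<le> 1" by auto
  assume e: "e \<in> E"
  show "(1 - curvature E f) * f {e} \<le> f E - f (E - {e})"
  proof (cases "e \<in> E'")
    case True
    then have "Min (\<rho> ` E') \<le> \<rho> e" using fin by (intro Min_le) auto
    then have "(1 - curvature E f) * f {e} \<le> \<rho> e * f {e}"
      using True pos[OF True] by (intro mult_right_mono) (auto simp: c)
    then show ?thesis using \<rho>(3)[OF True] by simp
  next
    case False
    \<comment> \<open>Elements with \<open>f {e} = 0\<close> are left out of the minimum; for them
      the left side is \<open>0\<close>.\<close>
    then show ?thesis using e gain(2)[OF e] by (simp add: E'_def)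
  qed
qed

lemma monotone_submodular_reindex:
  assumes ms: "monotone_submodular E f" and g: "bij_betw g J E"
  shows "monotone_submodular J (\<lambda>S. f (g ` S))"
proof -
  interpret monotone_submodular E f by (rule ms)
  have inj: "inj_on g J" and im: "g ` J = E" using g by (auto simp: bij_betw_def)
  have sub: "g ` S \<subseteq> E" if "S \<subseteq> J" for S using that im by blast
  show ?thesis
  proof
    show "finite J" using bij_betw_finite[OF g] finite_ground by simp
    show "submodular_on J (\<lambda>S. f (g ` S))"
      unfolding submodular_on_def
    proof (intro allI impI)
      fix S T assume ST: "S \<subseteq> J \<and> T \<subseteq> J"
      then have "g ` (S \<inter> T) = g ` S \<inter> g ` T" by (intro inj_on_image_Int[OF inj]) auto
      then show "f (g ` (S \<union> T)) + f (g ` (S \<inter> T)) \<le> f (g ` S) + f (g ` T)"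
        using submodD[OF sub sub] ST by (simp add: image_Un)
    qed
    show "mono_on (Pow J) (\<lambda>S. f (g ` S))"
      by (intro mono_onI mono_le) (auto intro: sub[THEN subsetD] dest: sub)
    show "0 \<le> f (g ` S)" if "S \<subseteq> J" for S using nonneg[OF sub[OF that]] .
  qed
qed

lemma knapsack_prog_correct:
  fixes E :: "'a set" and f :: "'a set \<Rightarrow> real" and w :: "'a \<Rightarrow> real" and \<epsilon> :: real
  assumes ms: "monotone_submodular E f" and es: "distinct es" "set es = E" and ne: "E \<noteq> {}"
    and w: "\<And>e. e \<in> E \<Longrightarrow> w e \<in> {0..1}" and \<epsilon>: "0 < \<epsilon>" "\<epsilon> < 1"
    and h: "h = 2200000000"
  shows "\<exists>t. real t \<le> 40000 * 2 ^ (256 * h) * (real (card E) ^ 4 * (1 + 2 * ln (real (card E))) *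
        (1 / \<epsilon>) powr (256 * real h * (1 / \<epsilon>) ^ 8)) \<and>
    halts_within knapsack_prog (knapsack_instance es f w \<epsilon>) t \<and>
    (\<exists>S\<subseteq>E. output_pmf knapsack_prog es f w \<epsilon> t = return_pmf S \<and> sum w S \<le> 1 \<and>
      (\<forall>Opt. knapsack_optimal E f w Opt \<longrightarrow> (1 - curvature E f / exp 1 - \<epsilon>) * f Opt \<le> f S))"
proof -
  interpret f: monotone_submodular E f by (rule ms)
  define I where "I = knapsack_instance es f w \<epsilon>"
  define g where "g = (!) es"
  define m where "m = length es"
  have I: "ground_size I = m" "accuracy I = \<epsilon>" "set_value I = (\<lambda>J. f (g ` J))"
    "weight_at I i = (if i < m then w (g i) else 0)" for i
    by (simp_all add: I_def knapsack_instance_def g_def m_def)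
  have m: "card E = m" using distinct_card[OF es(1)] es(2) by (simp add: m_def)
  have m1: "1 \<le> m" using ne f.finite_ground card_gt_0_iff[of E] by (simp add: m)
  have g: "bij_betw g {..<m} E"
    using bij_betw_nth[OF es(1), of "{..<length es}" E] es(2) by (simp add: g_def m_def)
  have inj: "inj_on g {..<m}" and im: "g ` {..<m} = E" using g by (auto simp: bij_betw_def)
  have wg: "0 \<le> w (g i)" "w (g i) \<le> 1" if "i < m" for i using w[of "g i"] that im by auto
  have sumw: "sum (weight_at I) J = sum w (g ` J)" if "J \<subseteq> {..<m}" for J
  proof -
    have "sum w (g ` J) = sum (\<lambda>i. w (g i)) J"
      using inj_on_subset[OF inj that] by (simp add: sum.reindex)
    also have "\<dots> = sum (weight_at I) J" using that by (intro sum.cong) (auto simp: I)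
    finally show ?thesis by simp
  qed
  obtain N where N: "0 < N" "1 \<le> real N * \<epsilon>" "\<And>j. 0 < j \<Longrightarrow> j < N \<Longrightarrow> real j * \<epsilon> < 1"
  proof -
    obtain j where j: "1 < real j * \<epsilon>" using reals_Archimedean3[OF \<epsilon>(1)] by blast
    then have ex: "0 < j \<and> 1 \<le> real j * \<epsilon>" by (cases j) auto
    define N where "N = (LEAST j. 0 < j \<and> 1 \<le> real j * \<epsilon>)"
    have "0 < N \<and> 1 \<le> real N * \<epsilon>" unfolding N_def using ex by (rule LeastI)
    moreover have "real i * \<epsilon> < 1" if "0 < i" "i < N" for i
      using not_less_Least[of i "\<lambda>j. 0 < j \<and> 1 \<le> real j * \<epsilon>"] that by (auto simp: N_def)
    ultimately show ?thesis using that by blast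
  qed
  interpret r: ram_setting I N
  proof (intro ram_setting.intro ram_setting_axioms.intro)
    show "monotone_submodular {..<ground_size I} (set_value I)"
      unfolding I by (rule monotone_submodular_reindex[OF ms g])
  qed (use N wg in \<open>auto simp: I\<close>)
  let ?s = "\<lparr>nmem = (\<lambda>_ _. 0), rmem = (\<lambda>_ _. 0)\<rparr>"
  obtain t s where t: "t \<le> r.total_time" "run_pmf knapsack_prog I t = return_pmf ([], s)"
    and imp: "improves I r.trials {} (stored_set I s 0 0)"
    using wp_halts[OF r.wp_knapsack[of ?s]] N I(2) by auto
  define J where "J = stored_set I s 0 0"
  define S where "S = g ` J"
  have J: "J \<subseteq> {..<m}" by (auto simp: J_def stored_set_def I)
  have time: "real t \<le> 40000 * 2 ^ (256 * h) * (real m ^ 4 * (1 + 2 * ln (real m)) *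
        (1 / \<epsilon>) powr (256 * real h * (1 / \<epsilon>) ^ 8))"
  proof -
    let ?Z = "(r.k ^ r.M) ^ 5"
    define K where "K = 2 ^ (256 * h) * (1 / \<epsilon>) powr (256 * real h * (1 / \<epsilon>) ^ 8)"
    have "real ?Z \<le> real (2 ^ (h * N ^ 8))"
      using r.guess_count_le unfolding h by (simp only: of_nat_le_iff)
    also have "\<dots> \<le> K" using guess_count_powr[OF \<epsilon> N(3)] by (simp add: K_def)
    finally have Z: "real ?Z \<le> K" .
    have sb: "real r.scale_bound \<le> 1 + 2 * ln (real m)" using r.scale_bound_le m1 by (simp add: I)
    have "t \<le> 40000 * (m ^ 4 * ?Z * r.scale_bound)"
      using t(1) r.total_time_bound m1 by (simp add: I(1))
    then have "real t \<le> real (40000 * (m ^ 4 * ?Z * r.scale_bound))" by (simp only: of_nat_le_iff)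
    also have "\<dots> = 40000 * (real m ^ 4 * (real ?Z * real r.scale_bound))" by simp
    also have "\<dots> \<le> 40000 * (real m ^ 4 * (K * (1 + 2 * ln (real m))))"
      by (intro mult_left_mono mult_mono Z sb) (auto simp: K_def)
    finally show ?thesis by (simp add: K_def algebra_simps)
  qed
  have "halts_within knapsack_prog I t" by (simp add: halts_within_def t(2))
  moreover have "output_pmf knapsack_prog es f w \<epsilon> t = return_pmf S"
    unfolding output_pmf_def I_def[symmetric] Let_def t(2) by (simp add: S_def J_def g_def)
  moreover have "sum w S \<le> 1" using imp sumw[OF J] by (simp add: improves_def J_def S_def)
  moreover have "S \<subseteq> E" using J im by (auto simp: S_def)
  moreover have "(1 - curvature E f / exp 1 - \<epsilon>) * f Opt \<le> f S" if opt: "knapsack_optimal E f w Opt" for Opt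
  proof -
    define A where "A = {i \<in> {..<m}. g i \<in> Opt}"
    have "Opt \<subseteq> E" using opt by (simp add: knapsack_optimal_def knapsack_feasible_def)
    then have A: "A \<subseteq> {..<m}" "g ` A = Opt" using im by (auto simp: A_def)
    have "(1 - curvature E f / exp 1 - \<epsilon>) * f Opt \<le> set_value I J"
    proof (rule r.guarantee[where A = A])
      show "improves I r.trials {} J" using imp by (simp add: J_def)
      show "sum (weight_at I) A \<le> 1"
        using opt sumw[OF A(1)] by (simp add: A knapsack_optimal_def knapsack_feasible_def)
      show "set_value I T \<le> f Opt" if T: "T \<subseteq> {..<ground_size I}" "sum (weight_at I) T \<le> 1" for T
      proof -
        have "T \<subseteq> {..<m}" using T by (simp add: I)
        moreover from this have "g ` T \<subseteq> E" using im by blast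
        ultimately have "knapsack_feasible E w (g ` T)"
          using T(2) sumw by (simp add: knapsack_feasible_def)
        then show ?thesis using opt by (simp add: knapsack_optimal_def I)
      qed
      show "(1 - curvature E f) * set_value I {e} \<le> r.tail e" if "e < ground_size I" for e
      proof -
        have e: "e < m" using that by (simp add: I)
        then have "g ` ({..<m} - {e}) = E - {g e}"
          using inj_on_image_set_diff[OF inj, of "{..<m}" "{e}"] im by auto
        then show ?thesis using f.curvature_bounds(3)[of "g e"] e im unfolding r.tail_def by (auto simp: I)
      qed
    qed (use J A m1 wg f.curvature_bounds N in \<open>auto simp: I\<close>)
    then show ?thesis by (simp add: I S_def)
  qed
  ultimately show ?thesis using time by (auto simp: m I_def)
qed

theorem theorem1p1:
  shows "\<exists>(P :: com) (C :: real) (polylog :: real poly) (q :: real poly).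
    \<forall>(E :: 'a set) (es :: 'a list) (f :: 'a set \<Rightarrow> real) (w :: 'a \<Rightarrow> real) (\<epsilon> :: real) (n :: nat).
      finite E \<and> E \<noteq> {} \<and> n = card E \<and> distinct es \<and> set es = E \<and>
      (\<forall>S. S \<subseteq> E \<longrightarrow> 0 \<le> f S) \<and> mono_on (Pow E) f \<and> submodular_on E f \<and>
      (\<forall>e\<in>E. w e \<in> {0..1}) \<and> \<epsilon> \<in> {0<..<1}
      \<longrightarrow> (\<exists>t :: nat.
            real t \<le> C * (real n ^ 5
                     + real n ^ 4 * poly polylog (ln (real n)) * (1 / \<epsilon>) powr poly q (1 / \<epsilon>)) \<and>
            halts_within P (knapsack_instance es f w \<epsilon>) t \<and>
            (\<forall>S \<in> set_pmf (output_pmf P es f w \<epsilon> t). S \<subseteq> E \<and> sum w S \<le> 1) \<and>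
            (\<forall>Opt. knapsack_optimal E f w Opt \<longrightarrow>
               measure_pmf.expectation (output_pmf P es f w \<epsilon> t) f
                 \<ge> (1 - curvature E f / exp 1 - \<epsilon>) * f Opt))"
proof -
  \<comment> \<open>Obtained and not defined, so that the constant \<open>2 ^ (256 * h)\<close>
    stays symbolic.\<close>
  obtain h :: nat where h: "h = 2200000000" by blast
  define q :: "real poly" where "q = monom (256 * real h) 8"
  define C :: real where "C = 40000 * 2 ^ (256 * h)"
  show ?thesis
  proof (rule exI[of _ knapsack_prog], rule exI[of _ C], rule exI[of _ "[:1, 2:]"], rule exI[of _ q],
      intro allI impI, elim conjE)
    fix E :: "'a set" and es :: "'a list" and f :: "'a set \<Rightarrow> real" and w :: "'a \<Rightarrow> real"
      and \<epsilon> :: real and n :: nat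
    assume a: "finite E" "E \<noteq> {}" "n = card E" "distinct es" "set es = E"
      "\<forall>S. S \<subseteq> E \<longrightarrow> 0 \<le> f S" "mono_on (Pow E) f" "submodular_on E f"
      "\<forall>e\<in>E. w e \<in> {0..1}" "\<epsilon> \<in> {0<..<1}"
    have ms: "monotone_submodular E f" using a by (intro monotone_submodular.intro) auto
    obtain t S where t: "real t \<le> C * (real n ^ 4 * (1 + 2 * ln (real n)) * (1 / \<epsilon>) powr (256 * real h * (1 / \<epsilon>) ^ 8))"
        "halts_within knapsack_prog (knapsack_instance es f w \<epsilon>) t"
      and S: "S \<subseteq> E" "output_pmf knapsack_prog es f w \<epsilon> t = return_pmf S" "sum w S \<le> 1"
        "\<And>Opt. knapsack_optimal E f w Opt \<Longrightarrow> (1 - curvature E f / exp 1 - \<epsilon>) * f Opt \<le> f S"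
      using knapsack_prog_correct[OF ms a(4,5,2) _ _ _ h, of w \<epsilon>] a unfolding C_def by auto
    have "0 \<le> C * real n ^ 5" by (simp add: C_def)
    then have "real t \<le> C * (real n ^ 5 + real n ^ 4 * poly [:1, 2:] (ln (real n)) * (1 / \<epsilon>) powr poly q (1 / \<epsilon>))"
      using t(1) by (simp add: q_def poly_monom distrib_left mult.commute[of _ "2 :: real"])
    then show "\<exists>t. real t \<le> C * (real n ^ 5
          + real n ^ 4 * poly [:1, 2:] (ln (real n)) * (1 / \<epsilon>) powr poly q (1 / \<epsilon>)) \<and>
        halts_within knapsack_prog (knapsack_instance es f w \<epsilon>) t \<and>
        (\<forall>S \<in> set_pmf (output_pmf knapsack_prog es f w \<epsilon> t). S \<subseteq> E \<and> sum w S \<le> 1) \<and>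
        (\<forall>Opt. knapsack_optimal E f w Opt \<longrightarrow>
           measure_pmf.expectation (output_pmf knapsack_prog es f w \<epsilon> t) f
             \<ge> (1 - curvature E f / exp 1 - \<epsilon>) * f Opt)"
      using t(2) S by (intro exI[of _ t]) simp
  qed
qed

end
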